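(* Let $\gamma=(i,j)$ be fixed, with incoming boundary datum $\phi_i=\phi_i(\mu,\omega,t)$ (for $\mu>0$) and test function $\psi_j=\psi_j(t)$, $t\in[0,t_{\max}]$. Let $\eta=\eta(\omega)$ be a reflection coefficient, and let $\mathcal{M}_\gamma(\eta)=\int_0^{t_{\max}}\Delta T_i(x=0,t)\,\psi_j(t)\,dt$ be the measurement, where $\Delta T_i=\langle\omega g_0\rangle/\langle\omega g^\ast\rangle$ and $g_0$ is the solution of $$\begin{cases}\partial_t g_0+\mu\omega\,\partial_x g_0=\mathcal{L}g_0, & x\in[0,1],\\ g_0(x,\mu,\omega,t=0)=0,\\ g_0(x=0,\mu,\omega,t)=\phi_i(\mu,\omega,t), & \mu>0,\\ g_0(x=1,\mu,\omega,t)=\eta(\omega)\,g_0(x=1,-\mu,\omega,t), & \mu<0.\end{cases}$$ Let $h$ be the solution of the adjoint equation $$\begin{cases}\partial_t h+\mu\omega\,\partial_x h=-\mathcal{L}h, & x\in[0,1],\\ h(x,\mu,\omega,t=t_{\max})=0,\\ h(x=0,\mu,\omega,t)=\dfrac{\psi_j(t)\,g^\ast(\omega)}{\mu}, & \mu<0,\\ h(x=1,\mu,\omega,t)=\eta(\omega)\,h(x=1,-\mu,\omega,t), & \mu>0.\end{cases}$$ Then the Fréchet derivative of $\mathcal{M}_\gamma$ at $\eta$ is, as a function of $\omega$, $$\nabla_\eta\mathcal{M}_\gamma(\eta)(\omega)=\frac{1}{\langle\omega g^\ast\rangle}\int_0^{t_{\max}}\int_{-1}^{0}\frac{\mu\,\omega\,h(x=1,\mu,\omega,t)\,g_0(x=1,-\mu,\omega,t)}{g^\ast(\omega)}\,d\mu\,dt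 .$$
   Context: Variables: $x\in[0,1]$, $\mu\in[-1,1]$, $\omega\in(0,\infty)$, $t\in[0,t_{\max}]$. The bracket denotes $\langle f\rangle=\int_{-1}^{1}\int_0^\infty f\,d\omega\,d\mu$. Set $g^\ast(\omega)=\dfrac{\omega^2e^\omega}{(e^\omega-1)^2}$. The linearized BGK collision operator is $\mathcal{L}g=-\omega g+\dfrac{\omega g^\ast}{\langle\omega g^\ast\rangle}\langle\omega g\rangle$. The reflection coefficient $\eta$ is a function of $\omega$ with values between $0$ and $1$. The Fréchet derivative $\nabla_\eta\mathcal{M}_\gamma(\eta)$ is identified with a function of $\omega$ via the pairing in which the first-order change of $\mathcal{M}_\gamma$ under a perturbation $\delta\eta$ of $\eta$ is $\int_0^\infty\nabla_\eta\mathcal{M}_\gamma(\eta)(\omega)\,\delta\eta(\omega)\,d\omega$. *)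

theory Defs
  imports "HOL-Analysis.Analysis" "HOL-Probability.Essential_Supremum"
begin

text \<open>
  Phase-space functions are curried in the order position, angle, frequency, time:
  \<open>g x \<mu> \<omega> t\<close> with \<open>x \<in> [0,1]\<close>, \<open>\<mu> \<in> [-1,1]\<close>, \<open>\<omega> \<in> (0,\<infinity>)\<close>, \<open>t \<in> [0,T]\<close>.
  Values outside these ranges are irrelevant.
\<close>

definition g_star :: "real \<Rightarrow> real" where
  "g_star \<omega> = \<omega>\<^sup>2 * exp \<omega> / (exp \<omega> - 1)\<^sup>2"

definition bracket :: "(real \<Rightarrow> real \<Rightarrow> real) \<Rightarrow> real" where
  "bracket f = (LBINT \<mu>:{-1..1}. (LBINT \<omega>:{0<..}. f \<mu> \<omega>))"

definition collision :: "(real \<Rightarrow> real \<Rightarrow> real) \<Rightarrow> real \<Rightarrow> real \<Rightarrow> real" where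
  "collision f \<mu> \<omega> =
     - \<omega> * f \<mu> \<omega>
     + \<omega> * g_star \<omega> / bracket (\<lambda>\<mu> \<omega>. \<omega> * g_star \<omega>) * bracket (\<lambda>\<mu> \<omega>. \<omega> * f \<mu> \<omega>)"

text \<open>
  \<open>(\<partial>\<^sub>t + c \<partial>\<^sub>x) u = D\<close> at \<open>(x, t)\<close>, where the transport operator is the derivative in the
  direction \<open>(c, 1)\<close>.  For \<open>u\<close> differentiable at \<open>(x, t)\<close> this is the sum of the two partial
  derivatives (lemma \<open>has_transport_derivative_iff\<close>).  The directional form does not need the
  separate partials, which fail to exist across the characteristics issuing from the corners
  of \<open>[0,1] \<times> [0,T]\<close> when boundary and initial (or final) data do not match there.
\<close>

definition has_transport_derivative ::
  "real \<Rightarrow> (real \<Rightarrow> real \<Rightarrow> real) \<Rightarrow> real \<Rightarrow> real \<Rightarrow> real \<Rightarrow> bool" where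
  "has_transport_derivative c u D x t \<longleftrightarrow>
     ((\<lambda>s. u (x + c * s) (t + s)) has_real_derivative D) (at 0)"

lemma has_transport_derivative_iff:
  assumes "((\<lambda>(y, s). u y s) has_derivative (\<lambda>(dy, ds). ux * dy + ut * ds)) (at (x, t))"
  shows "has_transport_derivative c u D x t \<longleftrightarrow> ut + c * ux = D"
proof -
  have line: "((\<lambda>s. (x + c * s, t + s)) has_derivative (\<lambda>s. (c * s, s))) (at 0)"
    by (auto intro!: derivative_eq_intros)
  have "((\<lambda>(y, s). u y s) has_derivative (\<lambda>(dy, ds). ux * dy + ut * ds))
          (at ((\<lambda>s. (x + c * s, t + s)) 0))"
    using assms by simp
  from has_derivative_compose[OF line this]
  have "((\<lambda>s. u (x + c * s) (t + s)) has_derivative (\<lambda>s. ux * (c * s) + ut * s)) (at 0)"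
    by simp
  moreover have "(\<lambda>s. ux * (c * s) + ut * s) = (*) (ut + c * ux)"
    by (simp add: fun_eq_iff algebra_simps)
  ultimately have "((\<lambda>s. u (x + c * s) (t + s)) has_real_derivative (ut + c * ux)) (at 0)"
    by (simp only: has_field_derivative_def)
  then show ?thesis
    unfolding has_transport_derivative_def by (auto dest: DERIV_unique)
qed

text \<open>
  \<open>\<partial>\<^sub>t u + \<mu> \<omega> \<partial>\<^sub>x u = S\<close> in the interior.  The boundary values of \<open>u\<close> at
  \<open>x = 0\<close>, \<open>x = 1\<close>, \<open>t = 0\<close>, \<open>t = T\<close> are its limits along characteristics.
\<close>

definition solves_transport ::
  "real \<Rightarrow> (real \<Rightarrow> real \<Rightarrow> real \<Rightarrow> real \<Rightarrow> real) \<Rightarrow> (real \<Rightarrow> real \<Rightarrow> real \<Rightarrow> real \<Rightarrow> real) \<Rightarrow> bool" where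
  "solves_transport T u S \<longleftrightarrow>
     (\<forall>\<mu>\<in>{-1..1}. \<forall>\<omega>>0.
        (\<forall>x\<in>{0<..<1}. \<forall>t\<in>{0<..<T}.
           has_transport_derivative (\<mu> * \<omega>) (\<lambda>x t. u x \<mu> \<omega> t) (S x \<mu> \<omega> t) x t) \<and>
        (\<forall>x\<in>{0..1}. \<forall>t\<in>{0..T}.
           continuous_on {s. x + \<mu> * \<omega> * s \<in> {0..1} \<and> t + s \<in> {0..T}}
             (\<lambda>s. u (x + \<mu> * \<omega> * s) \<mu> \<omega> (t + s))))"

definition phase_space :: "real \<Rightarrow> (real \<times> real \<times> real \<times> real) set" where
  "phase_space T = {0..1} \<times> {-1..1} \<times> {0<..} \<times> {0..T}"

text \<open>
  Solutions are taken with \<open>g / g\<^sup>*\<close> bounded.  The boundary conditions are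
  imposed for \<open>t > 0\<close>, so that no compatibility of \<open>\<phi>\<close> with the zero initial datum is forced
  at the corner \<open>t = 0\<close>.
\<close>

definition forward_solution ::
  "real \<Rightarrow> (real \<Rightarrow> real \<Rightarrow> real \<Rightarrow> real) \<Rightarrow> (real \<Rightarrow> real) \<Rightarrow>
   (real \<Rightarrow> real \<Rightarrow> real \<Rightarrow> real \<Rightarrow> real) \<Rightarrow> bool" where
  "forward_solution T \<phi> \<eta> g \<longleftrightarrow>
     set_borel_measurable borel (phase_space T) (\<lambda>(x, \<mu>, \<omega>, t). g x \<mu> \<omega> t) \<and>
     (\<exists>C. \<forall>(x, \<mu>, \<omega>, t)\<in>phase_space T. \<bar>g x \<mu> \<omega> t\<bar> \<le> C * g_star \<omega>) \<and>
     solves_transport T g (\<lambda>x \<mu> \<omega> t. collision (\<lambda>\<mu> \<omega>. g x \<mu> \<omega> t) \<mu> \<omega>) \<and>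
     (\<forall>x\<in>{0..1}. \<forall>\<mu>\<in>{-1..1}. \<forall>\<omega>>0. g x \<mu> \<omega> 0 = 0) \<and>
     (\<forall>\<mu>\<in>{0<..1}. \<forall>\<omega>>0. \<forall>t\<in>{0<..T}. g 0 \<mu> \<omega> t = \<phi> \<mu> \<omega> t) \<and>
     (\<forall>\<mu>\<in>{-1..<0}. \<forall>\<omega>>0. \<forall>t\<in>{0<..T}. g 1 \<mu> \<omega> t = \<eta> \<omega> * g 1 (-\<mu>) \<omega> t)"

text \<open>
  The inflow datum \<open>\<psi> g\<^sup>* / \<mu>\<close> is not integrable over \<open>\<mu> \<in> (-1,0)\<close>, so \<open>\<langle>\<omega> h\<rangle>\<close> is finite only
  for \<open>x > 0\<close>, with a logarithmic singularity at \<open>x = 0\<close>.  Hence integrability of \<open>\<omega> h\<close> (which makes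
  the collision operator meaningful) instead of a bound by \<open>g\<^sup>*\<close>.
\<close>

definition adjoint_solution ::
  "real \<Rightarrow> (real \<Rightarrow> real) \<Rightarrow> (real \<Rightarrow> real) \<Rightarrow>
   (real \<Rightarrow> real \<Rightarrow> real \<Rightarrow> real \<Rightarrow> real) \<Rightarrow> bool" where
  "adjoint_solution T \<psi> \<eta> h \<longleftrightarrow>
     set_integrable lborel (phase_space T) (\<lambda>(x, \<mu>, \<omega>, t). \<omega> * h x \<mu> \<omega> t) \<and>
     (\<forall>x\<in>{0<..<1}. \<forall>t\<in>{0<..<T}.
        set_integrable lborel ({-1..1} \<times> {0<..}) (\<lambda>(\<mu>, \<omega>). \<omega> * h x \<mu> \<omega> t)) \<and>
     solves_transport T h (\<lambda>x \<mu> \<omega> t. - collision (\<lambda>\<mu> \<omega>. h x \<mu> \<omega> t) \<mu> \<omega>) \<and>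
     (\<forall>x\<in>{0..1}. \<forall>\<mu>\<in>{-1..1}. \<forall>\<omega>>0. h x \<mu> \<omega> T = 0) \<and>
     (\<forall>\<mu>\<in>{-1..<0}. \<forall>\<omega>>0. \<forall>t\<in>{0..<T}. h 0 \<mu> \<omega> t = \<psi> t * g_star \<omega> / \<mu>) \<and>
     (\<forall>\<mu>\<in>{0<..1}. \<forall>\<omega>>0. \<forall>t\<in>{0..<T}. h 1 \<mu> \<omega> t = \<eta> \<omega> * h 1 (-\<mu>) \<omega> t)"

definition temperature ::
  "(real \<Rightarrow> real \<Rightarrow> real \<Rightarrow> real \<Rightarrow> real) \<Rightarrow> real \<Rightarrow> real \<Rightarrow> real" where
  "temperature g x t =
     bracket (\<lambda>\<mu> \<omega>. \<omega> * g x \<mu> \<omega> t) / bracket (\<lambda>\<mu> \<omega>. \<omega> * g_star \<omega>)"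

definition measurement ::
  "real \<Rightarrow> (real \<Rightarrow> real) \<Rightarrow> (real \<Rightarrow> real \<Rightarrow> real \<Rightarrow> real \<Rightarrow> real) \<Rightarrow> real" where
  "measurement T \<psi> g = (LBINT t:{0..T}. temperature g 0 t * \<psi> t)"

definition reflection_coefficients :: "(real \<Rightarrow> real) set" where
  "reflection_coefficients =
     {\<eta>. \<eta> \<in> borel_measurable (restrict_space borel {0<..}) \<and> (\<forall>\<omega>>0. 0 \<le> \<eta> \<omega> \<and> \<eta> \<omega> \<le> 1)}"

definition Linf_norm :: "(real \<Rightarrow> real) \<Rightarrow> real" where
  "Linf_norm f =
     real_of_ereal (esssup (restrict_space lborel {0<..}) (\<lambda>\<omega>. ereal \<bar>f \<omega>\<bar>))"

text \<open>
  Frechet differentiability at \<open>\<eta>\<close> in \<open>L\<^sup>\<infinity>(0,\<infinity>)\<close> within the set \<open>E\<close> on which \<open>F\<close> is defined, with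
  the derivative represented as \<open>\<delta> \<mapsto> \<integral> G \<delta> d\<omega>\<close>; integrability of \<open>G\<close> makes this functional
  bounded.  It is \<open>has_derivative\<close> within \<open>E\<close> written out, since \<open>L\<^sup>\<infinity>\<close> is not a normed type in the
  library.  For \<open>E = reflection_coefficients\<close> the gradient is unique almost everywhere, because
  at each \<open>\<omega>\<close> at least one sign of perturbation stays in \<open>[0,1]\<close>.
\<close>

definition has_frechet_gradient_within ::
  "((real \<Rightarrow> real) \<Rightarrow> real) \<Rightarrow> (real \<Rightarrow> real) \<Rightarrow> (real \<Rightarrow> real) \<Rightarrow> (real \<Rightarrow> real) set \<Rightarrow> bool" where
  "has_frechet_gradient_within F G \<eta> E \<longleftrightarrow>
     set_integrable lborel {0<..} G \<and>
     (\<forall>\<epsilon>>0. \<exists>d>0. \<forall>\<eta>'\<in>E. Linf_norm (\<lambda>\<omega>. \<eta>' \<omega> - \<eta> \<omega>) < d \<longrightarrow>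
        \<bar>F \<eta>' - F \<eta> - (LBINT \<omega>:{0<..}. G \<omega> * (\<eta>' \<omega> - \<eta> \<omega>))\<bar>
          \<le> \<epsilon> * Linf_norm (\<lambda>\<omega>. \<eta>' \<omega> - \<eta> \<omega>))"

end

theory Submission
  imports Defs "HOL-Probability.Distributions"
begin

text \<open>
  Let \<open>d\<close> be the difference of the forward solutions for \<open>\<eta>'\<close> and \<open>\<eta>\<close>.  The collision operator is
  self-adjoint for the weight \<open>1 / g\<^sup>*\<close>, so integrating the transport derivative of \<open>d h / g\<^sup>*\<close>
  leaves only boundary terms.  The one at \<open>x = 0\<close> is the difference of the measurements, times
  \<open>\<langle>\<omega> g\<^sup>*\<rangle>\<close>; the one at \<open>x = 1\<close> is exactly the claimed gradient paired with \<open>\<eta>' - \<eta>\<close>, except that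
  the forward solution in it is the one for \<open>\<eta>'\<close>.  Replacing it by the one for \<open>\<eta>\<close> costs
  \<open>O(\<parallel>\<eta>' - \<eta>\<parallel>\<^sup>2)\<close>: a maximum principle gives \<open>\<bar>d\<bar> \<le> K \<parallel>\<eta>' - \<eta>\<parallel> g\<^sup>*\<close>, and an \<open>L\<^sup>1\<close> estimate along
  characteristics shows that the trace \<open>\<mu> \<omega> h\<close> at \<open>x = 1\<close> is integrable.
\<close>

text \<open>The datum of \<open>h\<close> behaves like 1 / \<mu>, and only integrability of \<omega>
  h is available on the adjoint side. Every pairing is therefore of type L1 against L-infinity: the
  factor \<mu> in the flux \<mu> \<omega> h cancels the singularity of the datum, and forward
  solutions divided by \<open>g_star\<close> are bounded. This is why stability has to be measured
  in a supremum norm. A Gronwall argument would need a bound on the collision frequency \<omega>;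
  the weight exp t instead leaves the factor \<omega> / (\<omega> + 1), whose mean is less than 1.
  Mismatched data at the corners can destroy the partial derivatives, so integration by parts is
  replaced by the fundamental theorem of calculus on each single characteristic. The exact boundary
  term at x = 1 carries the solution for \<eta>' because \<eta>' g' - \<eta> g - \<eta> (g' - g) =
  (\<eta>' - \<eta>) g'.\<close>

lemma g_star_pos: "0 < \<omega> \<Longrightarrow> 0 < g_star \<omega>"
  by (simp add: g_star_def)

lemma g_star_nonneg: "0 \<le> g_star \<omega>"
  by (simp add: g_star_def)

lemma measurable_g_star [measurable]: "g_star \<in> borel_measurable borel"
  unfolding g_star_def by measurable

text \<open>Since 1 + \<omega> \<le> exp \<omega>, the quotient \<omega> exp \<omega> / (exp
  \<omega> - 1) is at most 1 + \<omega>, and \<open>g_star\<close> is the square of that quotient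
  times exp (- \<omega>). The bound removes the denominator that vanishes at 0.\<close>

lemma g_star_le: assumes "0 < \<omega>" shows "g_star \<omega> \<le> (1 + \<omega>)\<^sup>2 * exp (- \<omega>)"
proof -
  have "1 + \<omega> \<le> exp \<omega>" by (rule exp_ge_add_one_self)
  then have "\<omega> * exp \<omega> \<le> (1 + \<omega>) * (exp \<omega> - 1)"
    by (simp add: algebra_simps)
  then have "(\<omega> * exp \<omega>)\<^sup>2 \<le> ((1 + \<omega>) * (exp \<omega> - 1))\<^sup>2"
    using assms by (intro power_mono) auto
  moreover have "g_star \<omega> = (\<omega> * exp \<omega>)\<^sup>2 / (exp \<omega> - 1)\<^sup>2 * exp (- \<omega>)"
    by (simp add: g_star_def exp_minus power2_eq_square)
  ultimately show ?thesis
    using assms by (simp add: divide_le_eq power_mult_distrib)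
qed

text \<open>The majorant \<omega> (1 + \<omega>)^2 exp (- \<omega>) expands into the moments of
  order 1, 2 and 3 of the exponential density, which are Gamma integrals.\<close>

lemma integrable_omega_g_star:
  "integrable lborel (\<lambda>\<omega>::real. indicator {0<..} \<omega> * (\<omega> * g_star \<omega>))"
proof -
  have "integrable lborel (\<lambda>x::real. x ^ k * exp (- x) * indicator {0..} x)" for k :: nat
  proof (rule integrableI_nonneg)
    show "(\<integral>\<^sup>+ x. ennreal (x ^ k * exp (- x) * indicator {0..} x) \<partial>lborel) < \<infinity>"
      using nn_intergal_power_times_exp_Ici[of k]
      by (auto simp: ennreal_mult'' ennreal_indicator)
  qed (auto simp: indicator_def)
  from this[of 1] this[of 2] this[of 3]
  have "integrable lborel (\<lambda>x::real. x ^ 1 * exp (- x) * indicator {0..} x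
    + 2 * (x ^ 2 * exp (- x) * indicator {0..} x) + x ^ 3 * exp (- x) * indicator {0..} x)"
    by (intro Bochner_Integration.integrable_add integrable_mult_right)
  then show ?thesis
  proof (rule Bochner_Integration.integrable_bound)
    show "AE x in lborel. norm (indicator {0<..} x * (x * g_star x))
      \<le> norm (x ^ 1 * exp (- x) * indicator {0..} x
        + 2 * (x ^ 2 * exp (- x) * indicator {0..} x) + x ^ 3 * exp (- x) * indicator {0..} x)"
    proof (rule AE_I2)
      fix x :: real
      have "x * g_star x \<le> x * ((1 + x)\<^sup>2 * exp (- x))" if "0 < x"
        using g_star_le[OF that] that by (intro mult_left_mono) auto
      then show "norm (indicator {0<..} x * (x * g_star x))
        \<le> norm (x ^ 1 * exp (- x) * indicator {0..} x
          + 2 * (x ^ 2 * exp (- x) * indicator {0..} x) + x ^ 3 * exp (- x) * indicator {0..} x)"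
        using g_star_nonneg[of x]
        by (auto simp: indicator_def abs_mult field_simps power2_eq_square power3_eq_cube)
    qed
  qed measurable
qed

subsection \<open>Lebesgue-preserving changes of coordinates\<close>

text \<open>Stated through the image measure, so that integrability, integrals and measurability all
  transfer by the general facts on \<open>distr\<close>. Source and target may be different types,
  because regrouping a tuple changes its type.\<close>

definition preserves_lborel :: "('a::euclidean_space \<Rightarrow> 'b::euclidean_space) \<Rightarrow> bool" where
  "preserves_lborel f \<longleftrightarrow> f \<in> borel_measurable borel \<and> distr lborel borel f = lborel"

lemma preserves_lborelI:
  fixes f :: "'a::euclidean_space \<Rightarrow> 'b::euclidean_space"
  assumes [measurable]: "f \<in> borel_measurable borel"
    and "\<And>A. A \<in> sets borel \<Longrightarrow>
      (\<integral>\<^sup>+ z. indicator A (f z) \<partial>lborel) = (\<integral>\<^sup>+ z. indicator A z \<partial>lborel)"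
  shows "preserves_lborel f"
  unfolding preserves_lborel_def
proof (intro conjI measure_eqI)
  fix A :: "'b set"
  assume "A \<in> sets (distr lborel borel f)"
  then have A[measurable]: "A \<in> sets borel" by simp
  have "emeasure (distr lborel borel f) A = (\<integral>\<^sup>+ z. indicator A z \<partial>distr lborel borel f)"
    by simp
  also have "\<dots> = (\<integral>\<^sup>+ z. indicator A (f z) \<partial>lborel)"
    by (rule nn_integral_distr) auto
  finally show "emeasure (distr lborel borel f) A = emeasure lborel A"
    using assms(2)[OF A] by simp
qed (use assms(1) in simp_all)

lemma integrable_lborel_transform:
  fixes f :: "'a::euclidean_space \<Rightarrow> 'b::euclidean_space" and F :: "'b \<Rightarrow> real"
  assumes "preserves_lborel f" and "integrable lborel F"
  shows "integrable lborel (\<lambda>z. F (f z))"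
proof -
  have "F \<in> borel_measurable borel" using assms(2) by auto
  then show ?thesis
    using integrable_distr_eq[of f lborel borel F] assms by (simp add: preserves_lborel_def)
qed

lemma integral_lborel_transform:
  fixes f :: "'a::euclidean_space \<Rightarrow> 'b::euclidean_space" and F :: "'b \<Rightarrow> real"
  assumes "preserves_lborel f" and "F \<in> borel_measurable borel"
  shows "(LINT z|lborel. F (f z)) = (LINT z|lborel. F z)"
  using integral_distr[of f lborel borel F] assms by (simp add: preserves_lborel_def)

lemma nn_integral_lborel_transform:
  fixes f :: "'a::euclidean_space \<Rightarrow> 'b::euclidean_space" and F :: "'b \<Rightarrow> ennreal"
  assumes "preserves_lborel f" and "F \<in> borel_measurable borel"
  shows "(\<integral>\<^sup>+ z. F (f z) \<partial>lborel) = (\<integral>\<^sup>+ z. F z \<partial>lborel)"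
  using nn_integral_distr[of f lborel borel F] assms by (simp add: preserves_lborel_def)

lemma measurable_lborel_transform:
  assumes "preserves_lborel f" and "F \<in> borel_measurable borel"
  shows "(\<lambda>z. F (f z)) \<in> borel_measurable borel"
  using assms unfolding preserves_lborel_def by (auto intro: measurable_compose)

lemma preserves_lborel_compose:
  fixes f :: "'b::euclidean_space \<Rightarrow> 'c::euclidean_space"
    and g :: "'a::euclidean_space \<Rightarrow> 'b"
  assumes "preserves_lborel f" "preserves_lborel g"
  shows "preserves_lborel (\<lambda>z. f (g z))"
proof (rule preserves_lborelI)
  have m: "f \<in> borel_measurable borel" "g \<in> borel_measurable borel"
    using assms by (auto simp: preserves_lborel_def)
  then show "(\<lambda>z. f (g z)) \<in> borel_measurable borel"
    using measurable_compose by blast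
  fix A :: "'c set"
  assume [measurable]: "A \<in> sets borel"
  have "(\<lambda>z. indicator A (f z) :: ennreal) \<in> borel_measurable borel"
    by (rule measurable_compose[OF m(1)]) simp
  then show "(\<integral>\<^sup>+ z. indicator A (f (g z)) \<partial>lborel) = (\<integral>\<^sup>+ z. indicator A z \<partial>lborel)"
    using nn_integral_lborel_transform[OF assms(2), of "\<lambda>z. indicator A (f z)"]
      nn_integral_lborel_transform[OF assms(1), of "indicator A"] by simp
qed

lemma nn_integral_lborel_pair:
  fixes F :: "'a::euclidean_space \<times> 'b::euclidean_space \<Rightarrow> ennreal"
  assumes "F \<in> borel_measurable borel"
  shows "(\<integral>\<^sup>+ z. F z \<partial>lborel) = (\<integral>\<^sup>+ x. \<integral>\<^sup>+ y. F (x, y) \<partial>lborel \<partial>lborel)"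
  using lborel.nn_integral_fst[of F "lborel :: 'a measure"] assms
  by (simp add: lborel_prod)

lemma nn_integral_lborel_swap:
  fixes F :: "'a::euclidean_space \<Rightarrow> 'b::euclidean_space \<Rightarrow> ennreal"
  assumes "(\<lambda>(x, y). F x y) \<in> borel_measurable borel"
  shows "(\<integral>\<^sup>+ x. \<integral>\<^sup>+ y. F x y \<partial>lborel \<partial>lborel) = (\<integral>\<^sup>+ y. \<integral>\<^sup>+ x. F x y \<partial>lborel \<partial>lborel)"
  using lborel_pair.Fubini'[of F] assms by (simp add: lborel_prod)

lemma preserves_lborel_uminus: "preserves_lborel (uminus :: real \<Rightarrow> real)"
proof (rule preserves_lborelI)
  fix A :: "real set"
  assume [measurable]: "A \<in> sets borel"
  show "(\<integral>\<^sup>+ z. indicator A (- z) \<partial>lborel) = (\<integral>\<^sup>+ z. indicator A z \<partial>lborel)"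
    using nn_integral_real_affine[of "indicator A" "-1" 0] by simp
qed simp

text \<open>For fixed x the map is a translation in t. With a = 1 / c it straightens
  characteristics: the line with constant second coordinate \<tau> is sent to t = \<tau> + x /
  c.\<close>

lemma preserves_lborel_shear: "preserves_lborel (\<lambda>(x::real, t::real). (x, t + a * x))"
proof (rule preserves_lborelI)
  show m: "(\<lambda>(x, t). (x, t + a * x)) \<in> borel_measurable (borel :: (real \<times> real) measure)"
    unfolding borel_prod[symmetric] by measurable
  fix A :: "(real \<times> real) set"
  assume [measurable]: "A \<in> sets borel"
  have "(\<integral>\<^sup>+ t. indicator A (x, t + a * x) \<partial>lborel) = (\<integral>\<^sup>+ t. indicator A (x, t) \<partial>lborel)" for x
    using nn_integral_real_affine[of "\<lambda>t. indicator A (x, t) :: ennreal" 1 "a * x"]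
    by (simp add: add.commute)
  moreover have "(\<lambda>z. indicator A ((\<lambda>(x, t). (x, t + a * x)) z) :: ennreal) \<in> borel_measurable borel"
    by (rule measurable_compose[OF m]) simp
  ultimately show "(\<integral>\<^sup>+ z. indicator A ((\<lambda>(x, t). (x, t + a * x)) z) \<partial>lborel)
      = (\<integral>\<^sup>+ z. indicator A z \<partial>lborel)"
    by (subst (1 2) nn_integral_lborel_pair) auto
qed

lemma preserves_lborel_swap:
  "preserves_lborel (\<lambda>(x::'a::euclidean_space, y::'b::euclidean_space). (y, x))"
proof (rule preserves_lborelI)
  show m: "(\<lambda>(x, y). (y, x)) \<in> borel_measurable (borel :: ('a \<times> 'b) measure)"
    unfolding borel_prod[symmetric] by measurable
  fix A :: "('b \<times> 'a) set"
  assume [measurable]: "A \<in> sets borel"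
  have "(\<lambda>z. indicator A ((\<lambda>(x, y). (y, x)) z) :: ennreal) \<in> borel_measurable borel"
    by (rule measurable_compose[OF m]) simp
  then show "(\<integral>\<^sup>+ z. indicator A ((\<lambda>(x, y). (y, x)) z) \<partial>lborel)
      = (\<integral>\<^sup>+ z. indicator A z \<partial>lborel)"
    by (subst (1 2) nn_integral_lborel_pair)
      (auto intro!: nn_integral_lborel_swap simp: case_prod_unfold)
qed

lemma preserves_lborel_assoc:
  "preserves_lborel
    (\<lambda>((x::'a::euclidean_space, y::'b::euclidean_space), z::'c::euclidean_space). (x, y, z))"
proof (rule preserves_lborelI)
  show m: "(\<lambda>((x, y), z). (x, y, z)) \<in> borel_measurable (borel :: (('a \<times> 'b) \<times> 'c) measure)"
    unfolding borel_prod[symmetric] case_prod_unfold by measurable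
  fix A :: "('a \<times> 'b \<times> 'c) set"
  assume A[measurable]: "A \<in> sets borel"
  have m1: "(\<lambda>z. indicator A ((\<lambda>((x, y), z). (x, y, z)) z) :: ennreal) \<in> borel_measurable borel"
    by (rule measurable_compose[OF m]) simp
  have m2: "(\<lambda>w. \<integral>\<^sup>+ z. indicator A (fst w, snd w, z) \<partial>lborel) \<in> borel_measurable (borel :: ('a \<times> 'b) measure)"
    using A unfolding borel_prod[symmetric] by measurable
  have m3: "(\<lambda>w. indicator A (x, w) :: ennreal) \<in> borel_measurable (borel :: ('b \<times> 'c) measure)" for x
    using A unfolding borel_prod[symmetric] by measurable
  show "(\<integral>\<^sup>+ z. indicator A ((\<lambda>((x, y), z). (x, y, z)) z) \<partial>lborel)
      = (\<integral>\<^sup>+ z. indicator A z \<partial>lborel)"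
    using m1 m2 m3
    by (simp add: nn_integral_lborel_pair case_prod_unfold del: nn_integral_indicator)
qed

lemma preserves_lborel_map_prod:
  fixes f :: "'a::euclidean_space \<Rightarrow> 'c::euclidean_space"
    and g :: "'b::euclidean_space \<Rightarrow> 'd::euclidean_space"
  assumes f: "preserves_lborel f" and g: "preserves_lborel g"
  shows "preserves_lborel (map_prod f g)"
proof (rule preserves_lborelI)
  have [measurable]: "f \<in> borel_measurable borel" "g \<in> borel_measurable borel"
    using assms by (auto simp: preserves_lborel_def)
  show m: "map_prod f g \<in> borel_measurable borel"
    unfolding borel_prod[symmetric] map_prod_def case_prod_unfold by measurable
  fix A :: "('c \<times> 'd) set"
  assume A[measurable]: "A \<in> sets borel"
  have m1: "(\<lambda>z. indicator A (map_prod f g z) :: ennreal) \<in> borel_measurable borel"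
    by (rule measurable_compose[OF m]) simp
  have m2: "(\<lambda>w. \<integral>\<^sup>+ z. indicator A (w, z) \<partial>lborel) \<in> borel_measurable (borel :: 'c measure)"
    and m3: "(\<lambda>z. indicator A (w, z) :: ennreal) \<in> borel_measurable (borel :: 'd measure)" for w
    using A unfolding borel_prod[symmetric] by measurable
  show "(\<integral>\<^sup>+ z. indicator A (map_prod f g z) \<partial>lborel) = (\<integral>\<^sup>+ z. indicator A z \<partial>lborel)"
    using m1 nn_integral_lborel_transform[OF g m3] nn_integral_lborel_transform[OF f m2]
    by (simp add: nn_integral_lborel_pair del: nn_integral_indicator)
qed

lemma preserves_lborel_id: "preserves_lborel (\<lambda>z. z)"
  by (rule preserves_lborelI) auto

text \<open>Composition with this map turns a function on phase space into one of the pair of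
  velocity and (x, t). Fubini can then be used both ways: averages fix (x, t), transport estimates
  fix (\<mu>, \<omega>).\<close>

lemma preserves_lborel_phase:
  "preserves_lborel (\<lambda>((\<mu>::real, \<omega>::real), (x::real, t::real)). (x, \<mu>, \<omega>, t))"
proof -
  have "preserves_lborel (\<lambda>z. map_prod (\<lambda>x::real. x) (\<lambda>(t::real, (\<mu>::real, \<omega>::real)). (\<mu>, \<omega>, t)) z)"
    using preserves_lborel_map_prod[OF preserves_lborel_id
        preserves_lborel_compose[OF preserves_lborel_assoc[where 'a=real and 'b=real and 'c=real]
          preserves_lborel_swap[where 'a=real and 'b="real \<times> real"]]]
    by (simp add: case_prod_unfold)
  from preserves_lborel_compose[OF this preserves_lborel_compose[OF
      preserves_lborel_assoc[where 'a=real and 'b=real and 'c="real \<times> real"]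
      preserves_lborel_swap[where 'a="real \<times> real" and 'b="real \<times> real"]]]
  show ?thesis
    by (simp add: case_prod_unfold)
qed

lemma preserves_lborel_reflect:
  "preserves_lborel (\<lambda>((\<mu>::real, \<omega>::real), t::real). ((- \<mu>, \<omega>), t))"
  using preserves_lborel_map_prod[OF preserves_lborel_map_prod[OF preserves_lborel_uminus
      preserves_lborel_id[where 'a=real]] preserves_lborel_id[where 'a=real]]
  by (simp add: case_prod_unfold map_prod_def)

text \<open>Makes \<omega> the outermost variable, the order in which the gradient is written as an
  iterated integral.\<close>

lemma preserves_lborel_rotate:
  "preserves_lborel (\<lambda>(\<omega>::real, (t::real, \<mu>::real)). ((\<mu>, \<omega>), t))"
  using preserves_lborel_compose[OF preserves_lborel_swap[where 'a=real and 'b="real \<times> real"]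
    preserves_lborel_compose[OF preserves_lborel_assoc[where 'a=real and 'b=real and 'c=real]
      preserves_lborel_swap[where 'a=real and 'b="real \<times> real"]]]
  by (simp add: case_prod_unfold)

subsection \<open>Transport along characteristics\<close>

text \<open>
  Extending \<open>u\<close> by zero to all times lets every characteristic run through the whole of \<open>[0,1]\<close>,
  so that integrating over \<open>\<tau>\<close> only needs translation invariance.
\<close>

lemma transport_FTC:
  fixes u D :: "real \<Rightarrow> real \<Rightarrow> real" and T c \<tau> :: real
  defines "U \<equiv> \<lambda>x t. indicator {0..T} t * u x t"
  assumes T: "0 < T" and c: "c \<noteq> 0"
    and der: "\<And>x t. x \<in> {0<..<1} \<Longrightarrow> t \<in> {0<..<T} \<Longrightarrow> has_transport_derivative c u (D x t) x t"
    and cont: "\<And>x t. x \<in> {0..1} \<Longrightarrow> t \<in> {0..T} \<Longrightarrow>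
      continuous_on {s. x + c * s \<in> {0..1} \<and> t + s \<in> {0..T}} (\<lambda>s. u (x + c * s) (t + s))"
    and uT: "\<And>x. x \<in> {0..1} \<Longrightarrow> u x T = 0"
    and u0: "(\<forall>x\<in>{0..1}. u x 0 = 0) \<or> (\<forall>x\<in>{0..1}. 0 \<le> \<tau> + x / c)"
  shows "((\<lambda>x. indicator {0<..<T} (\<tau> + x / c) * D x (\<tau> + x / c))
    has_integral c * (U 1 (\<tau> + 1 / c) - U 0 \<tau>)) {0..1}"
proof -
  let ?\<theta> = "\<lambda>x. \<tau> + x / c"
  \<comment> \<open>The pieces collect the points where the time on the characteristic lies in
    [0,T], before it and after it. They overlap only at times 0 and T, where the extension by zero
    stays continuous because \<open>u\<close> vanishes. If \<open>u\<close> need not vanish at time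
    0, then \<open>B\<close> is empty and the second alternative of \<open>u0\<close> keeps all
    times nonnegative.\<close>
  define A where "A = {x\<in>{0..1}. ?\<theta> x \<in> {0..T}}"
  define B where "B = (if \<forall>x\<in>{0..1}. u x 0 = 0 then {x\<in>{0..1}. ?\<theta> x \<le> 0} else {})"
  define E where "E = {x\<in>{0..1}. T \<le> ?\<theta> x}"
  have "closed A" "closed E"
    unfolding A_def E_def
    by (intro closed_Collect_conj closed_Collect_le continuous_intros
        | simp add: c)+
  moreover have "closed {x\<in>{0..1}. ?\<theta> x \<le> 0}"
    by (intro closed_Collect_conj closed_Collect_le continuous_intros
        | simp add: c)+
  then have "closed B"
    by (simp add: B_def)
  moreover have AU: "continuous_on A (\<lambda>x. U x (?\<theta> x))"
  proof (cases "A = {}")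
    case False
    then obtain x0 where x0: "x0 \<in> {0..1}" "?\<theta> x0 \<in> {0..T}"
      by (auto simp: A_def)
    let ?s = "\<lambda>x. (x - x0) / c"
    have eq: "x0 + c * ?s x = x" "?\<theta> x0 + ?s x = ?\<theta> x" for x
      using c by (auto simp: field_simps)
    have "continuous_on (?s ` A) (\<lambda>s. u (x0 + c * s) (?\<theta> x0 + s))"
      using cont[OF x0] by (rule continuous_on_subset) (use eq in \<open>auto simp: A_def add.assoc\<close>)
    then have "continuous_on A ((\<lambda>s. u (x0 + c * s) (?\<theta> x0 + s)) \<circ> ?s)"
      by (intro continuous_on_compose continuous_intros) (use c in auto)
    then have "continuous_on A (\<lambda>x. u x (?\<theta> x))"
      by (simp only: o_def eq)
    then show ?thesis
      by (rule continuous_on_eq) (auto simp: A_def U_def)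
  qed simp
  moreover have "continuous_on B (\<lambda>x. U x (?\<theta> x))"
    by (rule continuous_on_eq[OF continuous_on_const[of _ 0]])
      (auto simp: B_def U_def indicator_def split: if_splits)
  moreover have "U x (?\<theta> x) = 0" if "x \<in> E" for x
    using that uT[of x] by (cases "?\<theta> x = T") (auto simp: E_def U_def)
  then have "continuous_on E (\<lambda>x. U x (?\<theta> x))"
    by (intro continuous_on_eq[OF continuous_on_const[of _ 0]]) auto
  ultimately have "continuous_on (A \<union> B \<union> E) (\<lambda>x. U x (?\<theta> x))"
    by (intro continuous_on_closed_Un closed_Un)
  moreover have "A \<union> B \<union> E = {0..1}"
    using u0 by (force simp: A_def B_def E_def)
  ultimately have CU: "continuous_on {0..1} (\<lambda>x. U x (?\<theta> x))"
    by simp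
  \<comment> \<open>The two exceptional points are those where the characteristic crosses the times
    0 and T; there the extension is continuous but may have a kink.\<close>
  have "((\<lambda>x. indicator {0<..<T} (?\<theta> x) * D x (?\<theta> x) / c)
    has_integral (U 1 (?\<theta> 1) - U 0 (?\<theta> 0))) {0..1}"
  proof (rule fundamental_theorem_of_calculus_interior_strong[where S="{- \<tau> * c, (T - \<tau>) * c}"])
    fix x assume x: "x \<in> {0<..<1} - {- \<tau> * c, (T - \<tau>) * c}"
    then have ne: "?\<theta> x \<noteq> 0" "?\<theta> x \<noteq> T"
      using c by (auto simp: field_simps)
    have \<theta>c: "(?\<theta> \<longlongrightarrow> ?\<theta> x) (nhds x)"
      using c by (intro tendsto_intros filterlim_ident) auto
    consider "?\<theta> x \<in> {0<..<T}" | "?\<theta> x \<in> - {0..T}"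
      using ne by force
    then show "((\<lambda>x. U x (?\<theta> x)) has_vector_derivative
        indicator {0<..<T} (?\<theta> x) * D x (?\<theta> x) / c) (at x)"
    proof cases
      case 1
      have "((\<lambda>s. u (x + c * s) (?\<theta> x + s)) has_real_derivative D x (?\<theta> x)) (at ((x - x) / c))"
        using der[of x "?\<theta> x"] 1 x by (simp add: has_transport_derivative_def)
      moreover have "((\<lambda>y. (y - x) / c) has_real_derivative 1 / c) (at x)"
        using c by (auto intro!: derivative_eq_intros)
      ultimately have "((\<lambda>y. u (x + c * ((y - x) / c)) (?\<theta> x + (y - x) / c))
          has_real_derivative D x (?\<theta> x) * (1 / c)) (at x)"
        by (rule DERIV_chain2)
      moreover have "x + c * ((y - x) / c) = y" "?\<theta> x + (y - x) / c = ?\<theta> y" for y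
        using c by (auto simp: field_simps)
      ultimately have du: "((\<lambda>y. u y (?\<theta> y)) has_real_derivative D x (?\<theta> x) / c) (at x)"
        by (simp only: times_divide_eq_right mult_1_right)
      have "\<forall>\<^sub>F y in nhds x. U y (?\<theta> y) = u y (?\<theta> y)"
        using topological_tendstoD[OF \<theta>c open_greaterThanLessThan 1]
        by eventually_elim (auto simp: U_def)
      then have "((\<lambda>y. U y (?\<theta> y)) has_real_derivative D x (?\<theta> x) / c) (at x)"
        by (subst DERIV_cong_ev[OF refl _ refl]) (use du in auto)
      then show ?thesis
        using 1 by (simp add: has_real_derivative_iff_has_vector_derivative)
    next
      case 2
      have "\<forall>\<^sub>F y in nhds x. U y (?\<theta> y) = 0"
        using topological_tendstoD[OF \<theta>c open_Compl[OF closed_atLeastAtMost] 2]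
        by eventually_elim (auto simp: U_def)
      then have "((\<lambda>y. U y (?\<theta> y)) has_real_derivative 0) (at x)"
        by (subst DERIV_cong_ev[OF refl _ refl]) auto
      then show ?thesis
        using 2 by (auto simp: has_real_derivative_iff_has_vector_derivative indicator_def)
    qed
  qed (use CU in auto)
  from has_integral_mult_right[OF this, of c] show ?thesis
    using c by simp
qed

text \<open>The fundamental theorem of calculus only yields a gauge integral, which need not
  converge absolutely. If the right side is finite, the function is Lebesgue integrable and both
  integrals agree; otherwise there is nothing to show. The trace estimate can thus be made on every
  characteristic, with no prior integrability of the source.\<close>

lemma has_integral_le_nn_integral:
  fixes f :: "'a::euclidean_space \<Rightarrow> real"
  assumes [measurable]: "f \<in> borel_measurable borel" and I: "(f has_integral I) UNIV"
  shows "ennreal \<bar>I\<bar> \<le> (\<integral>\<^sup>+ x. ennreal \<bar>f x\<bar> \<partial>lborel)"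
proof (cases "(\<integral>\<^sup>+ x. ennreal \<bar>f x\<bar> \<partial>lborel) = \<infinity>")
  case False
  then have f: "integrable lborel f"
    by (simp add: integrable_iff_bounded less_top)
  then have "I = (LINT x|lborel. f x)"
    by (intro has_integral_unique[OF I] has_integral_integral_lborel)
  then show ?thesis
    using integral_norm_bound_ennreal[OF f] by simp
qed simp

text \<open>In the coordinates (x, \<tau>) of the shear each \<tau> labels one characteristic, and
  \<open>transport_FTC\<close> evaluates its integral as the jump from x = 0 to x = 1. The end x = 1
  is met at the shifted time \<tau> + 1 / c; integrating over all real \<tau> makes the shift
  disappear.\<close>

lemma transport_green:
  fixes u D :: "real \<Rightarrow> real \<Rightarrow> real" and T c :: real
  defines "F \<equiv> \<lambda>x t. indicator ({0<..<1} \<times> {0<..<T}) (x, t) * D x t"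
    and "U \<equiv> \<lambda>x t. indicator {0..T} t * u x t"
  assumes T: "0 < T" and c: "c \<noteq> 0"
    and der: "\<And>x t. x \<in> {0<..<1} \<Longrightarrow> t \<in> {0<..<T} \<Longrightarrow> has_transport_derivative c u (D x t) x t"
    and cont: "\<And>x t. x \<in> {0..1} \<Longrightarrow> t \<in> {0..T} \<Longrightarrow>
      continuous_on {s. x + c * s \<in> {0..1} \<and> t + s \<in> {0..T}} (\<lambda>s. u (x + c * s) (t + s))"
    and uT: "\<And>x. x \<in> {0..1} \<Longrightarrow> u x T = 0"
    and u0: "\<And>x. x \<in> {0..1} \<Longrightarrow> u x 0 = 0"
    and F: "integrable lborel (\<lambda>(x, t). F x t)"
    and U1: "integrable lborel (U 1)" and U0: "integrable lborel (U 0)"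
  shows "c * ((LINT t|lborel. U 1 t) - (LINT t|lborel. U 0 t)) = (LINT p|lborel. (\<lambda>(x, t). F x t) p)"
proof -
  define G where "G = (\<lambda>x t. F x (t + 1 / c * x))"
  have Geq: "(\<lambda>x. G x \<tau>) = (\<lambda>x. if x \<in> {0<..<1}
      then indicator {0<..<T} (\<tau> + x / c) * D x (\<tau> + x / c) else 0)" for \<tau>
    by (auto simp: fun_eq_iff G_def F_def indicator_def)
  have "integrable lborel (\<lambda>(x, t). G x t)"
    using integrable_lborel_transform[OF preserves_lborel_shear[of "1 / c"] F]
    by (simp add: G_def case_prod_unfold)
  then have G: "integrable (lborel \<Otimes>\<^sub>M lborel) (\<lambda>(x, t). G x t)"
    by (simp add: lborel_prod)
  have "(LINT p|lborel. (\<lambda>(x, t). F x t) p) = (LINT p|lborel. (\<lambda>(x, t). G x t) p)"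
    using integral_lborel_transform[OF preserves_lborel_shear[of "1 / c"] borel_measurable_integrable[OF F, simplified]]
    by (simp add: G_def case_prod_unfold)
  also have "\<dots> = (LINT t|lborel. (LINT x|lborel. G x t))"
    using lborel_pair.integral_snd[OF G] by (simp add: lborel_prod)
  also have "\<dots> = (LINT t|lborel. c * (U 1 (1 / c + 1 * t) - U 0 t))"
  proof (rule integral_cong_AE)
    \<comment> \<open>Joint integrability makes almost every section Lebesgue integrable, and there
      the gauge integral is the Lebesgue integral.\<close>
    show "AE t in lborel. (LINT x|lborel. G x t) = c * (U 1 (1 / c + 1 * t) - U 0 t)"
      using lborel_pair.AE_integrable_snd[OF G]
    proof eventually_elim
      case (elim \<tau>)
      have "((\<lambda>x. indicator {0<..<T} (\<tau> + x / c) * D x (\<tau> + x / c))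
          has_integral c * (U 1 (\<tau> + 1 / c) - U 0 \<tau>)) {0<..<1}"
        unfolding U_def has_integral_Icc_iff_Ioo[symmetric]
        by (rule transport_FTC[OF T c]; (rule der cont uT; assumption)?) (use u0 in blast)
      then have "((\<lambda>x. G x \<tau>) has_integral c * (U 1 (\<tau> + 1 / c) - U 0 \<tau>)) UNIV"
        by (subst (asm) has_integral_restrict_UNIV[symmetric])
          (auto simp: G_def F_def indicator_def elim!: has_integral_eq[rotated])
      then have "(LINT x|lborel. G x \<tau>) = c * (U 1 (\<tau> + 1 / c) - U 0 \<tau>)"
        by (rule has_integral_unique[OF has_integral_integral_lborel[OF elim]])
      then show ?case
        by (simp add: add.commute)
    qed
    show "(\<lambda>t. LINT x|lborel. G x t) \<in> borel_measurable lborel"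
      using lborel_pair.integrable_snd[OF G] by simp
    show "(\<lambda>t. c * (U 1 (1 / c + 1 * t) - U 0 t)) \<in> borel_measurable lborel"
      using borel_measurable_integrable[OF U1] borel_measurable_integrable[OF U0] by measurable
  qed
  also have "\<dots> = c * ((LINT t|lborel. U 1 (1 / c + 1 * t)) - (LINT t|lborel. U 0 t))"
    using lborel_integrable_real_affine[OF U1, of 1 "1 / c"] U0 by simp
  also have "(LINT t|lborel. U 1 (1 / c + 1 * t)) = (LINT t|lborel. U 1 t)"
    using lborel_integral_real_affine[of 1 "U 1" "1 / c"] by simp
  finally show ?thesis by simp
qed

text \<open>
  For \<open>c < 0\<close> the characteristic through \<open>(1, t)\<close> reaches \<open>x = 0\<close> at a later time, so the values
  of \<open>u\<close> at time \<open>0\<close> do not enter.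
\<close>

lemma transport_trace:
  fixes u D :: "real \<Rightarrow> real \<Rightarrow> real" and T c :: real
  defines "F \<equiv> \<lambda>x t. indicator ({0<..<1} \<times> {0<..<T}) (x, t) * D x t"
    and "U \<equiv> \<lambda>x t. indicator {0..T} t * u x t"
  assumes T: "0 < T" and c: "c < 0"
    and der: "\<And>x t. x \<in> {0<..<1} \<Longrightarrow> t \<in> {0<..<T} \<Longrightarrow> has_transport_derivative c u (D x t) x t"
    and cont: "\<And>x t. x \<in> {0..1} \<Longrightarrow> t \<in> {0..T} \<Longrightarrow>
      continuous_on {s. x + c * s \<in> {0..1} \<and> t + s \<in> {0..T}} (\<lambda>s. u (x + c * s) (t + s))"
    and uT: "\<And>x. x \<in> {0..1} \<Longrightarrow> u x T = 0"
    and F: "(\<lambda>(x, t). F x t) \<in> borel_measurable borel"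
    and U1: "U 1 \<in> borel_measurable borel" and U0: "U 0 \<in> borel_measurable borel"
  shows "(\<integral>\<^sup>+ t. ennreal (\<bar>c\<bar> * \<bar>U 1 t\<bar>) \<partial>lborel)
    \<le> (\<integral>\<^sup>+ t. ennreal (\<bar>c\<bar> * \<bar>U 0 t\<bar>) \<partial>lborel) + (\<integral>\<^sup>+ (x, t). ennreal \<bar>F x t\<bar> \<partial>lborel)"
proof -
  define G where "G = (\<lambda>x t. F x (t + 1 / c * x))"
  have Geq: "(\<lambda>x. G x \<tau>) = (\<lambda>x. if x \<in> {0<..<1}
      then indicator {0<..<T} (\<tau> + x / c) * D x (\<tau> + x / c) else 0)" for \<tau>
    by (auto simp: fun_eq_iff G_def F_def indicator_def)
  note measurable_lborel_transform[OF preserves_lborel_shear[of "1 / c"] F]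
  then have "(\<lambda>(x, t). G x t) \<in> borel_measurable borel"
    by (simp add: G_def case_prod_unfold)
  then have Gm[measurable]: "(\<lambda>(x, t). G x t) \<in> borel_measurable (borel \<Otimes>\<^sub>M borel)"
    by (simp add: borel_prod)
  have c0: "c \<noteq> 0" using c by simp
  note [measurable] = U1 U0
  have le: "ennreal (\<bar>c\<bar> * \<bar>U 1 (1 / c + 1 * \<tau>)\<bar>)
      \<le> ennreal (\<bar>c\<bar> * \<bar>U 0 \<tau>\<bar>) + (\<integral>\<^sup>+ x. ennreal \<bar>G x \<tau>\<bar> \<partial>lborel)" for \<tau>
  proof (cases "1 / c + \<tau> < 0")
    case True
    then show ?thesis by (simp add: U_def)
  next
    case False
    \<comment> \<open>As c < 0, the earliest time on the characteristic is the one at x = 1, which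
      is nonnegative in this case.\<close>
    have nn: "(\<forall>x\<in>{0..1}. u x 0 = 0) \<or> (\<forall>x\<in>{0..1}. 0 \<le> \<tau> + x / c)"
    proof (intro disjI2 ballI)
      fix x :: real assume that: "x \<in> {0..1}"
      have "1 / c \<le> x / c" using that c by (simp add: divide_right_mono_neg)
      then show "0 \<le> \<tau> + x / c" using False by simp
    qed
    have "((\<lambda>x. indicator {0<..<T} (\<tau> + x / c) * D x (\<tau> + x / c))
        has_integral c * (U 1 (\<tau> + 1 / c) - U 0 \<tau>)) {0<..<1}"
      unfolding U_def has_integral_Icc_iff_Ioo[symmetric]
      by (rule transport_FTC[OF T c0]; (rule der cont uT nn; assumption?)?)
    then have "((\<lambda>x. G x \<tau>) has_integral c * (U 1 (\<tau> + 1 / c) - U 0 \<tau>)) UNIV"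
      by (simp only: has_integral_restrict_UNIV Geq)
    then have "ennreal \<bar>c * (U 1 (\<tau> + 1 / c) - U 0 \<tau>)\<bar> \<le> (\<integral>\<^sup>+ x. ennreal \<bar>G x \<tau>\<bar> \<partial>lborel)"
      by (rule has_integral_le_nn_integral[rotated]) measurable
    then have "ennreal (\<bar>c\<bar> * \<bar>U 0 \<tau>\<bar>) + ennreal \<bar>c * (U 1 (\<tau> + 1 / c) - U 0 \<tau>)\<bar>
        \<le> ennreal (\<bar>c\<bar> * \<bar>U 0 \<tau>\<bar>) + (\<integral>\<^sup>+ x. ennreal \<bar>G x \<tau>\<bar> \<partial>lborel)"
      by (rule add_left_mono)
    moreover have "\<bar>c\<bar> * \<bar>U 1 (1 / c + 1 * \<tau>)\<bar>
        \<le> \<bar>c\<bar> * \<bar>U 0 \<tau>\<bar> + \<bar>c * (U 1 (\<tau> + 1 / c) - U 0 \<tau>)\<bar>"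
      by (simp add: abs_mult add.commute flip: distrib_left) (intro mult_left_mono, auto)
    then have "ennreal (\<bar>c\<bar> * \<bar>U 1 (1 / c + 1 * \<tau>)\<bar>)
        \<le> ennreal (\<bar>c\<bar> * \<bar>U 0 \<tau>\<bar>) + ennreal \<bar>c * (U 1 (\<tau> + 1 / c) - U 0 \<tau>)\<bar>"
      by (simp add: ennreal_leI flip: ennreal_plus)
    ultimately show ?thesis by (rule order_trans[rotated])
  qed
  have "(\<integral>\<^sup>+ t. ennreal (\<bar>c\<bar> * \<bar>U 1 t\<bar>) \<partial>lborel)
      = (\<integral>\<^sup>+ t. ennreal (\<bar>c\<bar> * \<bar>U 1 (1 / c + 1 * t)\<bar>) \<partial>lborel)"
    using nn_integral_real_affine[of "\<lambda>t. ennreal (\<bar>c\<bar> * \<bar>U 1 t\<bar>)" 1 "1 / c"] by simp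
  also have "\<dots> \<le> (\<integral>\<^sup>+ t. ennreal (\<bar>c\<bar> * \<bar>U 0 t\<bar>) + (\<integral>\<^sup>+ x. ennreal \<bar>G x t\<bar> \<partial>lborel) \<partial>lborel)"
    by (intro nn_integral_mono le)
  also have "\<dots> = (\<integral>\<^sup>+ t. ennreal (\<bar>c\<bar> * \<bar>U 0 t\<bar>) \<partial>lborel)
      + (\<integral>\<^sup>+ t. \<integral>\<^sup>+ x. ennreal \<bar>G x t\<bar> \<partial>lborel \<partial>lborel)"
    by (rule nn_integral_add) measurable
  also have "(\<integral>\<^sup>+ t. \<integral>\<^sup>+ x. ennreal \<bar>G x t\<bar> \<partial>lborel \<partial>lborel)
      = (\<integral>\<^sup>+ x. \<integral>\<^sup>+ t. ennreal \<bar>G x t\<bar> \<partial>lborel \<partial>lborel)"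
    by (rule nn_integral_lborel_swap[symmetric]) (unfold borel_prod[symmetric], measurable)
  also have "\<dots> = (\<integral>\<^sup>+ p. (\<lambda>(x, t). ennreal \<bar>F x t\<bar>) ((\<lambda>(x, t). (x, t + 1 / c * x)) p) \<partial>lborel)"
    by (subst nn_integral_lborel_pair) (unfold borel_prod[symmetric], use Gm in \<open>simp_all add: G_def case_prod_unfold\<close>)
  also have "\<dots> = (\<integral>\<^sup>+ (x, t). ennreal \<bar>F x t\<bar> \<partial>lborel)"
    using F by (intro nn_integral_lborel_transform preserves_lborel_shear) (simp add: case_prod_unfold)
  finally show ?thesis .
qed

subsection \<open>Velocity averages\<close>

abbreviation velocities :: "(real \<times> real) set" where
  "velocities \<equiv> {-1..1} \<times> {0<..}"

text \<open>\<open>P\<close> and \<open>Q\<close> need not define measurable sets, so their failures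
  are first enclosed in measurable null sets, to which Fubini applies. This discards \<mu> = 0, the
  final time and exceptional frequencies.\<close>

lemma AE_lborel_prodI:
  fixes P :: "'a::euclidean_space \<Rightarrow> bool" and Q :: "'b::euclidean_space \<Rightarrow> bool"
  assumes "AE x in lborel. P x" "AE y in lborel. Q y"
  shows "AE z in lborel. P (fst z) \<and> Q (snd z)"
proof -
  obtain M where M: "{x. \<not> P x} \<subseteq> M" "emeasure lborel M = 0" "M \<in> sets lborel"
    by (rule AE_E[OF assms(1)]) auto
  obtain N where N: "{y. \<not> Q y} \<subseteq> N" "emeasure lborel N = 0" "N \<in> sets lborel"
    by (rule AE_E[OF assms(2)]) auto
  note [measurable] = M(3) N(3)
  have "AE x in lborel. AE y in lborel. fst (x, y) \<notin> M \<and> snd (x, y) \<notin> N"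
    using AE_not_in[of M lborel] AE_not_in[of N lborel] M N by (auto simp: null_sets_def)
  then have "AE z in lborel \<Otimes>\<^sub>M lborel. fst z \<notin> M \<and> snd z \<notin> N"
    by (rule lborel_pair.AE_pair_measure[rotated]) measurable
  then have "AE z in lborel. fst z \<notin> M \<and> snd z \<notin> N"
    by (simp only: lborel_prod)
  then show ?thesis
    by (rule eventually_mono) (use M(1) N(1) in blast)
qed

lemma integrable_lborel_mult:
  fixes f :: "'a::euclidean_space \<Rightarrow> real" and g :: "'b::euclidean_space \<Rightarrow> real"
  assumes f: "integrable lborel f" and g: "integrable lborel g"
  shows "integrable lborel (\<lambda>(x, y). f x * g y)"
proof -
  have [measurable]: "f \<in> borel_measurable borel" "g \<in> borel_measurable borel"
    using f g by auto
  have "integrable (lborel \<Otimes>\<^sub>M lborel) (\<lambda>(x, y). f x * g y)"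
    by (rule lborel_pair.Fubini_integrable) (use f g in \<open>auto simp: abs_mult\<close>)
  then show ?thesis by (simp add: lborel_prod)
qed

text \<open>\<open>bracket\<close> is an iterated integral, while domination arguments live on the
  product; for a jointly integrable integrand Fubini identifies the two.\<close>

lemma bracket_eq_integral:
  assumes "set_integrable lborel velocities (\<lambda>(\<mu>, \<omega>). f \<mu> \<omega>)"
  shows "bracket f = (LINT z:velocities|lborel. (\<lambda>(\<mu>, \<omega>). f \<mu> \<omega>) z)"
proof -
  have "integrable (lborel \<Otimes>\<^sub>M lborel)
      (\<lambda>(\<mu>, \<omega>). indicator {-1..1} \<mu> * (indicator {0<..} \<omega> * f \<mu> \<omega>))"
    using assms
    by (simp add: set_integrable_def lborel_prod case_prod_unfold indicator_times mult.assoc)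
  from lborel_pair.integral_fst[OF this] show ?thesis
    by (simp add: bracket_def set_lebesgue_integral_def lborel_prod case_prod_unfold
        indicator_times mult.assoc)
qed

lemma set_integrable_omega_g_star:
  "set_integrable lborel velocities (\<lambda>(\<mu>, \<omega>). \<omega> * g_star \<omega>)"
  using integrable_lborel_mult[OF _ integrable_omega_g_star, of "indicator {-1..1::real}"]
  by (simp add: set_integrable_def case_prod_unfold indicator_times mult.assoc)

lemma set_integrable_dominated:
  fixes f :: "'a::euclidean_space \<Rightarrow> real"
  assumes "set_integrable lborel A k" "set_borel_measurable borel A f"
    and "AE z in lborel. z \<in> A \<longrightarrow> \<bar>f z\<bar> \<le> k z"
  shows "set_integrable lborel A f" "\<bar>LINT z:A|lborel. f z\<bar> \<le> (LINT z:A|lborel. k z)"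
proof -
  have le: "AE z in lborel. norm (indicator A z *\<^sub>R f z) \<le> indicator A z *\<^sub>R k z"
    using assms(3) by (rule eventually_mono) (simp add: indicator_def)
  have k: "integrable lborel (\<lambda>z. indicator A z *\<^sub>R k z)"
    using assms(1) by (simp add: set_integrable_def)
  show "set_integrable lborel A f"
    unfolding set_integrable_def
    by (rule Bochner_Integration.integrable_bound[OF k])
      (use assms(2) in \<open>simp add: set_borel_measurable_def\<close>, use le in eventually_elim, simp)
  then show "\<bar>LINT z:A|lborel. f z\<bar> \<le> (LINT z:A|lborel. k z)"
    using k le integral_norm_bound[of lborel "\<lambda>z. indicator A z *\<^sub>R f z"]
    unfolding set_integrable_def set_lebesgue_integral_def real_norm_def
    by (elim order_trans, intro integral_mono_AE) simp_all
qed

text \<open>The factor \<omega> / (\<omega> + 1) is less than 1 at each frequency but tends to 1, so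
  there is no uniform gap. Strictness still survives averaging, because the difference of the
  integrands is positive on a set of positive measure. It is what closes the maximum
  principle.\<close>

lemma bracket_weight_less:
  "bracket (\<lambda>\<mu> \<omega>. \<omega> * (\<omega> / (\<omega> + 1) * g_star \<omega>)) < bracket (\<lambda>\<mu> \<omega>. \<omega> * g_star \<omega>)"
  "0 \<le> bracket (\<lambda>\<mu> \<omega>. \<omega> * (\<omega> / (\<omega> + 1) * g_star \<omega>))"
  "set_integrable lborel velocities (\<lambda>(\<mu>, \<omega>). \<omega> * (\<omega> / (\<omega> + 1) * g_star \<omega>))"
proof -
  have m: "set_borel_measurable borel velocities (\<lambda>(\<mu>, \<omega>). \<omega> * (\<omega> / (\<omega> + 1) * g_star \<omega>))"
    unfolding set_borel_measurable_def borel_prod[symmetric] case_prod_unfold by measurable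
  have le: "\<omega> * (\<omega> / (\<omega> + 1) * g_star \<omega>) < \<omega> * g_star \<omega>" if "0 < \<omega>" for \<omega>
    using g_star_pos[OF that] that by (simp add: field_simps)
  then have le': "\<bar>\<omega> * (\<omega> / (\<omega> + 1) * g_star \<omega>)\<bar> \<le> \<omega> * g_star \<omega>" if "0 < \<omega>" for \<omega>
    using that g_star_nonneg[of \<omega>] less_imp_le[OF le[OF that]] by simp
  note i = set_integrable_omega_g_star
  show j: "set_integrable lborel velocities (\<lambda>(\<mu>, \<omega>). \<omega> * (\<omega> / (\<omega> + 1) * g_star \<omega>))"
    by (rule set_integrable_dominated(1)[OF i m]) (use le' in auto)
  let ?I = "indicator velocities :: real \<times> real \<Rightarrow> real"
  let ?d = "\<lambda>z. ?I z *\<^sub>R (\<lambda>(\<mu>, \<omega>). \<omega> * g_star \<omega>) z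
    - ?I z *\<^sub>R (\<lambda>(\<mu>, \<omega>). \<omega> * (\<omega> / (\<omega> + 1) * g_star \<omega>)) z"
  have d: "integrable lborel ?d"
    using i j by (intro Bochner_Integration.integrable_diff) (simp_all add: set_integrable_def)
  have d0: "0 \<le> ?d z" for z
    using less_imp_le[OF le] by (auto simp: indicator_def)
  have "(LINT z|lborel. ?d z) \<noteq> 0"
  proof
    assume "(LINT z|lborel. ?d z) = 0"
    then have "AE z in lborel. ?d z = 0"
      using integral_nonneg_eq_0_iff_AE[OF d] d0 by simp
    \<comment> \<open>Any rectangle of positive measure inside \<open>velocities\<close> would
      do.\<close>
    moreover have "?d z \<noteq> 0" if "z \<in> {-1..1} \<times> {1..2}" for z
      using that le[of "snd z"] by (auto simp: indicator_def)
    ultimately have "AE z in lborel. z \<notin> {-1..1::real} \<times> {1..2::real}"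
      by (auto elim!: eventually_mono)
    moreover have "{-1..1::real} \<times> {1..2::real} \<in> sets lborel"
      by (simp add: borel_Times)
    ultimately have "emeasure lborel ({-1..1::real} \<times> {1..2::real}) = 0"
      using AE_iff_null_sets by blast
    moreover have "emeasure lborel ({-1..1::real} \<times> {1..2::real}) \<noteq> 0"
      unfolding lborel_prod[symmetric] by (subst lborel.emeasure_pair_measure_Times) auto
    ultimately show False by simp
  qed
  then have "0 < (LINT z|lborel. ?d z)"
    using integral_nonneg_AE[of ?d lborel] d0 by (simp add: less_le)
  also have "\<dots> = bracket (\<lambda>\<mu> \<omega>. \<omega> * g_star \<omega>) - bracket (\<lambda>\<mu> \<omega>. \<omega> * (\<omega> / (\<omega> + 1) * g_star \<omega>))"
    using i j unfolding bracket_eq_integral[OF i] bracket_eq_integral[OF j] set_lebesgue_integral_def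
    by (intro Bochner_Integration.integral_diff) (simp_all add: set_integrable_def)
  finally show "bracket (\<lambda>\<mu> \<omega>. \<omega> * (\<omega> / (\<omega> + 1) * g_star \<omega>)) < bracket (\<lambda>\<mu> \<omega>. \<omega> * g_star \<omega>)"
    by simp
  show "0 \<le> bracket (\<lambda>\<mu> \<omega>. \<omega> * (\<omega> / (\<omega> + 1) * g_star \<omega>))"
    unfolding bracket_eq_integral[OF j] set_lebesgue_integral_def
    by (intro integral_nonneg_AE AE_I2) (auto simp: indicator_def g_star_nonneg)
qed

lemma bracket_weight_pos: "0 < bracket (\<lambda>\<mu> \<omega>. \<omega> * g_star \<omega>)"
  using bracket_weight_less(1,2) by linarith

text \<open>Different velocities are coupled through the scalar \<open>temperature\<close> only. On
  a characteristic the forward equation is thus a linear ordinary differential equation with decay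
  rate \<omega> and a source.\<close>

lemma collision_eq_temperature:
  "collision (\<lambda>\<mu> \<omega>. f x \<mu> \<omega> t) \<mu> \<omega> = - \<omega> * f x \<mu> \<omega> t + \<omega> * g_star \<omega> * temperature f x t"
  by (simp add: collision_def temperature_def)

subsection \<open>Maximum principle\<close>

text \<open>\<open>A \<omega> / (\<omega> + 1) exp s\<close> solves \<open>y' = - \<omega> y + \<omega> A exp s\<close>, so it is a barrier.\<close>

lemma relaxation_bound:
  fixes y \<theta> :: "real \<Rightarrow> real" and \<omega> :: real
  assumes "a \<le> b" "0 < \<omega>" "0 \<le> \<beta>"
    and cont: "continuous_on {a..b} y"
    and der: "\<And>s. s \<in> {a<..<b} \<Longrightarrow> (y has_real_derivative (- \<omega> * y s + \<omega> * \<theta> s)) (at s)"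
    and \<theta>: "\<And>s. s \<in> {a<..<b} \<Longrightarrow> \<bar>\<theta> s\<bar> \<le> A * exp s"
    and ya: "\<bar>y a\<bar> \<le> \<beta> + A * (\<omega> / (\<omega> + 1)) * exp a"
  shows "\<bar>y b\<bar> \<le> \<beta> + A * (\<omega> / (\<omega> + 1)) * exp b"
proof -
  define k where "k = A * (\<omega> / (\<omega> + 1))"
  have k: "k * (\<omega> + 1) = \<omega> * A"
    using \<open>0 < \<omega>\<close> by (simp add: k_def)
  have "\<sigma> * y b \<le> \<beta> + k * exp b" if \<sigma>: "\<sigma> = 1 \<or> \<sigma> = -1" for \<sigma> :: real
  proof -
    \<comment> \<open>The sign \<sigma> treats the upper and the lower bound at once. Multiplied by
      the integrating factor exp (\<omega> s), the gap to the barrier is nondecreasing; the constant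
      \<beta> only contributes \<omega> \<beta> \<ge> 0 to its derivative.\<close>
    let ?f = "\<lambda>s. exp (\<omega> * s) * (\<beta> + k * exp s - \<sigma> * y s)"
    have "?f a \<le> ?f b"
    proof (rule DERIV_nonneg_imp_increasing_open[OF \<open>a \<le> b\<close>])
      fix s assume s: "a < s" "s < b"
      have "\<sigma> * (\<omega> * \<theta> s) \<le> \<omega> * (A * exp s)"
        using \<theta>[of s] s \<sigma> \<open>0 < \<omega>\<close> by (auto simp: abs_le_iff)
      moreover have "k * exp s + \<omega> * (k * exp s) = \<omega> * (A * exp s)"
        using arg_cong[OF k, of "\<lambda>z. z * exp s"] by (simp add: algebra_simps)
      ultimately have nn: "0 \<le> \<omega> * \<beta> + (k * exp s + \<omega> * (k * exp s)) - \<sigma> * (\<omega> * \<theta> s)"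
        using \<open>0 < \<omega>\<close> \<open>0 \<le> \<beta>\<close> by (simp add: add_increasing)
      have dd: "(?f has_real_derivative exp (\<omega> * s) *
          (\<omega> * \<beta> + (k * exp s + \<omega> * (k * exp s)) - \<sigma> * (\<omega> * \<theta> s))) (at s)"
        by (rule derivative_eq_intros refl der | use s in \<open>simp add: algebra_simps\<close>)+
      show "\<exists>D. (?f has_real_derivative D) (at s) \<and> 0 \<le> D"
        by (rule exI, rule conjI, rule dd, rule mult_nonneg_nonneg, simp, rule nn)
    qed (intro continuous_intros cont)
    moreover have "0 \<le> ?f a"
      using ya \<sigma> by (auto simp: k_def abs_le_iff)
    ultimately have "0 \<le> ?f b" by (rule order_trans[rotated])
    then show ?thesis by (simp add: zero_le_mult_iff)
  qed
  from this[of 1] this[of "-1"] show ?thesis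
    by (simp add: k_def abs_le_iff)
qed

text \<open>The forward problem without its boundary conditions. What remains is linear and
  homogeneous, so differences of forward solutions for different reflection coefficients qualify as
  well.\<close>

definition kinetic_solution :: "real \<Rightarrow> (real \<Rightarrow> real \<Rightarrow> real \<Rightarrow> real \<Rightarrow> real) \<Rightarrow> bool" where
  "kinetic_solution T g \<longleftrightarrow>
     set_borel_measurable borel (phase_space T) (\<lambda>(x, \<mu>, \<omega>, t). g x \<mu> \<omega> t) \<and>
     (\<exists>C. \<forall>(x, \<mu>, \<omega>, t)\<in>phase_space T. \<bar>g x \<mu> \<omega> t\<bar> \<le> C * g_star \<omega>) \<and>
     solves_transport T g (\<lambda>x \<mu> \<omega> t. collision (\<lambda>\<mu> \<omega>. g x \<mu> \<omega> t) \<mu> \<omega>) \<and>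
     (\<forall>x\<in>{0..1}. \<forall>\<mu>\<in>{-1..1}. \<forall>\<omega>>0. g x \<mu> \<omega> 0 = 0)"

lemma measurable_velocity_section:
  assumes "set_borel_measurable borel (phase_space T) (\<lambda>(x, \<mu>, \<omega>, t). f x \<mu> \<omega> t)"
    and "x \<in> {0..1}" "t \<in> {0..T}"
  shows "set_borel_measurable borel velocities (\<lambda>(\<mu>, \<omega>). f x \<mu> \<omega> t)"
proof -
  have "(\<lambda>(\<mu>::real, \<omega>::real). (x, \<mu>, \<omega>, t)) \<in> borel_measurable borel"
    unfolding borel_prod[symmetric] case_prod_unfold by measurable
  from measurable_compose[OF this assms(1)[unfolded set_borel_measurable_def]]
  have "(\<lambda>z. indicator (phase_space T) (x, fst z, snd z, t) *\<^sub>R f x (fst z) (snd z) t)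
      \<in> borel_measurable borel"
    by (simp add: case_prod_unfold)
  moreover have "indicator (phase_space T) (x, fst z, snd z, t) = (indicator velocities z :: real)" for z
    using assms by (cases z) (auto simp: phase_space_def indicator_def)
  ultimately show ?thesis
    by (simp add: set_borel_measurable_def case_prod_unfold)
qed

lemma set_borel_measurable_omega_mult:
  assumes "set_borel_measurable borel velocities (\<lambda>(\<mu>, \<omega>). f \<mu> \<omega>)"
  shows "set_borel_measurable borel velocities (\<lambda>(\<mu>, \<omega>). \<omega> * f \<mu> \<omega>)"
proof -
  have "(\<lambda>z. snd z * (indicator velocities z *\<^sub>R (\<lambda>(\<mu>, \<omega>). f \<mu> \<omega>) z)) \<in> borel_measurable borel"
    using assms unfolding set_borel_measurable_def
    by (intro borel_measurable_times) (simp_all add: borel_measurable_continuous_onI continuous_intros)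
  then show ?thesis
    by (simp add: set_borel_measurable_def case_prod_unfold mult.left_commute)
qed

text \<open>Only an almost everywhere bound is asked for, since the barrier estimate leaves out
  \<mu> = 0 and a null set of frequencies.\<close>

lemma bracket_dominated:
  assumes "set_borel_measurable borel velocities (\<lambda>(\<mu>, \<omega>). f \<mu> \<omega>)"
    and "set_integrable lborel velocities (\<lambda>(\<mu>, \<omega>). \<omega> * k \<mu> \<omega>)"
    and "AE z in lborel. z \<in> velocities \<longrightarrow> \<bar>f (fst z) (snd z)\<bar> \<le> k (fst z) (snd z)"
  shows "set_integrable lborel velocities (\<lambda>(\<mu>, \<omega>). \<omega> * f \<mu> \<omega>)"
    and "\<bar>bracket (\<lambda>\<mu> \<omega>. \<omega> * f \<mu> \<omega>)\<bar> \<le> bracket (\<lambda>\<mu> \<omega>. \<omega> * k \<mu> \<omega>)"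
proof -
  have "AE z in lborel. z \<in> velocities \<longrightarrow> \<bar>(\<lambda>(\<mu>, \<omega>). \<omega> * f \<mu> \<omega>) z\<bar> \<le> (\<lambda>(\<mu>, \<omega>). \<omega> * k \<mu> \<omega>) z"
    using assms(3)
  proof (rule eventually_mono, intro impI)
    fix z :: "real \<times> real"
    assume "z \<in> velocities \<longrightarrow> \<bar>f (fst z) (snd z)\<bar> \<le> k (fst z) (snd z)" "z \<in> velocities"
    then show "\<bar>(\<lambda>(\<mu>, \<omega>). \<omega> * f \<mu> \<omega>) z\<bar> \<le> (\<lambda>(\<mu>, \<omega>). \<omega> * k \<mu> \<omega>) z"
      by (cases z) (auto simp: abs_mult intro!: mult_left_mono)
  qed
  note dom = set_integrable_dominated[OF assms(2) set_borel_measurable_omega_mult[OF assms(1)] this]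
  then show "set_integrable lborel velocities (\<lambda>(\<mu>, \<omega>). \<omega> * f \<mu> \<omega>)" by simp
  then show "\<bar>bracket (\<lambda>\<mu> \<omega>. \<omega> * f \<mu> \<omega>)\<bar> \<le> bracket (\<lambda>\<mu> \<omega>. \<omega> * k \<mu> \<omega>)"
    using dom(2) by (simp only: bracket_eq_integral assms(2))
qed

lemma set_integrable_weight_mult:
  "set_integrable lborel velocities (\<lambda>(\<mu>, \<omega>). \<omega> * (C * g_star \<omega>))"
  using set_integrable_mult_right[OF set_integrable_omega_g_star, of C]
  by (simp add: case_prod_unfold mult.left_commute)

lemma bracket_weight_mult:
  "bracket (\<lambda>\<mu> \<omega>. \<omega> * (C * g_star \<omega>)) = C * bracket (\<lambda>\<mu> \<omega>. \<omega> * g_star \<omega>)"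
  by (simp only: bracket_def mult.left_commute[of _ C] set_integral_mult_right)

lemma bracket_add:
  assumes "set_integrable lborel velocities (\<lambda>(\<mu>, \<omega>). f \<mu> \<omega>)"
    and "set_integrable lborel velocities (\<lambda>(\<mu>, \<omega>). g \<mu> \<omega>)"
  shows "set_integrable lborel velocities (\<lambda>(\<mu>, \<omega>). f \<mu> \<omega> + g \<mu> \<omega>)"
    and "bracket (\<lambda>\<mu> \<omega>. f \<mu> \<omega> + g \<mu> \<omega>) = bracket f + bracket g"
proof -
  have eq: "(\<lambda>(\<mu>, \<omega>). f \<mu> \<omega> + g \<mu> \<omega>) = (\<lambda>z. (\<lambda>(\<mu>, \<omega>). f \<mu> \<omega>) z + (\<lambda>(\<mu>, \<omega>). g \<mu> \<omega>) z)"
    by auto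
  show *: "set_integrable lborel velocities (\<lambda>(\<mu>, \<omega>). f \<mu> \<omega> + g \<mu> \<omega>)"
    unfolding eq by (rule set_integral_add[OF assms])
  show "bracket (\<lambda>\<mu> \<omega>. f \<mu> \<omega> + g \<mu> \<omega>) = bracket f + bracket g"
    unfolding bracket_eq_integral[OF *] bracket_eq_integral[OF assms(1)] bracket_eq_integral[OF assms(2)]
    unfolding eq by (rule set_integral_add[OF assms])
qed

lemma bracket_mult:
  assumes "set_integrable lborel velocities (\<lambda>(\<mu>, \<omega>). f \<mu> \<omega>)"
  shows "set_integrable lborel velocities (\<lambda>(\<mu>, \<omega>). C * f \<mu> \<omega>)"
    and "bracket (\<lambda>\<mu> \<omega>. C * f \<mu> \<omega>) = C * bracket f"
proof -
  show "set_integrable lborel velocities (\<lambda>(\<mu>, \<omega>). C * f \<mu> \<omega>)"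
    using set_integrable_mult_right[OF assms, of C] by (simp add: case_prod_unfold)
qed (simp only: bracket_def set_integral_mult_right)

lemma kinetic_solution_moment:
  assumes g: "kinetic_solution T g" and xt: "x \<in> {0..1}" "t \<in> {0..T}"
  shows "set_integrable lborel velocities (\<lambda>(\<mu>, \<omega>). \<omega> * g x \<mu> \<omega> t)"
proof -
  from g obtain C where C: "\<forall>(x, \<mu>, \<omega>, t)\<in>phase_space T. \<bar>g x \<mu> \<omega> t\<bar> \<le> C * g_star \<omega>"
    by (auto simp: kinetic_solution_def)
  show ?thesis
    by (rule bracket_dominated(1)[OF measurable_velocity_section set_integrable_weight_mult[of C]])
      (use g xt C in \<open>auto simp: kinetic_solution_def phase_space_def intro!: AE_I2\<close>)
qed

text \<open>Averaging the pointwise bound C \<open>g_star\<close> and dividing by the same moment of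
  \<open>g_star\<close> returns the constant C. Its absolute value is taken so that one nonnegative
  constant serves both bounds.\<close>

lemma kinetic_solution_temperature_bounded:
  assumes g: "kinetic_solution T g"
  obtains C where "\<And>x t. x \<in> {0..1} \<Longrightarrow> t \<in> {0..T} \<Longrightarrow> \<bar>temperature g x t\<bar> \<le> C"
    and "\<And>x \<mu> \<omega> t. x \<in> {0..1} \<Longrightarrow> \<mu> \<in> {-1..1} \<Longrightarrow> 0 < \<omega> \<Longrightarrow> t \<in> {0..T} \<Longrightarrow>
      \<bar>g x \<mu> \<omega> t\<bar> \<le> C * g_star \<omega>"
    and "0 \<le> C"
proof -
  from g obtain C where C: "\<forall>(x, \<mu>, \<omega>, t)\<in>phase_space T. \<bar>g x \<mu> \<omega> t\<bar> \<le> C * g_star \<omega>"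
    by (auto simp: kinetic_solution_def)
  have 1: "\<bar>temperature g x t\<bar> \<le> \<bar>C\<bar>" if xt: "x \<in> {0..1}" "t \<in> {0..T}" for x t
  proof -
    have "\<bar>bracket (\<lambda>\<mu> \<omega>. \<omega> * g x \<mu> \<omega> t)\<bar> \<le> bracket (\<lambda>\<mu> \<omega>. \<omega> * (C * g_star \<omega>))"
      by (rule bracket_dominated(2)[OF measurable_velocity_section set_integrable_weight_mult[of C]])
        (use g xt C in \<open>auto simp: kinetic_solution_def phase_space_def intro!: AE_I2\<close>)
    then have "\<bar>temperature g x t\<bar> \<le> C"
      using bracket_weight_pos by (simp add: bracket_weight_mult temperature_def divide_le_eq)
    then show ?thesis by linarith
  qed
  have 2: "\<bar>g x \<mu> \<omega> t\<bar> \<le> \<bar>C\<bar> * g_star \<omega>"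
    if "x \<in> {0..1}" "\<mu> \<in> {-1..1}" "0 < \<omega>" "t \<in> {0..T}" for x \<mu> \<omega> t
  proof -
    have "\<bar>g x \<mu> \<omega> t\<bar> \<le> C * g_star \<omega>"
      using that C by (auto simp: phase_space_def)
    also have "\<dots> \<le> \<bar>C\<bar> * g_star \<omega>"
      by (intro mult_right_mono g_star_nonneg) simp
    finally show ?thesis .
  qed
  show ?thesis
    by (rule that[of "\<bar>C\<bar>", OF 1 2]) auto
qed

text \<open>Dividing by \<open>g_star\<close> turns the equation on the characteristic into y' = -
  \<omega> y + \<omega> \<theta>, to which \<open>relaxation_bound\<close> applies. Here r is the
  travel time back to a point where the bound is already known; the open segment must lie in the
  interior, its ends may lie on the boundary.\<close>

lemma kinetic_solution_step:
  assumes tr: "solves_transport T d (\<lambda>x \<mu> \<omega> t. collision (\<lambda>\<mu> \<omega>. d x \<mu> \<omega> t) \<mu> \<omega>)"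
    and v: "\<mu> \<in> {-1..1}" "0 < \<omega>"
    and xt: "x \<in> {0..1}" "t \<in> {0..T}" "0 \<le> r" "x - \<mu> * \<omega> * r \<in> {0..1}" "t - r \<in> {0..T}"
    and int: "\<And>s. s \<in> {t - r<..<t} \<Longrightarrow> x + \<mu> * \<omega> * (s - t) \<in> {0<..<1} \<and> s \<in> {0<..<T}"
    and \<theta>: "\<And>x t. x \<in> {0<..<1} \<Longrightarrow> t \<in> {0<..<T} \<Longrightarrow> \<bar>temperature d x t\<bar> \<le> A * exp t"
    and \<beta>: "0 \<le> \<beta>"
    and start: "\<bar>d (x - \<mu> * \<omega> * r) \<mu> \<omega> (t - r)\<bar>
      \<le> (\<beta> + A * (\<omega> / (\<omega> + 1)) * exp (t - r)) * g_star \<omega>"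
  shows "\<bar>d x \<mu> \<omega> t\<bar> \<le> (\<beta> + A * (\<omega> / (\<omega> + 1)) * exp t) * g_star \<omega>"
proof -
  let ?X = "\<lambda>s. x + \<mu> * \<omega> * (s - t)"
  define y where "y s = d (?X s) \<mu> \<omega> s / g_star \<omega>" for s
  note gp = g_star_pos[OF v(2)]
  have "\<bar>y t\<bar> \<le> \<beta> + A * (\<omega> / (\<omega> + 1)) * exp t"
  proof (rule relaxation_bound[where a="t - r" and b=t and \<omega>=\<omega> and y=y and \<theta>="\<lambda>s. temperature d (?X s) s"])
    show "continuous_on {t - r..t} y"
    proof -
      let ?S = "{s. x + \<mu> * \<omega> * s \<in> {0..1} \<and> t + s \<in> {0..T}}"
      have "continuous_on ?S (\<lambda>s. d (x + \<mu> * \<omega> * s) \<mu> \<omega> (t + s))"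
        using tr v xt by (auto simp: solves_transport_def)
      moreover have "(\<lambda>s. s - t) ` {t - r..t} \<subseteq> ?S"
      proof (rule image_subsetI)
        fix s assume "s \<in> {t - r..t}"
        then consider "s = t - r" | "s = t" | "s \<in> {t - r<..<t}" by fastforce
        then show "s - t \<in> ?S"
        proof cases
          case 3
          with int[OF 3] show ?thesis by simp
        qed (use xt in auto)
      qed
      ultimately have "continuous_on {t - r..t} ((\<lambda>s. d (x + \<mu> * \<omega> * s) \<mu> \<omega> (t + s)) \<circ> (\<lambda>s. s - t))"
        by (intro continuous_on_compose continuous_intros) (rule continuous_on_subset)
      then show ?thesis
        using gp unfolding y_def o_def by (intro continuous_intros) auto
    qed
    show "(y has_real_derivative - \<omega> * y s + \<omega> * temperature d (?X s) s) (at s)"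
      if "s \<in> {t - r<..<t}" for s
    proof -
      let ?f = "\<lambda>s. d (?X s) \<mu> \<omega> s"
      have "((\<lambda>\<sigma>. d (?X s + \<mu> * \<omega> * \<sigma>) \<mu> \<omega> (s + \<sigma>)) has_real_derivative
          - \<omega> * ?f s + \<omega> * g_star \<omega> * temperature d (?X s) s) (at 0)"
        using tr v int[OF that]
        unfolding solves_transport_def has_transport_derivative_def collision_eq_temperature by blast
      then have "((\<lambda>\<sigma>. ?f (\<sigma> + s)) has_real_derivative
          - \<omega> * ?f s + \<omega> * g_star \<omega> * temperature d (?X s) s) (at 0)"
        by (simp add: algebra_simps)
      then have "(?f has_real_derivative
          - \<omega> * ?f s + \<omega> * g_star \<omega> * temperature d (?X s) s) (at s)"
        using DERIV_shift[of ?f _ 0 s] by simp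
      from DERIV_cdivide[OF this, of "g_star \<omega>"] show ?thesis
        using gp by (simp add: y_def[abs_def] add_divide_distrib diff_divide_distrib)
    qed
    show "\<bar>temperature d (?X s) s\<bar> \<le> A * exp s" if "s \<in> {t - r<..<t}" for s
      using \<theta> int[OF that] by blast
    show "\<bar>y (t - r)\<bar> \<le> \<beta> + A * (\<omega> / (\<omega> + 1)) * exp (t - r)"
      using start gp by (simp add: y_def divide_le_eq)
  qed (use xt v \<beta> in auto)
  then show ?thesis
    using gp by (simp add: y_def divide_le_eq)
qed

text \<open>The mean of \<omega> / (\<omega> + 1) for the probability density on
  \<open>velocities\<close> proportional to \<omega> \<open>g_star\<close>. It is the contraction
  factor from a temperature bound A exp t to the bound that the barrier gives back.\<close>

definition relaxation_ratio :: real where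
  "relaxation_ratio = bracket (\<lambda>\<mu> \<omega>. \<omega> * (\<omega> / (\<omega> + 1) * g_star \<omega>)) / bracket (\<lambda>\<mu> \<omega>. \<omega> * g_star \<omega>)"

lemma relaxation_ratio: "0 \<le> relaxation_ratio" "relaxation_ratio < 1"
  using bracket_weight_less(1,2) bracket_weight_pos by (auto simp: relaxation_ratio_def)

text \<open>
  A particle is reflected at most once, at \<open>x = 1\<close>, so \<open>\<beta>\<close> enters once.  If \<open>A exp t\<close> bounds the
  temperature, averaging the barrier gives the bound \<open>\<beta> + A relaxation_ratio exp t\<close>, which closes
  because the ratio is less than 1, without any bound on the collision frequency \<open>\<omega>\<close>.
\<close>

lemma kinetic_solution_stability:
  assumes T: "0 < T" and d: "kinetic_solution T d"
    and inflow: "\<And>\<mu> \<omega> t. \<mu> \<in> {0<..1} \<Longrightarrow> 0 < \<omega> \<Longrightarrow> t \<in> {0<..T} \<Longrightarrow> d 0 \<mu> \<omega> t = 0"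
    and refl: "\<And>\<mu> \<omega> t. P \<omega> \<Longrightarrow> \<mu> \<in> {-1..<0} \<Longrightarrow> 0 < \<omega> \<Longrightarrow> t \<in> {0<..T} \<Longrightarrow>
      \<bar>d 1 \<mu> \<omega> t\<bar> \<le> \<bar>d 1 (- \<mu>) \<omega> t\<bar> + \<beta> * g_star \<omega>"
    and P: "AE \<omega> in lborel. P \<omega>" and \<beta>: "0 \<le> \<beta>"
    and pt: "P \<omega>" "0 < \<omega>" "\<mu> \<in> {-1..1}" "\<mu> \<noteq> 0" "x \<in> {0..1}" "t \<in> {0..T}"
  shows "\<bar>d x \<mu> \<omega> t\<bar> \<le> \<beta> * (1 + exp T / (1 - relaxation_ratio)) * g_star \<omega>"
proof -
  let ?Z = "bracket (\<lambda>\<mu> \<omega>. \<omega> * g_star \<omega>)"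
  have tr: "solves_transport T d (\<lambda>x \<mu> \<omega> t. collision (\<lambda>\<mu> \<omega>. d x \<mu> \<omega> t) \<mu> \<omega>)"
    and m: "set_borel_measurable borel (phase_space T) (\<lambda>(x, \<mu>, \<omega>, t). d x \<mu> \<omega> t)"
    and d0: "\<And>x \<mu> \<omega>. x \<in> {0..1} \<Longrightarrow> \<mu> \<in> {-1..1} \<Longrightarrow> 0 < \<omega> \<Longrightarrow> d x \<mu> \<omega> 0 = 0"
    using d by (auto simp: kinetic_solution_def)
  have est: "\<bar>d x \<mu> \<omega> t\<bar> \<le> (\<beta> + A * (\<omega> / (\<omega> + 1)) * exp t) * g_star \<omega>"
    if A: "0 \<le> A"
      and \<theta>: "\<And>x t. x \<in> {0<..<1} \<Longrightarrow> t \<in> {0<..<T} \<Longrightarrow> \<bar>temperature d x t\<bar> \<le> A * exp t"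
      and pt: "P \<omega>" "0 < \<omega>" "\<mu> \<in> {-1..1}" "\<mu> \<noteq> 0" "x \<in> {0..1}" "t \<in> {0..T}"
    for A x \<mu> \<omega> t
  proof -
    have nn: "0 \<le> (b + A * (\<omega> / (\<omega> + 1)) * exp t) * g_star \<omega>" if "0 \<le> b" for b t
      using A that \<open>0 < \<omega>\<close> g_star_nonneg by (intro mult_nonneg_nonneg add_nonneg_nonneg) auto
    \<comment> \<open>For \<mu> > 0 the backward characteristic ends at zero data, initial or
      inflow, so no \<beta> arises.\<close>
    have pos: "\<bar>d x \<mu> \<omega> t\<bar> \<le> (0 + A * (\<omega> / (\<omega> + 1)) * exp t) * g_star \<omega>"
      if \<mu>: "\<mu> \<in> {0<..1}" and xt: "x \<in> {0..1}" "t \<in> {0..T}" for x \<mu> t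
    proof -
      \<comment> \<open>The time needed backward to reach either time 0 or the boundary x = 0,
        whichever comes sooner.\<close>
      define r where "r = min t (x / (\<mu> * \<omega>))"
      have c: "0 < \<mu> * \<omega>" using \<mu> \<open>0 < \<omega>\<close> by simp
      have r: "0 \<le> r" "r \<le> t" "\<mu> * \<omega> * r \<le> x" "r = t \<or> \<mu> * \<omega> * r = x"
        using xt c by (auto simp: r_def min_def field_simps)
      have xr: "x - \<mu> * \<omega> * r \<in> {0..1}"
        using r(3) xt(1) mult_nonneg_nonneg[OF less_imp_le[OF c] r(1)] by simp
      show ?thesis
      proof (rule kinetic_solution_step[OF tr _ \<open>0 < \<omega>\<close> xt r(1) xr])
        show "x + \<mu> * \<omega> * (s - t) \<in> {0<..<1} \<and> s \<in> {0<..<T}" if "s \<in> {t - r<..<t}" for s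
        proof -
          have "\<mu> * \<omega> * (t - s) < \<mu> * \<omega> * r" "0 < \<mu> * \<omega> * (t - s)"
            using that c by (auto intro!: mult_strict_left_mono mult_pos_pos)
          then show ?thesis
            using that r xt by (auto simp: right_diff_distrib)
        qed
        have "d (x - \<mu> * \<omega> * r) \<mu> \<omega> (t - r) = 0"
        proof (cases "t - r = 0")
          case True
          then show ?thesis using d0[of "x - \<mu> * \<omega> * r" \<mu> \<omega>] xr \<mu> \<open>0 < \<omega>\<close> by simp
        next
          case False
          then show ?thesis using inflow[of \<mu> \<omega> "t - r"] r xt \<mu> \<open>0 < \<omega>\<close> by simp
        qed
        then show "\<bar>d (x - \<mu> * \<omega> * r) \<mu> \<omega> (t - r)\<bar>
            \<le> (0 + A * (\<omega> / (\<omega> + 1)) * exp (t - r)) * g_star \<omega>"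
          using nn[of 0 "t - r"] by simp
      qed (use \<theta> \<mu> r xt in auto)
    qed
    show ?thesis
    proof (cases "0 < \<mu>")
      case True
      have "\<bar>d x \<mu> \<omega> t\<bar> \<le> (0 + A * (\<omega> / (\<omega> + 1)) * exp t) * g_star \<omega>"
        by (rule pos) (use True pt in auto)
      also have "\<dots> \<le> (\<beta> + A * (\<omega> / (\<omega> + 1)) * exp t) * g_star \<omega>"
        using \<beta> by (intro mult_right_mono g_star_nonneg) simp
      finally show ?thesis .
    next
      case False
      then have \<mu>: "\<mu> \<in> {-1..<0}" using pt by auto
      define c where "c = - (\<mu> * \<omega>)"
      have c: "0 < c" using \<mu> \<open>0 < \<omega>\<close> by (simp add: c_def mult_neg_pos)
      have \<mu>\<omega>: "\<mu> * \<omega> = - c" by (simp add: c_def)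
      define r where "r = min t ((1 - x) / c)"
      have r: "0 \<le> r" "r \<le> t" "c * r \<le> 1 - x" "r = t \<or> c * r = 1 - x"
        using pt c by (auto simp: r_def min_def field_simps)
      have xr: "x - \<mu> * \<omega> * r \<in> {0..1}"
        using r(3) pt(5) mult_nonneg_nonneg[OF less_imp_le[OF c] r(1)] by (simp add: \<mu>\<omega>)
      show ?thesis
      proof (rule kinetic_solution_step[OF tr pt(3) \<open>0 < \<omega>\<close> pt(5,6) r(1) xr])
        show "x + \<mu> * \<omega> * (s - t) \<in> {0<..<1} \<and> s \<in> {0<..<T}" if "s \<in> {t - r<..<t}" for s
        proof -
          have "c * (t - s) < c * r" "0 < c * (t - s)"
            using that c by (auto intro!: mult_strict_left_mono mult_pos_pos)
          then show ?thesis
            using that r pt by (auto simp: right_diff_distrib \<mu>\<omega>)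
        qed
        show "\<bar>d (x - \<mu> * \<omega> * r) \<mu> \<omega> (t - r)\<bar>
            \<le> (\<beta> + A * (\<omega> / (\<omega> + 1)) * exp (t - r)) * g_star \<omega>"
        proof (cases "t - r = 0")
          case True
          then show ?thesis
            using d0[of "x - \<mu> * \<omega> * r" \<mu> \<omega>] xr \<mu> \<open>0 < \<omega>\<close> nn[of \<beta> "t - r"] \<beta> by simp
        next
          case False
          then have x1: "x - \<mu> * \<omega> * r = 1" and tr: "t - r \<in> {0<..T}"
            using r pt by (auto simp: \<mu>\<omega>)
          \<comment> \<open>The value before the reflection belongs to the direction - \<mu> > 0,
            whose bound is free of \<beta>; the defect of the reflection law adds it here.\<close>
          have "\<bar>d 1 \<mu> \<omega> (t - r)\<bar> \<le> \<bar>d 1 (- \<mu>) \<omega> (t - r)\<bar> + \<beta> * g_star \<omega>"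
            by (rule refl[OF pt(1) \<mu> \<open>0 < \<omega>\<close> tr])
          also have "\<bar>d 1 (- \<mu>) \<omega> (t - r)\<bar> \<le> (0 + A * (\<omega> / (\<omega> + 1)) * exp (t - r)) * g_star \<omega>"
            by (rule pos) (use \<mu> tr in auto)
          finally show ?thesis
            unfolding x1 by (simp add: algebra_simps)
        qed
      qed (use \<theta> \<beta> r pt in auto)
    qed
  qed
  have \<theta>_est: "\<bar>temperature d x t\<bar> \<le> \<beta> + A * relaxation_ratio * exp t"
    if A: "0 \<le> A"
      and \<theta>: "\<And>x t. x \<in> {0<..<1} \<Longrightarrow> t \<in> {0<..<T} \<Longrightarrow> \<bar>temperature d x t\<bar> \<le> A * exp t"
      and xt: "x \<in> {0<..<1}" "t \<in> {0<..<T}" for A x t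
  proof -
    let ?k = "\<lambda>\<omega>. \<beta> * g_star \<omega> + A * exp t * (\<omega> / (\<omega> + 1) * g_star \<omega>)"
    have k: "(\<lambda>\<mu>::real. \<lambda>\<omega>. \<omega> * ?k \<omega>)
        = (\<lambda>\<mu> \<omega>. \<beta> * (\<omega> * g_star \<omega>) + A * exp t * (\<omega> * (\<omega> / (\<omega> + 1) * g_star \<omega>)))"
      by (simp add: fun_eq_iff algebra_simps)
    note ki = bracket_add[OF bracket_mult(1)[OF set_integrable_omega_g_star, of \<beta>]
      bracket_mult(1)[OF bracket_weight_less(3), of "A * exp t"]]
    have kint: "set_integrable lborel velocities (\<lambda>(\<mu>, \<omega>). \<omega> * ?k \<omega>)"
      using ki(1) unfolding k[symmetric] .
    have kval: "bracket (\<lambda>\<mu> \<omega>. \<omega> * ?k \<omega>)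
        = \<beta> * ?Z + A * exp t * bracket (\<lambda>\<mu> \<omega>. \<omega> * (\<omega> / (\<omega> + 1) * g_star \<omega>))"
      unfolding k ki(2) bracket_mult(2)[OF set_integrable_omega_g_star] bracket_mult(2)[OF bracket_weight_less(3)] ..
    have "AE \<mu> in lborel. \<mu> \<noteq> (0::real)"
      by (rule AE_lborel_singleton)
    from AE_lborel_prodI[OF this P]
    have "AE z in lborel. z \<in> velocities \<longrightarrow> \<bar>d x (fst z) (snd z) t\<bar> \<le> ?k (snd z)"
    proof (rule eventually_mono, intro impI)
      fix z :: "real \<times> real"
      assume z: "fst z \<noteq> 0 \<and> P (snd z)" "z \<in> velocities"
      have "\<bar>d x (fst z) (snd z) t\<bar> \<le> (\<beta> + A * (snd z / (snd z + 1)) * exp t) * g_star (snd z)"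
        by (rule est[OF A \<theta>]) (use z xt in auto)
      then show "\<bar>d x (fst z) (snd z) t\<bar> \<le> ?k (snd z)"
        by (simp add: algebra_simps)
    qed
    from bracket_dominated(2)[OF measurable_velocity_section[OF m] kint this]
    have "\<bar>bracket (\<lambda>\<mu> \<omega>. \<omega> * d x \<mu> \<omega> t)\<bar>
        \<le> \<beta> * ?Z + A * exp t * bracket (\<lambda>\<mu> \<omega>. \<omega> * (\<omega> / (\<omega> + 1) * g_star \<omega>))"
      using xt unfolding kval by simp
    then show ?thesis
      using bracket_weight_pos by (simp add: temperature_def relaxation_ratio_def field_simps)
  qed
  obtain C where C: "\<And>x t. x \<in> {0..1} \<Longrightarrow> t \<in> {0..T} \<Longrightarrow> \<bar>temperature d x t\<bar> \<le> C" "0 \<le> C"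
    using kinetic_solution_temperature_bounded[OF d] by metis
  \<comment> \<open>The supremum of this set is the least admissible A. It is finite by the bound
    \<open>C\<close>, and finiteness is what permits A \<open>relaxation_ratio\<close> to be moved
    to the left side below.\<close>
  define \<Theta> where "\<Theta> = (\<lambda>(x, t). \<bar>temperature d x t\<bar> * exp (- t)) ` ({0<..<1} \<times> {0<..<T})"
  have ne: "\<Theta> \<noteq> {}" using T by (simp add: \<Theta>_def)
  have "y \<le> C" if "y \<in> \<Theta>" for y
  proof -
    from that obtain x t where xt: "x \<in> {0<..<1}" "t \<in> {0<..<T}" "y = \<bar>temperature d x t\<bar> * exp (- t)"
      by (auto simp: \<Theta>_def)
    have "\<bar>temperature d x t\<bar> * exp (- t) \<le> C * 1"
      using C xt by (intro mult_mono) auto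
    then show ?thesis using xt by simp
  qed
  then have bdd: "bdd_above \<Theta>" by (auto simp: bdd_above_def)
  define A where "A = Sup \<Theta>"
  obtain y where y: "y \<in> \<Theta>" using ne by auto
  then have "0 \<le> y" by (auto simp: \<Theta>_def)
  then have A: "0 \<le> A"
    unfolding A_def by (rule cSup_upper2[OF y _ bdd])
  have \<theta>: "\<bar>temperature d x t\<bar> \<le> A * exp t" if "x \<in> {0<..<1}" "t \<in> {0<..<T}" for x t
  proof -
    have "\<bar>temperature d x t\<bar> * exp (- t) \<le> A"
      unfolding A_def using that by (intro cSup_upper bdd) (auto simp: \<Theta>_def)
    then show ?thesis by (simp add: exp_minus field_simps)
  qed
  have "A \<le> \<beta> + A * relaxation_ratio"
    unfolding A_def
  proof (rule cSup_least[OF ne])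
    fix y assume "y \<in> \<Theta>"
    then obtain x t where xt: "x \<in> {0<..<1}" "t \<in> {0<..<T}" "y = \<bar>temperature d x t\<bar> * exp (- t)"
      by (auto simp: \<Theta>_def)
    have "y \<le> (\<beta> + A * relaxation_ratio * exp t) * exp (- t)"
      unfolding xt(3) by (intro mult_right_mono \<theta>_est[OF A \<theta>] xt) auto
    also have "\<dots> = \<beta> * exp (- t) + A * relaxation_ratio"
      by (simp add: algebra_simps exp_minus)
    also have "\<beta> * exp (- t) \<le> \<beta> * 1"
      using \<beta> xt by (intro mult_left_mono) auto
    finally show "y \<le> \<beta> + Sup \<Theta> * relaxation_ratio"
      by (simp add: A_def)
  qed
  then have A_le: "A \<le> \<beta> / (1 - relaxation_ratio)"
    using relaxation_ratio(2) by (simp add: field_simps)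
  have "A * (\<omega> / (\<omega> + 1)) * exp t \<le> A * 1 * exp T"
    using A pt by (intro mult_mono mult_nonneg_nonneg) auto
  also have "\<dots> \<le> \<beta> / (1 - relaxation_ratio) * 1 * exp T"
    using A_le by (intro mult_right_mono) auto
  finally have "\<beta> + A * (\<omega> / (\<omega> + 1)) * exp t \<le> \<beta> * (1 + exp T / (1 - relaxation_ratio))"
    by (simp add: algebra_simps)
  then show ?thesis
    using est[OF A \<theta> pt] mult_right_mono[OF _ g_star_nonneg[of \<omega>]] order_trans by blast
qed

subsection \<open>Integrability of the adjoint solution\<close>

text \<open>The transport equation is posed in the open rectangle of (x, t), so the indicator of the
  closed phase space is cut down to it while the velocity is moved to the front.\<close>

lemma measurable_phase_swap:
  fixes f :: "real \<Rightarrow> real \<Rightarrow> real \<Rightarrow> real \<Rightarrow> real"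
  assumes "set_borel_measurable borel (phase_space T) (\<lambda>(x, \<mu>, \<omega>, t). f x \<mu> \<omega> t)"
  shows "(\<lambda>((\<mu>, \<omega>), (x, t)). indicator velocities (\<mu>, \<omega>) *
    (indicator ({0<..<1} \<times> {0<..<T}) (x, t) * f x \<mu> \<omega> t)) \<in> borel_measurable borel"
proof -
  have "(\<lambda>((\<mu>, \<omega>), (x, t)). indicator (phase_space T) (x, \<mu>, \<omega>, t) * f x \<mu> \<omega> t) \<in> borel_measurable borel"
    using measurable_lborel_transform[OF preserves_lborel_phase assms[unfolded set_borel_measurable_def]]
    by (simp add: case_prod_unfold)
  moreover have "(\<lambda>(v, p). indicator velocities v * indicator ({0<..<1} \<times> {0<..<T}) p :: real)
      \<in> borel_measurable (borel :: ((real \<times> real) \<times> (real \<times> real)) measure)"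
    unfolding borel_prod[symmetric] case_prod_unfold by measurable
  ultimately have "(\<lambda>z. (\<lambda>((\<mu>, \<omega>), (x, t)). indicator (phase_space T) (x, \<mu>, \<omega>, t) * f x \<mu> \<omega> t) z
      * (\<lambda>(v, p). indicator velocities v * indicator ({0<..<1} \<times> {0<..<T}) p) z) \<in> borel_measurable borel"
    by (rule borel_measurable_times)
  also have "(\<lambda>z. (\<lambda>((\<mu>, \<omega>), (x, t)). indicator (phase_space T) (x, \<mu>, \<omega>, t) * f x \<mu> \<omega> t) z
      * (\<lambda>(v, p). indicator velocities v * indicator ({0<..<1} \<times> {0<..<T}) p) z)
    = (\<lambda>((\<mu>, \<omega>), (x, t)). indicator velocities (\<mu>, \<omega>) *
        (indicator ({0<..<1} \<times> {0<..<T}) (x, t) * f x \<mu> \<omega> t))"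
    by (auto simp: fun_eq_iff phase_space_def indicator_def)
  finally show ?thesis .
qed

lemma integrable_phase_swap:
  fixes f :: "real \<Rightarrow> real \<Rightarrow> real \<Rightarrow> real \<Rightarrow> real"
  assumes "set_integrable lborel (phase_space T) (\<lambda>(x, \<mu>, \<omega>, t). f x \<mu> \<omega> t)"
  shows "integrable lborel (\<lambda>((\<mu>, \<omega>), (x, t)). indicator velocities (\<mu>, \<omega>) *
    (indicator ({0<..<1} \<times> {0<..<T}) (x, t) * f x \<mu> \<omega> t))"
proof (rule Bochner_Integration.integrable_bound)
  show "integrable lborel (\<lambda>((\<mu>, \<omega>), (x, t)). indicator (phase_space T) (x, \<mu>, \<omega>, t) * f x \<mu> \<omega> t)"
    using integrable_lborel_transform[OF preserves_lborel_phase assms[unfolded set_integrable_def]]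
    by (simp add: case_prod_unfold)
  have "set_borel_measurable borel (phase_space T) (\<lambda>(x, \<mu>, \<omega>, t). f x \<mu> \<omega> t)"
    using borel_measurable_integrable[OF assms[unfolded set_integrable_def]]
    by (simp add: set_borel_measurable_def)
  from measurable_phase_swap[OF this]
  show "(\<lambda>((\<mu>, \<omega>), (x, t)). indicator velocities (\<mu>, \<omega>) *
    (indicator ({0<..<1} \<times> {0<..<T}) (x, t) * f x \<mu> \<omega> t)) \<in> borel_measurable lborel"
    by simp
qed (auto intro!: AE_I2 simp: phase_space_def indicator_def)

text \<open>Slices at fixed x are null sets of the phase space, so almost everywhere information
  says nothing about boundary traces. Joint Borel measurability is what makes them
  measurable.\<close>

lemma measurable_boundary_section:
  fixes f :: "real \<Rightarrow> real \<Rightarrow> real \<Rightarrow> real \<Rightarrow> real"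
  assumes "set_borel_measurable borel (phase_space T) (\<lambda>(x, \<mu>, \<omega>, t). f x \<mu> \<omega> t)"
    and "x \<in> {0..1}"
  shows "(\<lambda>((\<mu>, \<omega>), t). indicator velocities (\<mu>, \<omega>) * (indicator {0..T} t * f x \<mu> \<omega> t))
    \<in> borel_measurable borel"
proof -
  have "(\<lambda>((\<mu>::real, \<omega>::real), t::real). (x, \<mu>, \<omega>, t)) \<in> borel_measurable borel"
    unfolding borel_prod[symmetric] case_prod_unfold by measurable
  from measurable_compose[OF this assms(1)[unfolded set_borel_measurable_def]]
  have "(\<lambda>((\<mu>, \<omega>), t). indicator (phase_space T) (x, \<mu>, \<omega>, t) * f x \<mu> \<omega> t) \<in> borel_measurable borel"
    by (simp add: case_prod_unfold)
  moreover have "indicator (phase_space T) (x, \<mu>, \<omega>, t) * f x \<mu> \<omega> t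
      = indicator velocities (\<mu>, \<omega>) * (indicator {0..T} t * f x \<mu> \<omega> t)" for \<mu> \<omega> t
    using assms(2) by (auto simp: phase_space_def indicator_def)
  ultimately show ?thesis by simp
qed

text \<open>Integrability is assumed for \<omega> h; division by \<omega> > 0 recovers
  \<open>h\<close> on the phase space.\<close>

lemma adjoint_solution_measurable:
  assumes "adjoint_solution T \<psi> \<eta> h"
  shows "set_borel_measurable borel (phase_space T) (\<lambda>(x, \<mu>, \<omega>, t). h x \<mu> \<omega> t)"
proof -
  have "(\<lambda>z. indicator (phase_space T) z *\<^sub>R (\<lambda>(x, \<mu>, \<omega>, t). \<omega> * h x \<mu> \<omega> t) z)
      \<in> borel_measurable borel"
    using assms borel_measurable_integrable
    by (fastforce simp: adjoint_solution_def set_integrable_def)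
  moreover have "(\<lambda>(x, \<mu>, \<omega>, t). 1 / \<omega>)
      \<in> borel_measurable (borel :: (real \<times> real \<times> real \<times> real) measure)"
    unfolding borel_prod[symmetric] case_prod_unfold by measurable
  ultimately have "(\<lambda>z. (indicator (phase_space T) z *\<^sub>R (\<lambda>(x, \<mu>, \<omega>, t). \<omega> * h x \<mu> \<omega> t) z)
      * (\<lambda>(x, \<mu>, \<omega>, t). 1 / \<omega>) z) \<in> borel_measurable borel"
    by (rule borel_measurable_times)
  also have "(\<lambda>z. (indicator (phase_space T) z *\<^sub>R (\<lambda>(x, \<mu>, \<omega>, t). \<omega> * h x \<mu> \<omega> t) z)
      * (\<lambda>(x, \<mu>, \<omega>, t). 1 / \<omega>) z)
    = (\<lambda>z. indicator (phase_space T) z *\<^sub>R (\<lambda>(x, \<mu>, \<omega>, t). h x \<mu> \<omega> t) z)"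
    by (auto simp: fun_eq_iff phase_space_def indicator_def)
  finally show ?thesis
    by (simp add: set_borel_measurable_def)
qed

lemma moment_eq_temperature:
  assumes "set_integrable lborel velocities (\<lambda>(\<mu>, \<omega>). \<omega> * f x \<mu> \<omega> t)"
  shows "(LINT v|lborel. indicator velocities v * (\<lambda>(\<mu>, \<omega>). \<omega> * f x \<mu> \<omega> t) v)
    = bracket (\<lambda>\<mu> \<omega>. \<omega> * g_star \<omega>) * temperature f x t"
  using bracket_eq_integral[OF assms] bracket_weight_pos
  by (simp add: temperature_def set_lebesgue_integral_def)

text \<open>The moment over velocities is a positive multiple of the temperature, so Fubini gives
  integrability in (x, t). The hypothesis on every slice makes the iterated \<open>bracket\<close>
  equal to the planar integral at every interior (x, t), not just at almost every one.\<close>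

lemma temperature_integrable:
  assumes int: "integrable lborel (\<lambda>((\<mu>, \<omega>), (x, t)). indicator velocities (\<mu>, \<omega>) *
      (indicator ({0<..<1} \<times> {0<..<T}) (x, t) * (\<omega> * f x \<mu> \<omega> t)))"
    and f: "\<And>x t. x \<in> {0<..<1} \<Longrightarrow> t \<in> {0<..<T} \<Longrightarrow>
      set_integrable lborel velocities (\<lambda>(\<mu>, \<omega>). \<omega> * f x \<mu> \<omega> t)"
  shows "integrable lborel (\<lambda>(x, t). indicator ({0<..<1} \<times> {0<..<T}) (x, t) * temperature f x t)"
proof -
  let ?Z = "bracket (\<lambda>\<mu> \<omega>. \<omega> * g_star \<omega>)"
  let ?\<Omega> = "{0<..<1} \<times> {0<..<T} :: (real \<times> real) set"
  have "integrable (lborel \<Otimes>\<^sub>M lborel) (\<lambda>(v, p). indicator velocities v *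
      (indicator ?\<Omega> p * (snd v * f (fst p) (fst v) (snd v) (snd p))))"
    using int by (simp add: lborel_prod case_prod_unfold)
  from lborel_pair.integrable_snd[OF this]
  have "integrable lborel (\<lambda>p. LINT v|lborel. indicator velocities v *
      (indicator ?\<Omega> p * (snd v * f (fst p) (fst v) (snd v) (snd p))))" .
  moreover have "(LINT v|lborel. indicator velocities v *
      (indicator ?\<Omega> p * (snd v * f (fst p) (fst v) (snd v) (snd p))))
    = ?Z * (\<lambda>(x, t). indicator ?\<Omega> (x, t) * temperature f x t) p" for p
  proof (cases "p \<in> ?\<Omega>")
    case True
    then obtain x t where p: "p = (x, t)" "x \<in> {0<..<1}" "t \<in> {0<..<T}" by auto
    from moment_eq_temperature[of f x t, OF f[OF p(2,3)]] show ?thesis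
      using p by (simp add: case_prod_unfold)
  qed (simp add: case_prod_unfold)
  ultimately have "integrable lborel (\<lambda>p. ?Z * (\<lambda>(x, t). indicator ?\<Omega> (x, t) * temperature f x t) p)"
    by simp
  then have "?Z = 0 \<or> integrable lborel (\<lambda>(x, t). indicator ?\<Omega> (x, t) * temperature f x t)"
    by (rule iffD1[OF integrable_mult_left_iff])
  then show ?thesis
    using bracket_weight_pos by (elim disjE) simp_all
qed

lemma adjoint_solution_temperature_integrable:
  assumes h: "adjoint_solution T \<psi> \<eta> h"
  shows "integrable lborel (\<lambda>(x, t). indicator ({0<..<1} \<times> {0<..<T}) (x, t) * temperature h x t)"
  using h by (intro temperature_integrable integrable_phase_swap) (auto simp: adjoint_solution_def)

lemma integrable_weight_velocities:
  "integrable lborel (\<lambda>v. indicator velocities v * (snd v * g_star (snd v)))"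
  using set_integrable_omega_g_star by (simp add: set_integrable_def case_prod_unfold)

text \<open>The source is \<omega> h minus \<omega> \<open>g_star\<close> times the temperature of
  \<open>h\<close>. The second term is a function of the velocity times a function of (x, t), hence
  integrable as a product.\<close>

lemma adjoint_solution_source_integrable:
  assumes h: "adjoint_solution T \<psi> \<eta> h"
  shows "integrable lborel (\<lambda>((\<mu>, \<omega>), (x, t)). indicator velocities (\<mu>, \<omega>) *
    (indicator ({0<..<1} \<times> {0<..<T}) (x, t) * (- collision (\<lambda>\<mu> \<omega>. h x \<mu> \<omega> t) \<mu> \<omega>)))"
proof -
  let ?\<Omega> = "{0<..<1} \<times> {0<..<T} :: (real \<times> real) set"
  have 1: "integrable lborel (\<lambda>((\<mu>, \<omega>), (x, t)). indicator velocities (\<mu>, \<omega>) *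
      (indicator ?\<Omega> (x, t) * (\<omega> * h x \<mu> \<omega> t)))"
    using h by (intro integrable_phase_swap) (simp add: adjoint_solution_def)
  have 2: "integrable lborel (\<lambda>(v, p). indicator velocities v * (snd v * g_star (snd v)) *
      (\<lambda>(x, t). indicator ?\<Omega> (x, t) * temperature h x t) p)"
    by (intro integrable_lborel_mult integrable_weight_velocities adjoint_solution_temperature_integrable[OF h])
  from Bochner_Integration.integrable_diff[OF 1 2] show ?thesis
    by (simp add: collision_eq_temperature case_prod_unfold algebra_simps)
qed

text \<open>For \<mu> < 0 the flux at x = 1 is controlled by the flux at x = 0 and the source in
  between. The factor \<mu> of the flux cancels the 1 / \<mu> of the datum and leaves \<omega>
  \<open>g_star\<close> \<psi>, so both contributions remain integrable after integration over
  velocities.\<close>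

lemma adjoint_solution_trace_integrable:
  assumes T: "0 < T" and h: "adjoint_solution T \<psi> \<eta> h" and \<psi>: "set_integrable lborel {0..T} \<psi>"
  shows "integrable lborel (\<lambda>((\<mu>, \<omega>), t). indicator ({-1..<0} \<times> {0<..}) (\<mu>, \<omega>) *
    (indicator {0..T} t * (\<mu> * \<omega> * h 1 \<mu> \<omega> t)))"
proof (rule integrableI_bounded)
  let ?\<Omega> = "{0<..<1} \<times> {0<..<T} :: (real \<times> real) set"
  let ?N = "{-1..<0} \<times> {0<..} :: (real \<times> real) set"
  let ?J = "\<lambda>((\<mu>, \<omega>), t). indicator ?N (\<mu>, \<omega>) * (indicator {0..T} t * (\<mu> * \<omega> * h 1 \<mu> \<omega> t))"
  let ?S = "\<lambda>v p. indicator velocities v * (indicator ?\<Omega> p *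
    (- collision (\<lambda>\<mu> \<omega>. h (fst p) \<mu> \<omega> (snd p)) (fst v) (snd v)))"
  let ?W = "\<lambda>v t. indicator velocities v * (snd v * g_star (snd v)) * (indicator {0..T} t * \<psi> t)"
  note hm = adjoint_solution_measurable[OF h]
  have Sint: "integrable lborel (\<lambda>(v, p). ?S v p)"
    using adjoint_solution_source_integrable[OF h] by (simp add: case_prod_unfold)
  have Wint: "integrable lborel (\<lambda>(v, t). ?W v t)"
    using \<psi> by (intro integrable_lborel_mult integrable_weight_velocities) (simp add: set_integrable_def)
  have bm: "(\<lambda>(v, t). indicator velocities v * (indicator {0..T} t * h x (fst v) (snd v) t))
      \<in> borel_measurable (borel \<Otimes>\<^sub>M borel)" if "x \<in> {0..1}" for x
    using measurable_boundary_section[OF hm that] by (simp add: borel_prod case_prod_unfold)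
  have Jeq: "?J = (\<lambda>z. (indicator ?N (fst z) * fst (fst z) * snd (fst z)) *
      (\<lambda>(v, t). indicator velocities v * (indicator {0..T} t * h 1 (fst v) (snd v) t)) z)"
    by (auto simp: fun_eq_iff indicator_def)
  have km: "(\<lambda>z. indicator ?N (fst z) * fst (fst z) * snd (fst z))
      \<in> borel_measurable (borel :: ((real \<times> real) \<times> real) measure)"
    unfolding borel_prod[symmetric] by measurable
  have bm1: "(\<lambda>(v, t). indicator velocities v * (indicator {0..T} t * h 1 (fst v) (snd v) t))
      \<in> borel_measurable borel"
    using bm[of 1] by (simp add: borel_prod)
  show Jm: "?J \<in> borel_measurable lborel"
    unfolding Jeq using borel_measurable_times[OF km bm1] by simp
  have le: "(\<integral>\<^sup>+ t. ennreal \<bar>?J (v, t)\<bar> \<partial>lborel)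
      \<le> (\<integral>\<^sup>+ t. ennreal \<bar>?W v t\<bar> \<partial>lborel) + (\<integral>\<^sup>+ p. ennreal \<bar>?S v p\<bar> \<partial>lborel)" for v
  proof (cases "v \<in> ?N")
    case True
    then obtain \<mu> \<omega> where v: "v = (\<mu>, \<omega>)" and \<mu>: "\<mu> \<in> {-1..<0}" and \<omega>: "0 < \<omega>" by auto
    have vV: "v \<in> velocities" using True by auto
    have tr: "solves_transport T h (\<lambda>x \<mu> \<omega> t. - collision (\<lambda>\<mu> \<omega>. h x \<mu> \<omega> t) \<mu> \<omega>)"
      and hT: "\<And>x. x \<in> {0..1} \<Longrightarrow> h x \<mu> \<omega> T = 0"
      and h0: "\<And>t. t \<in> {0..<T} \<Longrightarrow> h 0 \<mu> \<omega> t = \<psi> t * g_star \<omega> / \<mu>"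
      using h \<mu> \<omega> by (auto simp: adjoint_solution_def)
    have sec: "(\<lambda>t. indicator {0..T} t * h x \<mu> \<omega> t) \<in> borel_measurable borel" if "x \<in> {0..1}" for x
    proof -
      have "(\<lambda>t. (\<lambda>(v, t). indicator velocities v * (indicator {0..T} t * h x (fst v) (snd v) t)) (v, t))
          \<in> borel_measurable borel"
        using bm[OF that] by (rule measurable_Pair2) simp
      moreover have "(\<lambda>t. (\<lambda>(v, t). indicator velocities v * (indicator {0..T} t * h x (fst v) (snd v) t)) (v, t))
          = (\<lambda>t. indicator {0..T} t * h x \<mu> \<omega> t)"
        using vV by (simp add: v)
      ultimately show ?thesis by (simp only:)
    qed
    have Ssec: "(\<lambda>p. ?S v p) \<in> borel_measurable borel"
    proof -
      have "(\<lambda>(v, p). ?S v p) \<in> borel_measurable (borel \<Otimes>\<^sub>M borel)"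
        using borel_measurable_integrable[OF Sint] by (simp only: borel_prod measurable_lborel2)
      then have "(\<lambda>p. (\<lambda>(v, p). ?S v p) (v, p)) \<in> borel_measurable borel"
        by (rule measurable_Pair2) simp
      then show ?thesis by (simp only: prod.case)
    qed
    have J_eq: "(\<integral>\<^sup>+ t. ennreal \<bar>?J (v, t)\<bar> \<partial>lborel)
        = (\<integral>\<^sup>+ t. ennreal (\<bar>\<mu> * \<omega>\<bar> * \<bar>indicator {0..T} t * h 1 \<mu> \<omega> t\<bar>) \<partial>lborel)"
      using True by (simp add: v abs_mult mult_ac)
    have iv: "indicator velocities (\<mu>, \<omega>) = (1::real)"
      using vV v by simp
    have Spt: "?S v p = indicator ?\<Omega> p * (- collision (\<lambda>\<mu> \<omega>. h (fst p) \<mu> \<omega> (snd p)) \<mu> \<omega>)" for p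
      by (simp only: v iv fst_conv snd_conv mult_1_left)
    have der: "has_transport_derivative (\<mu> * \<omega>) (\<lambda>x t. h x \<mu> \<omega> t)
        (- collision (\<lambda>\<mu> \<omega>. h x \<mu> \<omega> t) \<mu> \<omega>) x t" if "x \<in> {0<..<1}" "t \<in> {0<..<T}" for x t
      using tr \<mu> \<omega> that unfolding solves_transport_def by auto
    have cont: "continuous_on {s. x + \<mu> * \<omega> * s \<in> {0..1} \<and> t + s \<in> {0..T}}
        (\<lambda>s. h (x + \<mu> * \<omega> * s) \<mu> \<omega> (t + s))" if "x \<in> {0..1}" "t \<in> {0..T}" for x t
      using tr \<mu> \<omega> that unfolding solves_transport_def by auto
    have "(\<integral>\<^sup>+ t. ennreal \<bar>?J (v, t)\<bar> \<partial>lborel) \<le> (\<integral>\<^sup>+ t. ennreal (\<bar>\<mu> * \<omega>\<bar> * \<bar>indicator {0..T} t * h 0 \<mu> \<omega> t\<bar>) \<partial>lborel)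
        + (\<integral>\<^sup>+ (x, t). ennreal \<bar>indicator ?\<Omega> (x, t) * (- collision (\<lambda>\<mu> \<omega>. h x \<mu> \<omega> t) \<mu> \<omega>)\<bar> \<partial>lborel)"
      unfolding J_eq
    proof (rule transport_trace[OF T])
      show "\<mu> * \<omega> < 0" using \<mu> \<omega> by (simp add: mult_neg_pos)
      show "(\<lambda>(x, t). indicator ?\<Omega> (x, t) * (- collision (\<lambda>\<mu> \<omega>. h x \<mu> \<omega> t) \<mu> \<omega>))
          \<in> borel_measurable borel"
        using Ssec by (simp only: Spt case_prod_unfold prod.collapse)
    qed (rule der cont hT sec; simp)+
    also have "(\<integral>\<^sup>+ t. ennreal (\<bar>\<mu> * \<omega>\<bar> * \<bar>indicator {0..T} t * h 0 \<mu> \<omega> t\<bar>) \<partial>lborel)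
        \<le> (\<integral>\<^sup>+ t. ennreal \<bar>?W v t\<bar> \<partial>lborel)"
    proof (intro nn_integral_mono ennreal_leI)
      fix t
      show "\<bar>\<mu> * \<omega>\<bar> * \<bar>indicator {0..T} t * h 0 \<mu> \<omega> t\<bar> \<le> \<bar>?W v t\<bar>"
      proof (cases "t \<in> {0..<T}")
        case True
        then show ?thesis
          using h0[OF True] \<mu> vV by (simp add: v abs_mult)
      next
        case False
        \<comment> \<open>The datum is prescribed for t < T only; at t = T the final condition makes
          \<open>h\<close> vanish.\<close>
        then have "indicator {0..T} t * h 0 \<mu> \<omega> t = 0"
          using hT[of 0] by (cases "t = T") (auto simp: indicator_def)
        then show ?thesis by (simp only: abs_zero mult_zero_right abs_ge_zero)
      qed
    qed
    also have "(\<integral>\<^sup>+ (x, t). ennreal \<bar>indicator ?\<Omega> (x, t) * (- collision (\<lambda>\<mu> \<omega>. h x \<mu> \<omega> t) \<mu> \<omega>)\<bar> \<partial>lborel)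
        = (\<integral>\<^sup>+ p. ennreal \<bar>?S v p\<bar> \<partial>lborel)"
      by (simp only: Spt case_prod_unfold prod.collapse)
    finally show ?thesis by (simp add: add_right_mono)
  qed (simp add: case_prod_unfold)
  have "(\<integral>\<^sup>+ z. ennreal (norm (?J z)) \<partial>lborel) = (\<integral>\<^sup>+ v. \<integral>\<^sup>+ t. ennreal \<bar>?J (v, t)\<bar> \<partial>lborel \<partial>lborel)"
    using Jm by (subst nn_integral_lborel_pair) simp_all
  also have "\<dots> \<le> (\<integral>\<^sup>+ v. (\<integral>\<^sup>+ t. ennreal \<bar>?W v t\<bar> \<partial>lborel) + (\<integral>\<^sup>+ p. ennreal \<bar>?S v p\<bar> \<partial>lborel) \<partial>lborel)"
    by (intro nn_integral_mono le)
  also have "\<dots> = (\<integral>\<^sup>+ v. \<integral>\<^sup>+ t. ennreal \<bar>?W v t\<bar> \<partial>lborel \<partial>lborel)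
      + (\<integral>\<^sup>+ v. \<integral>\<^sup>+ p. ennreal \<bar>?S v p\<bar> \<partial>lborel \<partial>lborel)"
  proof (rule nn_integral_add)
    show "(\<lambda>v. \<integral>\<^sup>+ t. ennreal \<bar>?W v t\<bar> \<partial>lborel) \<in> borel_measurable lborel"
      by (rule lborel.borel_measurable_nn_integral)
        (use borel_measurable_integrable[OF Wint] in \<open>simp add: lborel_prod case_prod_unfold\<close>)
    show "(\<lambda>v. \<integral>\<^sup>+ p. ennreal \<bar>?S v p\<bar> \<partial>lborel) \<in> borel_measurable lborel"
      by (rule lborel.borel_measurable_nn_integral)
        (use borel_measurable_integrable[OF Sint] in \<open>simp add: lborel_prod case_prod_unfold\<close>)
  qed
  also have "(\<integral>\<^sup>+ v. \<integral>\<^sup>+ t. ennreal \<bar>?W v t\<bar> \<partial>lborel \<partial>lborel) = (\<integral>\<^sup>+ z. ennreal (norm ((\<lambda>(v, t). ?W v t) z)) \<partial>lborel)"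
    using borel_measurable_integrable[OF Wint] by (subst nn_integral_lborel_pair) simp_all
  also have "(\<integral>\<^sup>+ v. \<integral>\<^sup>+ p. ennreal \<bar>?S v p\<bar> \<partial>lborel \<partial>lborel) = (\<integral>\<^sup>+ z. ennreal (norm ((\<lambda>(v, p). ?S v p) z)) \<partial>lborel)"
    using borel_measurable_integrable[OF Sint] by (subst nn_integral_lborel_pair) simp_all
  also have "(\<integral>\<^sup>+ z. ennreal (norm ((\<lambda>(v, t). ?W v t) z)) \<partial>lborel)
      + (\<integral>\<^sup>+ z. ennreal (norm ((\<lambda>(v, p). ?S v p) z)) \<partial>lborel) < \<infinity>"
    using Wint Sint by (simp only: integrable_iff_bounded ennreal_add_less_top) simp
  finally show "(\<integral>\<^sup>+ z. ennreal (norm (?J z)) \<partial>lborel) < \<infinity>" .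
qed

subsection \<open>Green's identity\<close>

text \<open>Since \<open>g\<close> is bounded by a multiple of \<open>g_star\<close> and the
  rectangle of (x, t) is bounded, a product of two integrable functions dominates.\<close>

lemma kinetic_solution_moment_integrable:
  assumes g: "kinetic_solution T g"
  shows "integrable lborel (\<lambda>((\<mu>, \<omega>), (x, t)). indicator velocities (\<mu>, \<omega>) *
    (indicator ({0<..<1} \<times> {0<..<T}) (x, t) * (\<omega> * g x \<mu> \<omega> t)))"
proof -
  let ?\<Omega> = "{0<..<1} \<times> {0<..<T} :: (real \<times> real) set"
  obtain C where C: "\<And>x \<mu> \<omega> t. x \<in> {0..1} \<Longrightarrow> \<mu> \<in> {-1..1} \<Longrightarrow> 0 < \<omega> \<Longrightarrow> t \<in> {0..T} \<Longrightarrow>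
      \<bar>g x \<mu> \<omega> t\<bar> \<le> C * g_star \<omega>"
    using kinetic_solution_temperature_bounded[OF g] by metis
  have "integrable lborel (indicator {0<..<a} :: real \<Rightarrow> real)" for a
    using emeasure_bounded_finite[of "{0<..<a}"] by (intro integrable_real_indicator) auto
  then have "integrable lborel (\<lambda>(x::real, t::real). indicator {0<..<1} x * indicator {0<..<T} t :: real)"
    by (intro integrable_lborel_mult) auto
  then have \<Omega>: "integrable lborel (\<lambda>p. indicator ?\<Omega> p :: real)"
    by (simp add: indicator_times case_prod_unfold)
  show ?thesis
  proof (rule Bochner_Integration.integrable_bound)
    show "integrable lborel (\<lambda>(v, p). (C * (indicator velocities v * (snd v * g_star (snd v)))) * indicator ?\<Omega> p)"
      by (intro integrable_lborel_mult \<Omega> integrable_mult_right integrable_weight_velocities)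
    have m: "set_borel_measurable borel (phase_space T) (\<lambda>(x, \<mu>, \<omega>, t). g x \<mu> \<omega> t)"
      using g by (simp add: kinetic_solution_def)
    have "(\<lambda>z. snd (fst z) * (\<lambda>((\<mu>, \<omega>), (x, t)). indicator velocities (\<mu>, \<omega>) *
        (indicator ?\<Omega> (x, t) * g x \<mu> \<omega> t)) z) \<in> borel_measurable borel"
      by (intro borel_measurable_times measurable_phase_swap[OF m])
        (unfold borel_prod[symmetric], measurable)
    then show "(\<lambda>((\<mu>, \<omega>), (x, t)). indicator velocities (\<mu>, \<omega>) *
        (indicator ?\<Omega> (x, t) * (\<omega> * g x \<mu> \<omega> t))) \<in> borel_measurable lborel"
      by (simp add: case_prod_unfold mult_ac)
    have "\<bar>\<omega> * g x \<mu> \<omega> t\<bar> \<le> C * (\<omega> * g_star \<omega>)"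
      if "x \<in> {0..1}" "\<mu> \<in> {-1..1}" "0 < \<omega>" "t \<in> {0..T}" for x \<mu> \<omega> t
      using mult_left_mono[OF C[OF that], of \<omega>] that by (simp add: abs_mult mult_ac)
    then have le: "norm (indicator velocities (\<mu>, \<omega>) * (indicator ?\<Omega> (x, t) * (\<omega> * g x \<mu> \<omega> t)))
        \<le> norm (C * (indicator velocities (\<mu>, \<omega>) * (\<omega> * g_star \<omega>)) * indicator ?\<Omega> (x, t))" for x \<mu> \<omega> t
      by (force simp: indicator_def intro: order_trans[OF _ abs_ge_self])
    show "AE z in lborel. norm ((\<lambda>((\<mu>, \<omega>), (x, t)). indicator velocities (\<mu>, \<omega>) *
        (indicator ?\<Omega> (x, t) * (\<omega> * g x \<mu> \<omega> t))) z)
      \<le> norm ((\<lambda>(v, p). (C * (indicator velocities v * (snd v * g_star (snd v)))) * indicator ?\<Omega> p) z)"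
    proof (rule AE_I2)
      fix z :: "(real \<times> real) \<times> (real \<times> real)"
      show "norm ((\<lambda>((\<mu>, \<omega>), (x, t)). indicator velocities (\<mu>, \<omega>) *
          (indicator ?\<Omega> (x, t) * (\<omega> * g x \<mu> \<omega> t))) z)
        \<le> norm ((\<lambda>(v, p). (C * (indicator velocities v * (snd v * g_star (snd v)))) * indicator ?\<Omega> p) z)"
        using le[of "fst (fst z)" "snd (fst z)" "fst (snd z)" "snd (snd z)"]
        by (simp only: case_prod_unfold prod.collapse)
    qed
  qed
qed

lemma has_transport_derivative_mult:
  assumes "has_transport_derivative c u D x t" "has_transport_derivative c w E x t"
  shows "has_transport_derivative c (\<lambda>x t. u x t * w x t) (D * w x t + u x t * E) x t"
  using DERIV_mult[OF assms[unfolded has_transport_derivative_def]]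
  by (simp add: has_transport_derivative_def algebra_simps)

text \<open>In the transport derivative of d h / \<open>g_star\<close> the loss terms of
  \<open>d\<close> and \<open>h\<close> have opposite signs and cancel. The gain terms leave
  \<omega> h times the temperature of \<open>d\<close> minus \<omega> d times the temperature of
  \<open>h\<close>; averaging over velocities turns \<omega> h and \<omega> d into the same multiple
  of their temperatures, so these cancel too. The zero initial value of \<open>d\<close> and the
  zero final value of \<open>h\<close> remove the boundary terms in time.\<close>

lemma green_identity:
  fixes T :: real and d h :: "real \<Rightarrow> real \<Rightarrow> real \<Rightarrow> real \<Rightarrow> real"
  defines "B \<equiv> \<lambda>x ((\<mu>, \<omega>), t). indicator velocities (\<mu>, \<omega>) *
    (indicator {0..T} t * (\<mu> * \<omega> * (d x \<mu> \<omega> t * h x \<mu> \<omega> t / g_star \<omega>)))"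
  assumes T: "0 < T" and d: "kinetic_solution T d" and h: "adjoint_solution T \<psi> \<eta> h"
    and B0: "integrable lborel (B 0)" and B1: "integrable lborel (B 1)"
  shows "(LINT z|lborel. B 1 z) = (LINT z|lborel. B 0 z)"
proof -
  let ?Z = "bracket (\<lambda>\<mu> \<omega>. \<omega> * g_star \<omega>)"
  let ?\<Omega> = "{0<..<1} \<times> {0<..<T} :: (real \<times> real) set"
  define D where "D v p = snd v * h (fst p) (fst v) (snd v) (snd p) * temperature d (fst p) (snd p)
    - snd v * d (fst p) (fst v) (snd v) (snd p) * temperature h (fst p) (snd p)" for v p
  define M where "M f v p = indicator velocities v *
    (indicator ?\<Omega> p * (snd v * f (fst p) (fst v) (snd v) (snd p)))"
    for f :: "real \<Rightarrow> real \<Rightarrow> real \<Rightarrow> real \<Rightarrow> real" and v p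
  define \<theta> where "\<theta> f p = indicator ?\<Omega> p * temperature f (fst p) (snd p)" for f p
  define Q where "Q v p = M h v p * \<theta> d p - M d v p * \<theta> h p" for v p
  obtain C where C: "\<And>x t. x \<in> {0..1} \<Longrightarrow> t \<in> {0..T} \<Longrightarrow> \<bar>temperature d x t\<bar> \<le> C"
      "\<And>x \<mu> \<omega> t. x \<in> {0..1} \<Longrightarrow> \<mu> \<in> {-1..1} \<Longrightarrow> 0 < \<omega> \<Longrightarrow> t \<in> {0..T} \<Longrightarrow>
        \<bar>d x \<mu> \<omega> t\<bar> \<le> C * g_star \<omega>" "0 \<le> C"
    using kinetic_solution_temperature_bounded[OF d] by metis
  have mh: "set_integrable lborel velocities (\<lambda>(\<mu>, \<omega>). \<omega> * h x \<mu> \<omega> t)"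
    and md: "set_integrable lborel velocities (\<lambda>(\<mu>, \<omega>). \<omega> * d x \<mu> \<omega> t)"
    if "x \<in> {0<..<1}" "t \<in> {0<..<T}" for x t
    using h d that by (auto simp: adjoint_solution_def intro!: kinetic_solution_moment)
  have Mh: "integrable lborel (\<lambda>(v, p). M h v p)"
    using integrable_phase_swap[of T "\<lambda>x \<mu> \<omega> t. \<omega> * h x \<mu> \<omega> t"] h
    by (simp add: adjoint_solution_def M_def case_prod_unfold)
  have Md: "integrable lborel (\<lambda>(v, p). M d v p)"
    using kinetic_solution_moment_integrable[OF d] by (simp add: M_def case_prod_unfold)
  have \<theta>h: "integrable lborel (\<theta> h)"
    using adjoint_solution_temperature_integrable[OF h] by (simp add: \<theta>_def[abs_def] case_prod_unfold)
  have \<theta>d: "integrable lborel (\<theta> d)"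
    using temperature_integrable[OF kinetic_solution_moment_integrable[OF d] md]
    by (simp add: \<theta>_def[abs_def] case_prod_unfold)
  have \<theta>m: "(\<lambda>z :: (real \<times> real) \<times> (real \<times> real). \<theta> h (snd z)) \<in> borel_measurable borel"
    "(\<lambda>z :: (real \<times> real) \<times> (real \<times> real). \<theta> d (snd z)) \<in> borel_measurable borel"
  proof -
    have "(snd :: (real \<times> real) \<times> (real \<times> real) \<Rightarrow> _) \<in> borel_measurable borel"
      by (intro borel_measurable_continuous_onI continuous_intros)
    then show "(\<lambda>z :: (real \<times> real) \<times> (real \<times> real). \<theta> h (snd z)) \<in> borel_measurable borel"
      "(\<lambda>z :: (real \<times> real) \<times> (real \<times> real). \<theta> d (snd z)) \<in> borel_measurable borel"
      using \<theta>h \<theta>d by (auto intro: measurable_compose)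
  qed
  have \<theta>dC: "\<bar>\<theta> d p\<bar> \<le> C" for p
    using C(1)[of "fst p" "snd p"] C(3) by (cases p) (auto simp: \<theta>_def indicator_def)
  have MdC: "\<bar>M d v p\<bar> \<le> C * (indicator velocities v * (snd v * g_star (snd v)))" for v p
  proof (cases "v \<in> velocities \<and> p \<in> ?\<Omega>")
    case True
    then have "\<bar>d (fst p) (fst v) (snd v) (snd p)\<bar> \<le> C * g_star (snd v)" "0 < snd v"
      by (auto intro!: C(2))
    then have "snd v * \<bar>d (fst p) (fst v) (snd v) (snd p)\<bar> \<le> snd v * (C * g_star (snd v))"
      by (intro mult_left_mono) auto
    then show ?thesis using True \<open>0 < snd v\<close> by (simp add: M_def abs_mult mult_ac)
  next
    case False
    then have "M d v p = 0" by (auto simp: M_def)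
    then show ?thesis
      using C(3) g_star_nonneg[of "snd v"] by (cases v) (simp add: indicator_def)
  qed
  \<comment> \<open>In each product one factor is integrable and the other controlled by the bound
    on \<open>d\<close>: the temperature of \<open>d\<close> is bounded against \<open>M h\<close>,
    while \<open>M d\<close> is dominated by an integrable function of the velocity alone, against
    the integrable temperature of \<open>h\<close>.\<close>
  have Q: "integrable lborel (\<lambda>(v, p). Q v p)"
  proof -
    have "integrable lborel (\<lambda>z. (\<lambda>(v, p). M h v p) z * \<theta> d (snd z))"
    proof (rule Bochner_Integration.integrable_bound)
      show "integrable lborel (\<lambda>z. C * (\<lambda>(v, p). M h v p) z)"
        by (intro integrable_mult_right Mh)
      show "(\<lambda>z. (\<lambda>(v, p). M h v p) z * \<theta> d (snd z)) \<in> borel_measurable lborel"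
        using borel_measurable_times[OF _ \<theta>m(2)] borel_measurable_integrable[OF Mh]
        by (simp only: measurable_lborel2)
      show "AE z in lborel. norm ((\<lambda>(v, p). M h v p) z * \<theta> d (snd z)) \<le> norm (C * (\<lambda>(v, p). M h v p) z)"
      proof (rule AE_I2)
        fix z :: "(real \<times> real) \<times> (real \<times> real)"
        show "norm ((\<lambda>(v, p). M h v p) z * \<theta> d (snd z)) \<le> norm (C * (\<lambda>(v, p). M h v p) z)"
          using mult_left_mono[OF \<theta>dC abs_ge_zero, of "(\<lambda>(v, p). M h v p) z" "snd z"] C(3)
          by (simp add: abs_mult mult.commute)
      qed
    qed
    moreover have "integrable lborel (\<lambda>z. (\<lambda>(v, p). M d v p) z * \<theta> h (snd z))"
    proof (rule Bochner_Integration.integrable_bound)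
      show "integrable lborel (\<lambda>(v, p). (C * (indicator velocities v * (snd v * g_star (snd v)))) * \<theta> h p)"
        by (intro integrable_lborel_mult \<theta>h integrable_mult_right integrable_weight_velocities)
      show "(\<lambda>z. (\<lambda>(v, p). M d v p) z * \<theta> h (snd z)) \<in> borel_measurable lborel"
        using borel_measurable_times[OF _ \<theta>m(1)] borel_measurable_integrable[OF Md]
        by (simp only: measurable_lborel2)
      show "AE z in lborel. norm ((\<lambda>(v, p). M d v p) z * \<theta> h (snd z))
          \<le> norm ((\<lambda>(v, p). (C * (indicator velocities v * (snd v * g_star (snd v)))) * \<theta> h p) z)"
      proof (rule AE_I2)
        fix z :: "(real \<times> real) \<times> (real \<times> real)"
        have "\<bar>M d (fst z) (snd z)\<bar> * \<bar>\<theta> h (snd z)\<bar>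
            \<le> C * (indicator velocities (fst z) * (snd (fst z) * g_star (snd (fst z)))) * \<bar>\<theta> h (snd z)\<bar>"
          by (intro mult_right_mono MdC) simp
        also have "\<dots> \<le> \<bar>C * (indicator velocities (fst z) * (snd (fst z) * g_star (snd (fst z))))\<bar> * \<bar>\<theta> h (snd z)\<bar>"
          by (intro mult_right_mono abs_ge_self) simp
        finally show "norm ((\<lambda>(v, p). M d v p) z * \<theta> h (snd z))
            \<le> norm ((\<lambda>(v, p). (C * (indicator velocities v * (snd v * g_star (snd v)))) * \<theta> h p) z)"
          by (simp only: real_norm_def abs_mult split_beta)
      qed
    qed
    ultimately show ?thesis
      unfolding Q_def case_prod_unfold by (rule Bochner_Integration.integrable_diff)
  qed
  have Qp: "integrable (lborel \<Otimes>\<^sub>M lborel) (\<lambda>(v, p). Q v p)"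
    using Q by (simp only: lborel_prod)
  \<comment> \<open>Both averages equal \<open>?Z\<close> times the product of the two temperatures;
    this is the self-adjointness of the gain term.\<close>
  have Q0: "(LINT v|lborel. Q v p) = 0" for p
  proof (cases "p \<in> ?\<Omega>")
    case True
    then obtain x t where p: "p = (x, t)" and xt: "x \<in> {0<..<1}" "t \<in> {0<..<T}" by auto
    have Mp: "(\<lambda>v. M f v p) = (\<lambda>v. indicator velocities v * (\<lambda>(\<mu>, \<omega>). \<omega> * f x \<mu> \<omega> t) v)" for f
      using True by (simp add: fun_eq_iff M_def p)
    have "(LINT v|lborel. Q v p) = (LINT v|lborel. M h v p * \<theta> d p) - (LINT v|lborel. M d v p * \<theta> h p)"
      unfolding Q_def
      by (intro Bochner_Integration.integral_diff integrable_mult_left)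
        (use mh[OF xt] md[OF xt] in \<open>simp_all only: Mp set_integrable_def real_scaleR_def\<close>)
    also have "\<dots> = ?Z * temperature h x t * \<theta> d p - ?Z * temperature d x t * \<theta> h p"
      unfolding integral_mult_left_zero Mp
        moment_eq_temperature[of h x t, OF mh[OF xt]] moment_eq_temperature[of d x t, OF md[OF xt]] ..
    also have "\<dots> = 0"
      using True by (simp add: \<theta>_def p)
    finally show ?thesis .
  qed (simp add: Q_def M_def)
  have "(LINT z|lborel. (\<lambda>(v, p). Q v p) z) = (LINT p|lborel. LINT v|lborel. Q v p)"
    using lborel_pair.integral_snd[OF Qp] by (simp only: lborel_prod)
  also have "\<dots> = 0" by (simp only: Q0 integral_zero)
  finally have Q_int: "(LINT z|lborel. (\<lambda>(v, p). Q v p) z) = 0" .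
  have BB: "integrable (lborel \<Otimes>\<^sub>M lborel) (\<lambda>(v, t). B x (v, t))" if "integrable lborel (B x)" for x
    using that by (simp add: lborel_prod)
  have key: "AE v in lborel. (LINT t|lborel. B 1 (v, t)) - (LINT t|lborel. B 0 (v, t)) = (LINT p|lborel. Q v p)"
  proof -
    \<comment> \<open>At \<mu> = 0 there is no motion in x and characteristics do not cross [0,1],
      so this null set is removed.\<close>
    have "AE \<mu> in lborel. \<mu> \<noteq> (0::real)" "AE \<omega> :: real in lborel. True"
      by (simp_all add: AE_lborel_singleton)
    from AE_lborel_prodI[OF this] show ?thesis
      using lborel_pair.AE_integrable_fst[OF Qp] lborel_pair.AE_integrable_fst[OF BB[OF B0]]
        lborel_pair.AE_integrable_fst[OF BB[OF B1]]
    proof eventually_elim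
      case (elim v)
      obtain \<mu> \<omega> where v: "v = (\<mu>, \<omega>)" by (cases v)
      show ?case
      proof (cases "v \<in> velocities")
        case True
        then have \<mu>: "\<mu> \<in> {-1..1}" "\<mu> \<noteq> 0" and \<omega>: "0 < \<omega>" using elim(1) by (auto simp: v)
        note gp = g_star_pos[OF \<omega>]
        have c: "\<mu> * \<omega> \<noteq> 0" using \<mu> \<omega> by simp
        let ?u = "\<lambda>x t. d x \<mu> \<omega> t * h x \<mu> \<omega> t / g_star \<omega>"
        have iv: "indicator velocities v = (1::real)" using True by simp
        have Bsec: "(\<lambda>t. B x (v, t)) = (\<lambda>t. \<mu> * \<omega> * (indicator {0..T} t * ?u x t))" for x
          using iv by (simp add: B_def v fun_eq_iff)
        have Qsec: "(\<lambda>p. Q v p) = (\<lambda>(x, t). indicator ?\<Omega> (x, t) * D v (x, t))"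
        proof
          show "Q v p = (\<lambda>(x, t). indicator ?\<Omega> (x, t) * D v (x, t)) p" for p
            by (cases "p \<in> ?\<Omega>") (simp_all add: split_beta Q_def M_def \<theta>_def D_def iv)
        qed
        have U: "integrable lborel (\<lambda>t. indicator {0..T} t * ?u x t)" if "integrable lborel (\<lambda>t. B x (v, t))" for x
          using that c unfolding Bsec integrable_mult_left_iff by blast
        have tr: "solves_transport T d (\<lambda>x \<mu> \<omega> t. collision (\<lambda>\<mu> \<omega>. d x \<mu> \<omega> t) \<mu> \<omega>)"
          "solves_transport T h (\<lambda>x \<mu> \<omega> t. - collision (\<lambda>\<mu> \<omega>. h x \<mu> \<omega> t) \<mu> \<omega>)"
          using d h by (simp_all add: kinetic_solution_def adjoint_solution_def)
        have "\<mu> * \<omega> * ((LINT t|lborel. indicator {0..T} t * ?u 1 t) - (LINT t|lborel. indicator {0..T} t * ?u 0 t))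
            = (LINT p|lborel. (\<lambda>(x, t). indicator ?\<Omega> (x, t) * D v (x, t)) p)"
        proof (rule transport_green[OF T c])
          fix x t :: real assume xt: "x \<in> {0<..<1}" "t \<in> {0<..<T}"
          have hd: "has_transport_derivative (\<mu> * \<omega>) (\<lambda>x t. d x \<mu> \<omega> t)
              (- \<omega> * d x \<mu> \<omega> t + \<omega> * g_star \<omega> * temperature d x t) x t"
            using tr(1) \<mu> \<omega> xt unfolding solves_transport_def collision_eq_temperature by blast
          have hh: "has_transport_derivative (\<mu> * \<omega>) (\<lambda>x t. h x \<mu> \<omega> t)
              (- (- \<omega> * h x \<mu> \<omega> t + \<omega> * g_star \<omega> * temperature h x t)) x t"
            using tr(2) \<mu> \<omega> xt unfolding solves_transport_def collision_eq_temperature by blast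
          have hc: "has_transport_derivative (\<mu> * \<omega>) (\<lambda>x t. 1 / g_star \<omega>) 0 x t"
            unfolding has_transport_derivative_def by simp
          have "((- \<omega> * d x \<mu> \<omega> t + \<omega> * g_star \<omega> * temperature d x t) * h x \<mu> \<omega> t
              + d x \<mu> \<omega> t * - (- \<omega> * h x \<mu> \<omega> t + \<omega> * g_star \<omega> * temperature h x t)) * (1 / g_star \<omega>)
              + d x \<mu> \<omega> t * h x \<mu> \<omega> t * 0 = D v (x, t)"
            using gp by (simp add: D_def v field_simps)
          then have "has_transport_derivative (\<mu> * \<omega>) (\<lambda>x t. d x \<mu> \<omega> t * h x \<mu> \<omega> t * (1 / g_star \<omega>)) (D v (x, t)) x t"
            using has_transport_derivative_mult[OF has_transport_derivative_mult[OF hd hh] hc] by (simp only:)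
          then show "has_transport_derivative (\<mu> * \<omega>) ?u (D v (x, t)) x t"
            by simp
        next
          fix x t :: real assume xt: "x \<in> {0..1}" "t \<in> {0..T}"
          have "continuous_on {s. x + \<mu> * \<omega> * s \<in> {0..1} \<and> t + s \<in> {0..T}} (\<lambda>s. d (x + \<mu> * \<omega> * s) \<mu> \<omega> (t + s))"
            "continuous_on {s. x + \<mu> * \<omega> * s \<in> {0..1} \<and> t + s \<in> {0..T}} (\<lambda>s. h (x + \<mu> * \<omega> * s) \<mu> \<omega> (t + s))"
            using tr \<mu> \<omega> xt unfolding solves_transport_def by blast+
          then show "continuous_on {s. x + \<mu> * \<omega> * s \<in> {0..1} \<and> t + s \<in> {0..T}}
              (\<lambda>s. ?u (x + \<mu> * \<omega> * s) (t + s))"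
            using gp by (intro continuous_intros) auto
        next
          fix x :: real assume "x \<in> {0..1}"
          then show "?u x T = 0" "?u x 0 = 0"
            using d h \<mu> \<omega> by (simp_all add: kinetic_solution_def adjoint_solution_def)
        next
          show "integrable lborel (\<lambda>(x, t). indicator ?\<Omega> (x, t) * D v (x, t))"
            using elim(2) unfolding Qsec .
        qed (rule U[OF elim(4)] U[OF elim(3)])+
        then show ?thesis
          unfolding Bsec Qsec by (simp only: integral_mult_right_zero right_diff_distrib)
      next
        case False
        then have "B x (v, t) = 0" "Q v p = 0" for x t p
          by (simp_all add: B_def Q_def M_def v)
        then show ?thesis by simp
      qed
    qed
  qed
  have fst: "integrable lborel (\<lambda>v. LINT t|lborel. B x (v, t))"
    "(LINT v|lborel. LINT t|lborel. B x (v, t)) = (LINT z|lborel. B x z)" if "integrable lborel (B x)" for x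
    using lborel_pair.integrable_fst[OF BB[OF that]] lborel_pair.integral_fst[OF BB[OF that]]
    by (simp_all add: lborel_prod)
  have "(LINT z|lborel. B 1 z) - (LINT z|lborel. B 0 z)
      = (LINT v|lborel. (LINT t|lborel. B 1 (v, t)) - (LINT t|lborel. B 0 (v, t)))"
    using fst[OF B0] fst[OF B1] by simp
  also have "\<dots> = (LINT v|lborel. LINT p|lborel. Q v p)"
    by (rule integral_cong_AE)
      (use key fst(1)[OF B0] fst(1)[OF B1] lborel_pair.integrable_fst[OF Qp] in auto)
  also have "\<dots> = 0"
    using lborel_pair.integral_fst[OF Qp] Q_int by (simp only: lborel_prod)
  finally show ?thesis by simp
qed

subsection \<open>Variation of the measurement\<close>

lemma forward_solution_kinetic: "forward_solution T \<phi> \<eta> g \<Longrightarrow> kinetic_solution T g"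
  by (simp add: forward_solution_def kinetic_solution_def)

text \<open>Linearity of the collision operator is the only point that needs care: the integral
  defining \<open>temperature\<close> splits over the difference because both moments are
  integrable.\<close>

lemma kinetic_solution_diff:
  assumes g: "kinetic_solution T g" and g': "kinetic_solution T g'"
  shows "kinetic_solution T (\<lambda>x \<mu> \<omega> t. g' x \<mu> \<omega> t - g x \<mu> \<omega> t)"
proof -
  let ?d = "\<lambda>x \<mu> \<omega> t. g' x \<mu> \<omega> t - g x \<mu> \<omega> t"
  have "set_borel_measurable borel (phase_space T) (\<lambda>(x, \<mu>, \<omega>, t). ?d x \<mu> \<omega> t)"
  proof -
    have "(\<lambda>z. indicator (phase_space T) z *\<^sub>R (\<lambda>(x, \<mu>, \<omega>, t). g' x \<mu> \<omega> t) z
        - indicator (phase_space T) z *\<^sub>R (\<lambda>(x, \<mu>, \<omega>, t). g x \<mu> \<omega> t) z) \<in> borel_measurable borel"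
      using g g' by (intro borel_measurable_diff) (simp_all add: kinetic_solution_def set_borel_measurable_def)
    then show ?thesis
      by (simp add: set_borel_measurable_def case_prod_unfold right_diff_distrib)
  qed
  moreover have "\<exists>C. \<forall>(x, \<mu>, \<omega>, t)\<in>phase_space T. \<bar>?d x \<mu> \<omega> t\<bar> \<le> C * g_star \<omega>"
  proof -
    obtain C where C: "\<forall>(x, \<mu>, \<omega>, t)\<in>phase_space T. \<bar>g x \<mu> \<omega> t\<bar> \<le> C * g_star \<omega>"
      using g unfolding kinetic_solution_def by blast
    obtain C' where C': "\<forall>(x, \<mu>, \<omega>, t)\<in>phase_space T. \<bar>g' x \<mu> \<omega> t\<bar> \<le> C' * g_star \<omega>"
      using g' unfolding kinetic_solution_def by blast
    have "\<bar>?d x \<mu> \<omega> t\<bar> \<le> (C + C') * g_star \<omega>" if "(x, \<mu>, \<omega>, t) \<in> phase_space T" for x \<mu> \<omega> t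
      using bspec[OF C that] bspec[OF C' that] by (simp add: distrib_right)
    then show ?thesis by blast
  qed
  moreover have "solves_transport T ?d (\<lambda>x \<mu> \<omega> t. collision (\<lambda>\<mu> \<omega>. ?d x \<mu> \<omega> t) \<mu> \<omega>)"
  proof -
    have tr: "solves_transport T g (\<lambda>x \<mu> \<omega> t. collision (\<lambda>\<mu> \<omega>. g x \<mu> \<omega> t) \<mu> \<omega>)"
      "solves_transport T g' (\<lambda>x \<mu> \<omega> t. collision (\<lambda>\<mu> \<omega>. g' x \<mu> \<omega> t) \<mu> \<omega>)"
      using g g' by (auto simp: kinetic_solution_def)
    have temp: "temperature ?d x t = temperature g' x t - temperature g x t"
      if "x \<in> {0..1}" "t \<in> {0..T}" for x t
    proof -
      note i = kinetic_solution_moment[OF g that] kinetic_solution_moment[OF g' that]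
      have "bracket (\<lambda>\<mu> \<omega>. \<omega> * g' x \<mu> \<omega> t + (-1) * (\<omega> * g x \<mu> \<omega> t))
          = bracket (\<lambda>\<mu> \<omega>. \<omega> * g' x \<mu> \<omega> t) + (-1) * bracket (\<lambda>\<mu> \<omega>. \<omega> * g x \<mu> \<omega> t)"
        using bracket_add(2)[OF i(2) bracket_mult(1)[OF i(1), of "-1"]] bracket_mult(2)[OF i(1), of "-1"]
        by simp
      then show ?thesis
        by (simp add: temperature_def right_diff_distrib diff_divide_distrib)
    qed
    have "has_transport_derivative (\<mu> * \<omega>) (\<lambda>x t. ?d x \<mu> \<omega> t) (collision (\<lambda>\<mu> \<omega>. ?d x \<mu> \<omega> t) \<mu> \<omega>) x t"
      if v: "\<mu> \<in> {-1..1}" "0 < \<omega>" and xt: "x \<in> {0<..<1}" "t \<in> {0<..<T}" for \<mu> \<omega> x t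
    proof -
      have c: "collision (\<lambda>\<mu> \<omega>. ?d x \<mu> \<omega> t) \<mu> \<omega>
          = collision (\<lambda>\<mu> \<omega>. g' x \<mu> \<omega> t) \<mu> \<omega> - collision (\<lambda>\<mu> \<omega>. g x \<mu> \<omega> t) \<mu> \<omega>"
      proof -
        have "temperature ?d x t = temperature g' x t - temperature g x t"
          using temp xt by simp
        then show ?thesis
          unfolding collision_eq_temperature[of ?d] collision_eq_temperature[of g] collision_eq_temperature[of g']
          by (simp only:) (simp add: algebra_simps)
      qed
      have "has_transport_derivative (\<mu> * \<omega>) (\<lambda>x t. g x \<mu> \<omega> t) (collision (\<lambda>\<mu> \<omega>. g x \<mu> \<omega> t) \<mu> \<omega>) x t"
        "has_transport_derivative (\<mu> * \<omega>) (\<lambda>x t. g' x \<mu> \<omega> t) (collision (\<lambda>\<mu> \<omega>. g' x \<mu> \<omega> t) \<mu> \<omega>) x t"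
        using tr v xt unfolding solves_transport_def by blast+
      then show ?thesis
        unfolding c has_transport_derivative_def by (intro DERIV_diff)
    qed
    moreover have "continuous_on {s. x + \<mu> * \<omega> * s \<in> {0..1} \<and> t + s \<in> {0..T}}
        (\<lambda>s. ?d (x + \<mu> * \<omega> * s) \<mu> \<omega> (t + s))"
      if "\<mu> \<in> {-1..1}" "0 < \<omega>" "x \<in> {0..1}" "t \<in> {0..T}" for \<mu> \<omega> x t
      using tr that unfolding solves_transport_def by (intro continuous_on_diff) blast+
    ultimately show ?thesis
      unfolding solves_transport_def by blast
  qed
  moreover have "\<forall>x\<in>{0..1}. \<forall>\<mu>\<in>{-1..1}. \<forall>\<omega>>0. ?d x \<mu> \<omega> 0 = 0"
    using g g' by (simp add: kinetic_solution_def)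
  ultimately show ?thesis
    unfolding kinetic_solution_def by blast
qed

text \<open>Fubini turns the measurement into one integral over velocity and time, the form in which
  Green's identity produces it at x = 0.\<close>

lemma measurement_eq_integral:
  assumes g: "kinetic_solution T g" and \<psi>: "set_integrable lborel {0..T} \<psi>" and T: "0 < T"
  defines "W \<equiv> \<lambda>((\<mu>, \<omega>), t). indicator velocities (\<mu>, \<omega>) * (\<omega> * g 0 \<mu> \<omega> t) * (indicator {0..T} t * \<psi> t)"
  shows "integrable lborel W"
    and "(LINT z|lborel. W z) = bracket (\<lambda>\<mu> \<omega>. \<omega> * g_star \<omega>) * measurement T \<psi> g"
proof -
  let ?Z = "bracket (\<lambda>\<mu> \<omega>. \<omega> * g_star \<omega>)"
  obtain C where C: "\<And>x \<mu> \<omega> t. x \<in> {0..1} \<Longrightarrow> \<mu> \<in> {-1..1} \<Longrightarrow> 0 < \<omega> \<Longrightarrow> t \<in> {0..T} \<Longrightarrow>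
      \<bar>g x \<mu> \<omega> t\<bar> \<le> C * g_star \<omega>" "0 \<le> C"
    using kinetic_solution_temperature_bounded[OF g] by metis
  have m: "set_borel_measurable borel (phase_space T) (\<lambda>(x, \<mu>, \<omega>, t). g x \<mu> \<omega> t)"
    using g by (simp add: kinetic_solution_def)
  have \<psi>i: "integrable lborel (\<lambda>t. indicator {0..T} t * \<psi> t)"
    using \<psi> by (simp add: set_integrable_def)
  show W: "integrable lborel W"
  proof (rule Bochner_Integration.integrable_bound)
    show "integrable lborel (\<lambda>(v, t). (C * (indicator velocities v * (snd v * g_star (snd v)))) * (indicator {0..T} t * \<psi> t))"
      by (intro integrable_lborel_mult \<psi>i integrable_mult_right integrable_weight_velocities)
    have "(\<lambda>t. indicator {0..T} t * \<psi> t) \<in> borel_measurable borel"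
      using borel_measurable_integrable[OF \<psi>i] by simp
    then have "(\<lambda>z :: (real \<times> real) \<times> real. snd (fst z) * (indicator {0..T} (snd z) * \<psi> (snd z)))
        \<in> borel_measurable (borel \<Otimes>\<^sub>M borel)"
      unfolding borel_prod[symmetric] by measurable
    then have "(\<lambda>z. (\<lambda>((\<mu>, \<omega>), t). indicator velocities (\<mu>, \<omega>) * (indicator {0..T} t * g 0 \<mu> \<omega> t)) z
        * (snd (fst z) * (indicator {0..T} (snd z) * \<psi> (snd z)))) \<in> borel_measurable borel"
      unfolding borel_prod by (intro borel_measurable_times[OF measurable_boundary_section[OF m]]) auto
    also have "(\<lambda>z. (\<lambda>((\<mu>, \<omega>), t). indicator velocities (\<mu>, \<omega>) * (indicator {0..T} t * g 0 \<mu> \<omega> t)) z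
        * (snd (fst z) * (indicator {0..T} (snd z) * \<psi> (snd z)))) = W"
      by (auto simp: fun_eq_iff W_def indicator_def)
    finally show "W \<in> borel_measurable lborel" by simp
    show "AE z in lborel. norm (W z)
      \<le> norm ((\<lambda>(v, t). (C * (indicator velocities v * (snd v * g_star (snd v)))) * (indicator {0..T} t * \<psi> t)) z)"
    proof (rule AE_I2)
      fix z :: "(real \<times> real) \<times> real"
      obtain \<mu> \<omega> t where z: "z = ((\<mu>, \<omega>), t)" by (metis prod.exhaust)
      show "norm (W z) \<le> norm ((\<lambda>(v, t). (C * (indicator velocities v * (snd v * g_star (snd v))))
          * (indicator {0..T} t * \<psi> t)) z)"
      proof (cases "(\<mu>, \<omega>) \<in> velocities \<and> t \<in> {0..T}")
        case True
        then have "\<omega> * \<bar>g 0 \<mu> \<omega> t\<bar> \<le> \<omega> * (C * g_star \<omega>)"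
          by (intro mult_left_mono C(1)) auto
        from mult_right_mono[OF this, of "\<bar>\<psi> t\<bar>"] show ?thesis
          using True C(2) g_star_nonneg[of \<omega>] by (simp add: z W_def abs_mult mult_ac)
      next
        case False
        then have "W z = 0" by (auto simp: z W_def)
        then show ?thesis by simp
      qed
    qed
  qed
  then have Wp: "integrable (lborel \<Otimes>\<^sub>M lborel) (\<lambda>(v, t). W (v, t))"
    by (simp add: lborel_prod)
  have "(LINT z|lborel. W z) = (LINT t|lborel. LINT v|lborel. W (v, t))"
    using lborel_pair.integral_snd[OF Wp] by (simp add: lborel_prod)
  also have "\<dots> = (LINT t|lborel. ?Z * (indicator {0..T} t *\<^sub>R (temperature g 0 t * \<psi> t)))"
  proof (rule Bochner_Integration.integral_cong[OF refl])
    fix t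
    show "(LINT v|lborel. W (v, t)) = ?Z * (indicator {0..T} t *\<^sub>R (temperature g 0 t * \<psi> t))"
    proof (cases "t \<in> {0..T}")
      case True
      have "(\<lambda>v. W (v, t)) = (\<lambda>v. indicator velocities v * (\<lambda>(\<mu>, \<omega>). \<omega> * g 0 \<mu> \<omega> t) v * \<psi> t)"
        using True by (simp add: fun_eq_iff W_def)
      then have "(LINT v|lborel. W (v, t))
          = (LINT v|lborel. indicator velocities v * (\<lambda>(\<mu>, \<omega>). \<omega> * g 0 \<mu> \<omega> t) v) * \<psi> t"
        by (simp only: integral_mult_left_zero)
      also have "\<dots> = ?Z * temperature g 0 t * \<psi> t"
        using moment_eq_temperature[of g 0 t, OF kinetic_solution_moment[OF g _ True]] by simp
      finally show ?thesis using True by simp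
    next
      case False
      then have "W (v, t) = 0" for v by (auto simp: W_def split: prod.split)
      then show ?thesis using False by simp
    qed
  qed
  also have "\<dots> = ?Z * measurement T \<psi> g"
    by (simp add: measurement_def set_lebesgue_integral_def)
  finally show "(LINT z|lborel. W z) = ?Z * measurement T \<psi> g" .
qed

text \<open>For almost every \<omega> the remaining section is integrable and Fubini splits it. On
  the exceptional null set the iterated integral may have an unrelated value, so it is compared with
  the planar integral only almost everywhere and its measurability is shown separately.\<close>

lemma integral_rotate:
  fixes R :: "(real \<times> real) \<times> real \<Rightarrow> real"
  assumes R: "integrable lborel R"
  shows "integrable lborel (\<lambda>\<omega>. LINT t|lborel. LINT \<mu>|lborel. R ((\<mu>, \<omega>), t))"
    and "(LINT \<omega>|lborel. LINT t|lborel. LINT \<mu>|lborel. R ((\<mu>, \<omega>), t)) = (LINT z|lborel. R z)"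
proof -
  have Rm: "R \<in> borel_measurable borel" using R by auto
  have S: "integrable (lborel \<Otimes>\<^sub>M lborel) (\<lambda>(\<omega>, p). R ((snd p, \<omega>), fst p))"
    using integrable_lborel_transform[OF preserves_lborel_rotate R] by (simp add: lborel_prod case_prod_unfold)
  have eq: "AE \<omega> in lborel. (LINT p|lborel. R ((snd p, \<omega>), fst p)) = (LINT t|lborel. LINT \<mu>|lborel. R ((\<mu>, \<omega>), t))"
    using lborel_pair.AE_integrable_fst[OF S]
  proof eventually_elim
    case (elim \<omega>)
    then have "integrable (lborel \<Otimes>\<^sub>M lborel) (\<lambda>(t, \<mu>). R ((\<mu>, \<omega>), t))"
      by (simp add: lborel_prod case_prod_unfold)
    from lborel_pair.integral_fst[OF this] show ?case
      by (simp add: lborel_prod case_prod_unfold)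
  qed
  have m: "(\<lambda>\<omega>. LINT t|lborel. LINT \<mu>|lborel. R ((\<mu>, \<omega>), t)) \<in> borel_measurable lborel"
  proof (intro lborel.borel_measurable_lebesgue_integral)
    have "R \<in> borel_measurable ((borel \<Otimes>\<^sub>M borel) \<Otimes>\<^sub>M borel)"
      using Rm by (simp add: borel_prod)
    then have "(\<lambda>z. R ((snd z, fst (fst z)), snd (fst z))) \<in> borel_measurable ((borel \<Otimes>\<^sub>M borel) \<Otimes>\<^sub>M borel)"
      by measurable
    then have "(\<lambda>(p, \<mu>). R ((\<mu>, fst p), snd p)) \<in> borel_measurable ((lborel \<Otimes>\<^sub>M lborel) \<Otimes>\<^sub>M lborel)"
      by (simp add: lborel_prod borel_prod case_prod_unfold)
    from lborel.borel_measurable_lebesgue_integral[OF this]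
    show "(\<lambda>(\<omega>, t). LINT \<mu>|lborel. R ((\<mu>, \<omega>), t)) \<in> borel_measurable (lborel \<Otimes>\<^sub>M lborel)"
      by (simp add: case_prod_unfold)
  qed
  have i: "integrable lborel (\<lambda>\<omega>. LINT p|lborel. R ((snd p, \<omega>), fst p))"
    by (rule lborel_pair.integrable_fst[OF S])
  show "integrable lborel (\<lambda>\<omega>. LINT t|lborel. LINT \<mu>|lborel. R ((\<mu>, \<omega>), t))"
    by (rule integrable_cong_AE_imp[OF i m]) (use eq in \<open>auto elim: eventually_mono\<close>)
  have "(LINT \<omega>|lborel. LINT t|lborel. LINT \<mu>|lborel. R ((\<mu>, \<omega>), t)) = (LINT \<omega>|lborel. LINT p|lborel. R ((snd p, \<omega>), fst p))"
    by (rule integral_cong_AE[OF m]) (use i eq in \<open>auto elim: eventually_mono\<close>)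
  also have "\<dots> = (LINT z|lborel. R z)"
    using lborel_pair.integral_fst[OF S] integral_lborel_transform[OF preserves_lborel_rotate Rm]
    by (simp add: lborel_prod case_prod_unfold)
  finally show "(LINT \<omega>|lborel. LINT t|lborel. LINT \<mu>|lborel. R ((\<mu>, \<omega>), t)) = (LINT z|lborel. R z)" .
qed

text \<open>\<open>Linf_norm\<close> converts an extended real to a real, which would send infinite
  values to 0. Here the conversion is faithful: both coefficients lie in [0,1], so the essential
  supremum is at most 1, and it is nonnegative because the half-line is not a null set.\<close>

lemma Linf_norm_reflection:
  assumes "\<eta> \<in> reflection_coefficients" "\<eta>' \<in> reflection_coefficients"
  defines "\<delta> \<equiv> Linf_norm (\<lambda>\<omega>. \<eta>' \<omega> - \<eta> \<omega>)"
  shows "0 \<le> \<delta>" and "AE \<omega> in lborel. 0 < \<omega> \<longrightarrow> \<bar>\<eta>' \<omega> - \<eta> \<omega>\<bar> \<le> \<delta>"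
proof -
  let ?M = "restrict_space lborel {0::real<..}"
  let ?f = "\<lambda>\<omega>. ereal \<bar>\<eta>' \<omega> - \<eta> \<omega>\<bar>"
  have "sets ?M = sets (restrict_space borel {0<..})"
    by (rule sets_restrict_space_cong) simp
  then have m: "\<eta> \<in> borel_measurable ?M" "\<eta>' \<in> borel_measurable ?M"
    using assms by (simp_all add: reflection_coefficients_def cong: measurable_cong_sets)
  then have fm: "?f \<in> borel_measurable ?M"
    by measurable
  have sp: "space ?M = {0<..}" by (simp add: space_restrict_space)
  have le: "AE \<omega> in ?M. ?f \<omega> \<le> esssup ?M ?f"
    by (rule esssup_AE)
  have le1: "esssup ?M ?f \<le> 1"
  proof (rule esssup_I[OF fm], rule AE_I2)
    fix \<omega> assume "\<omega> \<in> space ?M"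
    then have "0 \<le> \<eta> \<omega>" "\<eta> \<omega> \<le> 1" "0 \<le> \<eta>' \<omega>" "\<eta>' \<omega> \<le> 1"
      using assms by (auto simp: reflection_coefficients_def sp)
    then show "?f \<omega> \<le> 1" by (simp add: abs_le_iff one_ereal_def)
  qed
  have ge0: "0 \<le> esssup ?M ?f"
  proof (rule ccontr)
    assume "\<not> 0 \<le> esssup ?M ?f"
    then have "\<not> ?f \<omega> \<le> esssup ?M ?f" for \<omega>
      by (meson abs_ge_zero ereal_less_eq(5) order_trans)
    then have "AE \<omega> in ?M. False"
      using le by simp
    then have "AE \<omega> in lborel. \<omega> \<notin> {0::real<..}"
      by (subst (asm) AE_restrict_space_iff) auto
    then have "AE \<omega> in lborel. \<omega> \<notin> {1..2::real}"
      by (rule eventually_mono) simp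
    then have "{1..2::real} \<in> null_sets lborel"
      by (subst AE_iff_null_sets) auto
    then show False
      by (simp add: null_sets_def)
  qed
  have \<delta>: "ereal \<delta> = esssup ?M ?f"
    using le1 ge0 by (cases "esssup ?M ?f") (auto simp: \<delta>_def Linf_norm_def)
  show "0 \<le> \<delta>"
    using ge0 unfolding \<delta>[symmetric] by simp
  have "AE \<omega> in ?M. \<bar>\<eta>' \<omega> - \<eta> \<omega>\<bar> \<le> \<delta>"
    using le unfolding \<delta>[symmetric] by simp
  then show "AE \<omega> in lborel. 0 < \<omega> \<longrightarrow> \<bar>\<eta>' \<omega> - \<eta> \<omega>\<bar> \<le> \<delta>"
    by (subst (asm) AE_restrict_space_iff) auto
qed

text \<open>Outgoing for the adjoint problem, which runs backward in time and has its data at x = 1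
  prescribed for \<mu> > 0. The sign of \<mu> is kept, as in the integrand of the gradient.\<close>

definition outgoing_flux :: "real \<Rightarrow> (real \<Rightarrow> real \<Rightarrow> real \<Rightarrow> real \<Rightarrow> real) \<Rightarrow> (real \<times> real) \<times> real \<Rightarrow> real" where
  "outgoing_flux T h = (\<lambda>((\<mu>, \<omega>), t). indicator ({-1..<0} \<times> {0<..}) (\<mu>, \<omega>) *
    (indicator {0..T} t * (\<mu> * \<omega> * h 1 \<mu> \<omega> t)))"

text \<open>The pairing of an integrable flux with a bounded factor; the bound matters only on the
  support of the flux.\<close>

lemma integrable_flux_mult:
  fixes k :: "(real \<times> real) \<times> real \<Rightarrow> real"
  assumes J: "integrable lborel (outgoing_flux T h)"
    and k: "k \<in> borel_measurable borel"
    and le: "\<And>\<mu> \<omega> t. \<mu> \<in> {-1..<0} \<Longrightarrow> 0 < \<omega> \<Longrightarrow> t \<in> {0..T} \<Longrightarrow> \<bar>k ((\<mu>, \<omega>), t)\<bar> \<le> C"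
  shows "integrable lborel (\<lambda>z. outgoing_flux T h z * k z)"
proof (rule Bochner_Integration.integrable_bound)
  show "integrable lborel (\<lambda>z. C * outgoing_flux T h z)"
    by (rule integrable_mult_right[OF J])
  show "(\<lambda>z. outgoing_flux T h z * k z) \<in> borel_measurable lborel"
    using borel_measurable_times[OF borel_measurable_integrable[OF J], of k] k by simp
  show "AE z in lborel. norm (outgoing_flux T h z * k z) \<le> norm (C * outgoing_flux T h z)"
  proof (rule AE_I2)
    fix z :: "(real \<times> real) \<times> real"
    obtain \<mu> \<omega> t where z: "z = ((\<mu>, \<omega>), t)" by (metis prod.exhaust)
    show "norm (outgoing_flux T h z * k z) \<le> norm (C * outgoing_flux T h z)"
    proof (cases "\<mu> \<in> {-1..<0} \<and> 0 < \<omega> \<and> t \<in> {0..T}")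
      case True
      then have "\<bar>k z\<bar> \<le> \<bar>C\<bar>" using le[of \<mu> \<omega> t] by (simp add: z)
      from mult_left_mono[OF this abs_ge_zero, of "outgoing_flux T h z"] show ?thesis
        by (simp add: abs_mult mult.commute)
    next
      case False
      then have "outgoing_flux T h z = 0" by (auto simp: z outgoing_flux_def)
      then show ?thesis by simp
    qed
  qed
qed

text \<open>
  A solution is measurable on the phase space only, hence the indicators in \<open>incident_trace\<close>.
\<close>

definition incident_trace :: "real \<Rightarrow> (real \<Rightarrow> real \<Rightarrow> real \<Rightarrow> real \<Rightarrow> real) \<Rightarrow> (real \<times> real) \<times> real \<Rightarrow> real" where
  "incident_trace T g = (\<lambda>((\<mu>, \<omega>), t). indicator velocities (\<mu>, \<omega>) *
    (indicator {0..T} t * g 1 (- \<mu>) \<omega> t) / g_star \<omega>)"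

lemma measurable_omega:
  assumes [measurable]: "f \<in> borel_measurable borel"
  shows "(\<lambda>z. f (snd (fst z))) \<in> borel_measurable (borel :: ((real \<times> real) \<times> real) measure)"
  unfolding borel_prod[symmetric] by measurable

lemma measurable_incident_trace:
  assumes g: "kinetic_solution T g"
  shows "incident_trace T g \<in> borel_measurable borel"
proof -
  have m: "set_borel_measurable borel (phase_space T) (\<lambda>(x, \<mu>, \<omega>, t). g x \<mu> \<omega> t)"
    using g by (simp add: kinetic_solution_def)
  have "(\<lambda>z. (\<lambda>((\<mu>, \<omega>), t). indicator velocities (\<mu>, \<omega>) * (indicator {0..T} t * g 1 \<mu> \<omega> t))
      ((\<lambda>((\<mu>, \<omega>), t). ((- \<mu>, \<omega>), t)) z)) \<in> borel_measurable borel"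
    by (rule measurable_lborel_transform[OF preserves_lborel_reflect measurable_boundary_section[OF m]]) simp
  from borel_measurable_divide[OF this measurable_omega[OF measurable_g_star]]
  have "(\<lambda>z. (\<lambda>((\<mu>, \<omega>), t). indicator velocities (\<mu>, \<omega>) * (indicator {0..T} t * g 1 \<mu> \<omega> t))
      ((\<lambda>((\<mu>, \<omega>), t). ((- \<mu>, \<omega>), t)) z) / g_star (snd (fst z))) \<in> borel_measurable borel" .
  also have "(\<lambda>z. (\<lambda>((\<mu>, \<omega>), t). indicator velocities (\<mu>, \<omega>) * (indicator {0..T} t * g 1 \<mu> \<omega> t))
      ((\<lambda>((\<mu>, \<omega>), t). ((- \<mu>, \<omega>), t)) z) / g_star (snd (fst z))) = incident_trace T g"
    by (auto simp: fun_eq_iff incident_trace_def indicator_def)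
  finally show ?thesis .
qed

lemma incident_trace_bound:
  assumes C: "\<And>x \<mu> \<omega> t. x \<in> {0..1} \<Longrightarrow> \<mu> \<in> {-1..1} \<Longrightarrow> 0 < \<omega> \<Longrightarrow> t \<in> {0..T} \<Longrightarrow>
      \<bar>g x \<mu> \<omega> t\<bar> \<le> C * g_star \<omega>"
    and "\<mu> \<in> {-1..<0}" "0 < \<omega>" "t \<in> {0..T}"
  shows "\<bar>incident_trace T g ((\<mu>, \<omega>), t)\<bar> \<le> C"
  using C[of 1 "- \<mu>" \<omega> t] assms(2-4) g_star_pos[OF assms(3)]
  by (simp add: incident_trace_def divide_le_eq)

text \<open>A reflection coefficient is measurable on the half-line only; extension by zero makes it
  a Borel function on the line.\<close>

lemma measurable_reflection_extension:
  assumes "\<eta> \<in> reflection_coefficients"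
  shows "(\<lambda>\<omega>. indicator {0<..} \<omega> * \<eta> \<omega>) \<in> borel_measurable borel"
  using assms by (simp add: reflection_coefficients_def borel_measurable_restrict_space_iff mult.commute)

text \<open>Green's identity for the difference \<open>d\<close> and \<open>h\<close>. At x = 0,
  \<open>d\<close> vanishes for \<mu> > 0 and \<mu> \<omega> h / \<open>g_star\<close> equals
  \<omega> \<psi> for \<mu> < 0. At x = 1, the part \<mu> > 0 is folded onto \<mu> < 0 by the
  reflection law of \<open>h\<close>, which leaves the flux times d(\<mu>) - \<eta> d(- \<mu>). No
  linearization takes place.\<close>

lemma measurement_difference:
  fixes T :: real and g g' h :: "real \<Rightarrow> real \<Rightarrow> real \<Rightarrow> real \<Rightarrow> real" and \<eta> \<eta>' :: "real \<Rightarrow> real"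
  assumes T: "0 < T" and \<psi>: "set_integrable lborel {0..T} \<psi>"
    and g: "forward_solution T \<phi> \<eta> g" and g': "forward_solution T \<phi> \<eta>' g'"
    and \<eta>: "\<eta> \<in> reflection_coefficients" and h: "adjoint_solution T \<psi> \<eta> h"
    and J: "integrable lborel (outgoing_flux T h)"
  shows "bracket (\<lambda>\<mu> \<omega>. \<omega> * g_star \<omega>) * (measurement T \<psi> g' - measurement T \<psi> g)
    = (LINT z|lborel. outgoing_flux T h z * ((\<eta>' (snd (fst z)) - \<eta> (snd (fst z))) * incident_trace T g' z))"
proof -
  let ?Z = "bracket (\<lambda>\<mu> \<omega>. \<omega> * g_star \<omega>)"
  let ?N = "{-1..<0} \<times> {0<..} :: (real \<times> real) set"
  define d where "d = (\<lambda>x \<mu> \<omega> t. g' x \<mu> \<omega> t - g x \<mu> \<omega> t)"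
  note kg = forward_solution_kinetic[OF g] and kg' = forward_solution_kinetic[OF g']
  have kd: "kinetic_solution T d"
    unfolding d_def by (rule kinetic_solution_diff[OF kg kg'])
  obtain C where C: "\<And>x \<mu> \<omega> t. x \<in> {0..1} \<Longrightarrow> \<mu> \<in> {-1..1} \<Longrightarrow> 0 < \<omega> \<Longrightarrow> t \<in> {0..T} \<Longrightarrow>
      \<bar>d x \<mu> \<omega> t\<bar> \<le> C * g_star \<omega>" "0 \<le> C"
    using kinetic_solution_temperature_bounded[OF kd] by metis
  have dm: "set_borel_measurable borel (phase_space T) (\<lambda>(x, \<mu>, \<omega>, t). d x \<mu> \<omega> t)"
    using kd by (simp add: kinetic_solution_def)
  note hm = adjoint_solution_measurable[OF h]
  define B where "B = (\<lambda>x ((\<mu>, \<omega>), t). indicator velocities (\<mu>, \<omega>) *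
    (indicator {0..T} t * (\<mu> * \<omega> * (d x \<mu> \<omega> t * h x \<mu> \<omega> t / g_star \<omega>))))"
  have Bm: "B x \<in> borel_measurable borel" if x: "x \<in> {0..1}" for x
  proof -
    have w: "(\<lambda>z. fst (fst z) * (snd (fst z) / g_star (snd (fst z))))
        \<in> borel_measurable (borel :: ((real \<times> real) \<times> real) measure)"
      unfolding borel_prod[symmetric] by measurable
    have "(\<lambda>z. (\<lambda>((\<mu>, \<omega>), t). indicator velocities (\<mu>, \<omega>) * (indicator {0..T} t * d x \<mu> \<omega> t)) z
        * (\<lambda>((\<mu>, \<omega>), t). indicator velocities (\<mu>, \<omega>) * (indicator {0..T} t * h x \<mu> \<omega> t)) z
        * (fst (fst z) * (snd (fst z) / g_star (snd (fst z))))) \<in> borel_measurable borel"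
      by (intro borel_measurable_times[OF _ w]
          borel_measurable_times[OF measurable_boundary_section[OF dm x] measurable_boundary_section[OF hm x]])
    also have "(\<lambda>z. (\<lambda>((\<mu>, \<omega>), t). indicator velocities (\<mu>, \<omega>) * (indicator {0..T} t * d x \<mu> \<omega> t)) z
        * (\<lambda>((\<mu>, \<omega>), t). indicator velocities (\<mu>, \<omega>) * (indicator {0..T} t * h x \<mu> \<omega> t)) z
        * (fst (fst z) * (snd (fst z) / g_star (snd (fst z))))) = B x"
      by (auto simp: fun_eq_iff B_def indicator_def)
    finally show ?thesis .
  qed
  have h0: "h 0 \<mu> \<omega> t = \<psi> t * g_star \<omega> / \<mu>" if "\<mu> \<in> {-1..<0}" "0 < \<omega>" "t \<in> {0..<T}" for \<mu> \<omega> t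
    using h that by (simp add: adjoint_solution_def)
  have h1: "h 1 (- \<mu>) \<omega> t = \<eta> \<omega> * h 1 \<mu> \<omega> t" if "\<mu> \<in> {-1..<0}" "0 < \<omega>" "t \<in> {0..T}" for \<mu> \<omega> t
  proof (cases "t = T")
    case True
    then show ?thesis using h that by (simp add: adjoint_solution_def)
  next
    case False
    then have "- \<mu> \<in> {0<..1}" "t \<in> {0..<T}" using that by auto
    moreover have "\<forall>\<mu>\<in>{0<..1}. \<forall>\<omega>>0. \<forall>t\<in>{0..<T}. h 1 \<mu> \<omega> t = \<eta> \<omega> * h 1 (- \<mu>) \<omega> t"
      using h by (simp add: adjoint_solution_def)
    ultimately show ?thesis using that(2) by fastforce
  qed
  have d_in: "d 0 \<mu> \<omega> t = 0" if "\<mu> \<in> {0<..1}" "0 < \<omega>" "t \<in> {0..T}" for \<mu> \<omega> t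
    using g g' that by (cases "t = 0") (auto simp: forward_solution_def d_def)
  \<comment> \<open>Subtracting \<eta> times the incident value of \<open>d\<close> removes
    \<open>g\<close> altogether, because \<open>g\<close> satisfies the reflection law for
    \<eta>.\<close>
  have d_out: "d 1 \<mu> \<omega> t - \<eta> \<omega> * d 1 (- \<mu>) \<omega> t = (\<eta>' \<omega> - \<eta> \<omega>) * g' 1 (- \<mu>) \<omega> t"
    if "\<mu> \<in> {-1..<0}" "0 < \<omega>" "t \<in> {0..T}" for \<mu> \<omega> t
  proof (cases "t = 0")
    case True
    then show ?thesis using g g' that by (simp add: forward_solution_def d_def)
  next
    case False
    then have "g 1 \<mu> \<omega> t = \<eta> \<omega> * g 1 (- \<mu>) \<omega> t" "g' 1 \<mu> \<omega> t = \<eta>' \<omega> * g' 1 (- \<mu>) \<omega> t"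
      using g g' that by (simp_all add: forward_solution_def)
    then show ?thesis by (simp add: d_def algebra_simps)
  qed
  have \<eta>01: "0 \<le> \<eta> \<omega>" "\<eta> \<omega> \<le> 1" if "0 < \<omega>" for \<omega>
    using \<eta> that by (auto simp: reflection_coefficients_def)

  \<comment> \<open>The boundary term at x = 0\<close>
  define W where "W f = (\<lambda>((\<mu>, \<omega>), t). indicator velocities (\<mu>, \<omega>) * (\<omega> * f 0 \<mu> \<omega> t) * (indicator {0..T} t * \<psi> t))"
    for f :: "real \<Rightarrow> real \<Rightarrow> real \<Rightarrow> real \<Rightarrow> real"
  note Wg = measurement_eq_integral[OF kg \<psi> T, folded W_def[of g]]
    and Wg' = measurement_eq_integral[OF kg' \<psi> T, folded W_def[of g']]
  have Wd: "W d = (\<lambda>z. W g' z - W g z)"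
    by (auto simp: fun_eq_iff W_def d_def algebra_simps)
  have Wd_int: "integrable lborel (W d)"
    unfolding Wd by (rule Bochner_Integration.integrable_diff[OF Wg'(1) Wg(1)])
  have Wd_val: "(LINT z|lborel. W d z) = ?Z * (measurement T \<psi> g' - measurement T \<psi> g)"
    unfolding Wd using Wg' Wg by (simp add: right_diff_distrib)
  \<comment> \<open>The two may differ at \<mu> = 0, where no datum for \<open>h\<close> is given,
    and at t = T, where \<open>h\<close> vanishes but \<psi> need not.\<close>
  have BW: "AE z in lborel. W d z = B 0 z"
  proof -
    have "AE \<mu> in lborel. \<mu> \<noteq> (0::real)" "AE \<omega> :: real in lborel. True"
      by (simp_all add: AE_lborel_singleton)
    from AE_lborel_prodI[OF AE_lborel_prodI[OF this] AE_lborel_singleton[of T]] show ?thesis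
    proof (rule eventually_mono)
      fix z :: "(real \<times> real) \<times> real"
      assume a: "(fst (fst z) \<noteq> 0 \<and> True) \<and> snd z \<noteq> T"
      obtain \<mu> \<omega> t where z: "z = ((\<mu>, \<omega>), t)" by (metis prod.exhaust)
      show "W d z = B 0 z"
      proof (cases "(\<mu>, \<omega>) \<in> velocities \<and> t \<in> {0..T}")
        case True
        then consider "\<mu> \<in> {0<..1}" "0 < \<omega>" | "\<mu> \<in> {-1..<0}" "0 < \<omega>" using a z by fastforce
        then show ?thesis
        proof cases
          case 1
          then have "d 0 \<mu> \<omega> t = 0" using True by (intro d_in) auto
          then show ?thesis by (simp add: z W_def B_def)
        next
          case 2
          then have "h 0 \<mu> \<omega> t = \<psi> t * g_star \<omega> / \<mu>" using True a z by (intro h0) auto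
          then show ?thesis using 2 True g_star_pos[OF 2(2)] by (simp add: z W_def B_def)
        qed
      next
        case False
        then show ?thesis by (auto simp: z W_def B_def)
      qed
    qed
  qed
  have B0: "integrable lborel (B 0)"
    by (rule integrable_cong_AE_imp[OF Wd_int _ BW]) (use Bm[of 0] in simp)
  have B0_val: "(LINT z|lborel. B 0 z) = ?Z * (measurement T \<psi> g' - measurement T \<psi> g)"
    unfolding Wd_val[symmetric]
    by (rule integral_cong_AE) (use BW[THEN AE_symmetric] B0 Wd_int in auto)

  \<comment> \<open>The boundary term at x = 1\<close>
  let ?rf = "\<lambda>((\<mu>, \<omega>), t). ((- \<mu>, \<omega>), t) :: (real \<times> real) \<times> real"
  define k1 where "k1 z = (\<lambda>((\<mu>, \<omega>), t). indicator velocities (\<mu>, \<omega>) * (indicator {0..T} t * d 1 \<mu> \<omega> t)) z / g_star (snd (fst z))" for z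
  \<comment> \<open>The factor for the folded part \<mu> > 0. Its minus sign compensates for the
    negative velocity carried by \<open>outgoing_flux\<close> at the reflected point.\<close>
  define k2 where "k2 z = - (indicator {0<..} (snd (fst z)) * \<eta> (snd (fst z))) * incident_trace T d z" for z
  have k1m: "k1 \<in> borel_measurable borel"
    unfolding k1_def by (intro borel_measurable_divide measurable_boundary_section[OF dm] measurable_omega measurable_g_star) simp
  have k2m: "k2 \<in> borel_measurable borel"
    unfolding k2_def by (intro borel_measurable_times borel_measurable_uminus measurable_omega[OF measurable_reflection_extension[OF \<eta>]]
        measurable_incident_trace[OF kd])
  have P1: "integrable lborel (\<lambda>z. outgoing_flux T h z * k1 z)"
  proof (rule integrable_flux_mult[OF J k1m])
    fix \<mu> \<omega> t :: real assume a: "\<mu> \<in> {-1..<0}" "0 < \<omega>" "t \<in> {0..T}"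
    then show "\<bar>k1 ((\<mu>, \<omega>), t)\<bar> \<le> C"
      using C(1)[of 1 \<mu> \<omega> t] g_star_pos[OF a(2)] by (simp add: k1_def divide_le_eq)
  qed
  have P2: "integrable lborel (\<lambda>z. outgoing_flux T h z * k2 z)"
  proof (rule integrable_flux_mult[OF J k2m])
    fix \<mu> \<omega> t :: real assume a: "\<mu> \<in> {-1..<0}" "0 < \<omega>" "t \<in> {0..T}"
    have "\<bar>\<eta> \<omega>\<bar> * \<bar>incident_trace T d ((\<mu>, \<omega>), t)\<bar> \<le> 1 * C"
      using \<eta>01[OF a(2)] incident_trace_bound[OF C(1) a] C(2) by (intro mult_mono) auto
    then show "\<bar>k2 ((\<mu>, \<omega>), t)\<bar> \<le> C"
      using a by (simp add: k2_def abs_mult)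
  qed
  have B1_split: "B 1 z = outgoing_flux T h z * k1 z + outgoing_flux T h (?rf z) * k2 (?rf z)" for z
  proof -
    obtain \<mu> \<omega> t where z: "z = ((\<mu>, \<omega>), t)" by (metis prod.exhaust)
    show ?thesis
    proof (cases "(\<mu>, \<omega>) \<in> velocities \<and> t \<in> {0..T}")
      case True
      then have \<omega>: "0 < \<omega>" by simp
      consider "\<mu> = 0" | "\<mu> \<in> {-1..<0}" | "- \<mu> \<in> {-1..<0}" using True by fastforce
      then show ?thesis
      proof cases
        case 1
        then show ?thesis by (simp add: z B_def outgoing_flux_def)
      next
        case 2
        then show ?thesis using True by (simp add: z B_def outgoing_flux_def k1_def)
      next
        case 3
        then show ?thesis using True h1[of "- \<mu>" \<omega> t]
          by (simp add: z B_def outgoing_flux_def k2_def incident_trace_def)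
      qed
    next
      case False
      then have "B 1 z = 0" "outgoing_flux T h z = 0" "outgoing_flux T h (?rf z) = 0"
        by (auto simp: z B_def outgoing_flux_def)
      then show ?thesis by simp
    qed
  qed
  have P2r: "integrable lborel (\<lambda>z. outgoing_flux T h (?rf z) * k2 (?rf z))"
    by (rule integrable_lborel_transform[OF preserves_lborel_reflect P2])
  have B1: "integrable lborel (B 1)"
    unfolding B1_split[abs_def] by (rule Bochner_Integration.integrable_add[OF P1 P2r])
  have "?Z * (measurement T \<psi> g' - measurement T \<psi> g) = (LINT z|lborel. B 1 z)"
    unfolding B0_val[symmetric] B_def
    by (rule green_identity[OF T kd h B0[unfolded B_def] B1[unfolded B_def], symmetric])
  also have "\<dots> = (LINT z|lborel. outgoing_flux T h z * k1 z)
      + (LINT z|lborel. outgoing_flux T h (?rf z) * k2 (?rf z))"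
    unfolding B1_split by (rule Bochner_Integration.integral_add[OF P1 P2r])
  also have "(LINT z|lborel. outgoing_flux T h (?rf z) * k2 (?rf z)) = (LINT z|lborel. outgoing_flux T h z * k2 z)"
    using borel_measurable_integrable[OF P2]
    by (intro integral_lborel_transform[OF preserves_lborel_reflect, of "\<lambda>z. outgoing_flux T h z * k2 z"]) simp
  also have "(LINT z|lborel. outgoing_flux T h z * k1 z) + (LINT z|lborel. outgoing_flux T h z * k2 z)
      = (LINT z|lborel. outgoing_flux T h z * k1 z + outgoing_flux T h z * k2 z)"
    by (rule Bochner_Integration.integral_add[symmetric, OF P1 P2])
  also have "\<dots> = (LINT z|lborel. outgoing_flux T h z * ((\<eta>' (snd (fst z)) - \<eta> (snd (fst z))) * incident_trace T g' z))"
  proof (rule Bochner_Integration.integral_cong[OF refl])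
    fix z :: "(real \<times> real) \<times> real"
    obtain \<mu> \<omega> t where z: "z = ((\<mu>, \<omega>), t)" by (metis prod.exhaust)
    show "outgoing_flux T h z * k1 z + outgoing_flux T h z * k2 z
      = outgoing_flux T h z * ((\<eta>' (snd (fst z)) - \<eta> (snd (fst z))) * incident_trace T g' z)"
    proof (cases "\<mu> \<in> {-1..<0} \<and> 0 < \<omega> \<and> t \<in> {0..T}")
      case True
      then have "k1 z + k2 z = (d 1 \<mu> \<omega> t - \<eta> \<omega> * d 1 (- \<mu>) \<omega> t) / g_star \<omega>"
        by (simp add: z k1_def k2_def incident_trace_def diff_divide_distrib)
      also have "\<dots> = (\<eta>' \<omega> - \<eta> \<omega>) * incident_trace T g' z"
        using True d_out[of \<mu> \<omega> t] by (simp add: z incident_trace_def)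
      finally show ?thesis
        by (simp add: z flip: distrib_left)
    next
      case False
      then have "outgoing_flux T h z = 0" by (auto simp: z outgoing_flux_def)
      then show ?thesis by simp
    qed
  qed
  finally show ?thesis .
qed

theorem theorem3p2:
  fixes T :: real
    and \<phi> :: "real \<Rightarrow> real \<Rightarrow> real \<Rightarrow> real"
    and \<psi> \<eta> :: "real \<Rightarrow> real"
    and g\<^sub>0 :: "(real \<Rightarrow> real) \<Rightarrow> real \<Rightarrow> real \<Rightarrow> real \<Rightarrow> real \<Rightarrow> real"
    and h :: "real \<Rightarrow> real \<Rightarrow> real \<Rightarrow> real \<Rightarrow> real"
  assumes "0 < T"
    and "set_integrable lborel {0..T} \<psi>"
    and "\<And>\<eta>'. \<eta>' \<in> reflection_coefficients \<Longrightarrow> forward_solution T \<phi> \<eta>' (g\<^sub>0 \<eta>')"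
    and "\<eta> \<in> reflection_coefficients"
    and "adjoint_solution T \<psi> \<eta> h"
  shows "has_frechet_gradient_within
           (\<lambda>\<eta>'. measurement T \<psi> (g\<^sub>0 \<eta>'))
           (\<lambda>\<omega>. 1 / bracket (\<lambda>\<mu> \<omega>. \<omega> * g_star \<omega>) *
              (LBINT t:{0..T}. (LBINT \<mu>:{-1..0}.
                 \<mu> * \<omega> * h 1 \<mu> \<omega> t * g\<^sub>0 \<eta> 1 (-\<mu>) \<omega> t / g_star \<omega>)))
           \<eta> reflection_coefficients"
proof -
  let ?Z = "bracket (\<lambda>\<mu> \<omega>. \<omega> * g_star \<omega>)"
  let ?G = "\<lambda>\<omega>. 1 / ?Z * (LBINT t:{0..T}. (LBINT \<mu>:{-1..0}.
    \<mu> * \<omega> * h 1 \<mu> \<omega> t * g\<^sub>0 \<eta> 1 (-\<mu>) \<omega> t / g_star \<omega>))"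
  let ?F = "\<lambda>\<eta>'. measurement T \<psi> (g\<^sub>0 \<eta>')"
  note T = assms(1) and \<psi> = assms(2) and fwd = assms(3) and \<eta> = assms(4) and h = assms(5)
  note Zp = bracket_weight_pos

  \<comment> \<open>The density of the gradient and its integrability\<close>
  define g where "g = g\<^sub>0 \<eta>"
  have fg: "forward_solution T \<phi> \<eta> g" unfolding g_def by (rule fwd[OF \<eta>])
  note kg = forward_solution_kinetic[OF fg]
  obtain C where C: "\<And>x \<mu> \<omega> t. x \<in> {0..1} \<Longrightarrow> \<mu> \<in> {-1..1} \<Longrightarrow> 0 < \<omega> \<Longrightarrow> t \<in> {0..T} \<Longrightarrow>
      \<bar>g x \<mu> \<omega> t\<bar> \<le> C * g_star \<omega>" "0 \<le> C"
    using kinetic_solution_temperature_bounded[OF kg] by metis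
  define J where "J = outgoing_flux T h"
  have J: "integrable lborel J"
    unfolding J_def outgoing_flux_def by (rule adjoint_solution_trace_integrable[OF T h \<psi>])
  define R where "R z = J z * incident_trace T g z" for z
  have R: "integrable lborel R"
    unfolding R_def J_def
    by (rule integrable_flux_mult[OF J[unfolded J_def] measurable_incident_trace[OF kg] incident_trace_bound[OF C(1)]])
  \<comment> \<open>The range of \<mu> includes 0 on the left, while \<open>R\<close> is supported
    on \<mu> < 0; they agree because the integrand has the factor \<mu>.\<close>
  have GR: "indicator {0<..} \<omega> * ?G \<omega> = 1 / ?Z * (LINT t|lborel. LINT \<mu>|lborel. R ((\<mu>, \<omega>), t))" for \<omega>
  proof -
    have "indicator {0<..} \<omega> * (indicator {0..T} t * (indicator {-1..0} \<mu> *
          (\<mu> * \<omega> * h 1 \<mu> \<omega> t * g\<^sub>0 \<eta> 1 (-\<mu>) \<omega> t / g_star \<omega>))) = R ((\<mu>, \<omega>), t)" for \<mu> t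
      by (auto simp: R_def J_def outgoing_flux_def incident_trace_def g_def indicator_def)
    then have "(LINT t|lborel. LINT \<mu>|lborel. R ((\<mu>, \<omega>), t))
        = indicator {0<..} \<omega> * (LINT t|lborel. indicator {0..T} t * (LINT \<mu>|lborel. indicator {-1..0} \<mu> *
          (\<mu> * \<omega> * h 1 \<mu> \<omega> t * g\<^sub>0 \<eta> 1 (-\<mu>) \<omega> t / g_star \<omega>)))"
      by (simp only: integral_mult_right_zero flip: \<open>\<And>\<mu> t. _ = R ((\<mu>, \<omega>), t)\<close>)
    then show ?thesis
      by (simp add: set_lebesgue_integral_def)
  qed
  have "integrable lborel (\<lambda>\<omega>. indicator {0<..} \<omega> * ?G \<omega>)"
    unfolding GR by (intro integrable_mult_right integral_rotate(1)[OF R])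
  then have G_int: "set_integrable lborel {0<..} ?G"
    by (simp add: set_integrable_def)
  \<comment> \<open>The constant of \<open>kinetic_solution_stability\<close> for \<beta> = \<delta>
    C, with \<delta> factored out.\<close>
  define K where "K = C * (1 + exp T / (1 - relaxation_ratio))"
  have K: "0 \<le> K"
    unfolding K_def using C(2) relaxation_ratio(2) by (intro mult_nonneg_nonneg add_nonneg_nonneg) auto
  \<comment> \<open>The constant of the quadratic remainder: one factor \<delta> comes from \<eta>'
    - \<eta>, the other from the stability estimate with constant \<open>K\<close>, and both
    multiply the L1 norm of the flux.\<close>
  define Q where "Q = K / ?Z * (LINT z|lborel. \<bar>J z\<bar>)"
  have Q: "0 \<le> Q"
    unfolding Q_def using K Zp by (intro mult_nonneg_nonneg divide_nonneg_pos integral_nonneg_AE) auto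

  \<comment> \<open>The quadratic remainder\<close>
  have main: "\<bar>?F \<eta>' - ?F \<eta> - (LBINT \<omega>:{0<..}. ?G \<omega> * (\<eta>' \<omega> - \<eta> \<omega>))\<bar>
      \<le> Q * (Linf_norm (\<lambda>\<omega>. \<eta>' \<omega> - \<eta> \<omega>))\<^sup>2" if \<eta>': "\<eta>' \<in> reflection_coefficients" for \<eta>'
  proof -
    define \<delta> where "\<delta> = Linf_norm (\<lambda>\<omega>. \<eta>' \<omega> - \<eta> \<omega>)"
    note \<delta> = Linf_norm_reflection[OF \<eta> \<eta>', folded \<delta>_def]
    define g' where "g' = g\<^sub>0 \<eta>'"
    have fg': "forward_solution T \<phi> \<eta>' g'" unfolding g'_def by (rule fwd[OF \<eta>'])
    note kg' = forward_solution_kinetic[OF fg']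
    define d where "d = (\<lambda>x \<mu> \<omega> t. g' x \<mu> \<omega> t - g x \<mu> \<omega> t)"
    have kd: "kinetic_solution T d"
      unfolding d_def by (rule kinetic_solution_diff[OF kg kg'])
    have stab: "\<bar>d x \<mu> \<omega> t\<bar> \<le> \<delta> * C * (1 + exp T / (1 - relaxation_ratio)) * g_star \<omega>"
      if "0 < \<omega> \<longrightarrow> \<bar>\<eta>' \<omega> - \<eta> \<omega>\<bar> \<le> \<delta>" "0 < \<omega>" "\<mu> \<in> {-1..1}" "\<mu> \<noteq> 0" "x \<in> {0..1}" "t \<in> {0..T}"
      for x \<mu> \<omega> t
    proof (rule kinetic_solution_stability[where P="\<lambda>\<omega>. 0 < \<omega> \<longrightarrow> \<bar>\<eta>' \<omega> - \<eta> \<omega>\<bar> \<le> \<delta>", OF T kd])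
      show "d 0 \<mu> \<omega> t = 0" if "\<mu> \<in> {0<..1}" "0 < \<omega>" "t \<in> {0<..T}" for \<mu> \<omega> t
        using fg fg' that by (simp add: forward_solution_def d_def)
      show "\<bar>d 1 \<mu> \<omega> t\<bar> \<le> \<bar>d 1 (- \<mu>) \<omega> t\<bar> + \<delta> * C * g_star \<omega>"
        if P: "0 < \<omega> \<longrightarrow> \<bar>\<eta>' \<omega> - \<eta> \<omega>\<bar> \<le> \<delta>" and a: "\<mu> \<in> {-1..<0}" "0 < \<omega>" "t \<in> {0<..T}" for \<mu> \<omega> t
      proof -
        \<comment> \<open>Here the defect is attached to \<open>g\<close> rather than to
          \<open>g'\<close>: its bound \<open>C\<close> must not depend on \<eta>', and \<eta>'
          \<le> 1 keeps the reflected difference from growing.\<close>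
        have "d 1 \<mu> \<omega> t = \<eta>' \<omega> * d 1 (- \<mu>) \<omega> t + (\<eta>' \<omega> - \<eta> \<omega>) * g 1 (- \<mu>) \<omega> t"
          using fg fg' a by (simp add: forward_solution_def d_def algebra_simps)
        then have "\<bar>d 1 \<mu> \<omega> t\<bar> \<le> \<bar>\<eta>' \<omega>\<bar> * \<bar>d 1 (- \<mu>) \<omega> t\<bar> + \<bar>\<eta>' \<omega> - \<eta> \<omega>\<bar> * \<bar>g 1 (- \<mu>) \<omega> t\<bar>"
          by (metis abs_mult abs_triangle_ineq)
        also have "\<dots> \<le> 1 * \<bar>d 1 (- \<mu>) \<omega> t\<bar> + \<delta> * (C * g_star \<omega>)"
          using \<eta>' P a \<delta>(1) by (intro add_mono mult_mono C(1)) (auto simp: reflection_coefficients_def)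
        finally show ?thesis by (simp add: mult.assoc)
      qed
    qed (use that \<delta> C(2) in auto)
    \<comment> \<open>The perturbation extended by zero. It agrees with \<eta>' - \<eta> on the
      half-line, and \<open>J\<close> vanishes elsewhere.\<close>
    define \<Delta> where "\<Delta> \<omega> = indicator {0<..} \<omega> * \<eta>' \<omega> - indicator {0<..} \<omega> * \<eta> \<omega>" for \<omega>
    have \<Delta>m: "(\<lambda>z. \<Delta> (snd (fst z))) \<in> borel_measurable (borel :: ((real \<times> real) \<times> real) measure)"
      unfolding \<Delta>_def
      by (intro borel_measurable_diff measurable_omega[OF measurable_reflection_extension] \<eta> \<eta>')
    have \<Delta>: "\<Delta> \<omega> = \<eta>' \<omega> - \<eta> \<omega>" "\<bar>\<Delta> \<omega>\<bar> \<le> 1" if "0 < \<omega>" for \<omega>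
    proof -
      show "\<Delta> \<omega> = \<eta>' \<omega> - \<eta> \<omega>" using that by (simp add: \<Delta>_def)
      moreover have "0 \<le> \<eta> \<omega>" "\<eta> \<omega> \<le> 1" "0 \<le> \<eta>' \<omega>" "\<eta>' \<omega> \<le> 1"
        using \<eta> \<eta>' that by (auto simp: reflection_coefficients_def)
      ultimately show "\<bar>\<Delta> \<omega>\<bar> \<le> 1" by (simp add: abs_le_iff)
    qed
    have int_\<Delta>: "integrable lborel (\<lambda>z. J z * (\<Delta> (snd (fst z)) * incident_trace T f z))"
      if f: "kinetic_solution T f" for f
    proof -
      \<comment> \<open>This constant depends on \<open>f\<close>, hence possibly on \<eta>'; it
        serves integrability alone and does not enter \<open>Q\<close>.\<close>
      obtain C where C: "\<And>x \<mu> \<omega> t. x \<in> {0..1} \<Longrightarrow> \<mu> \<in> {-1..1} \<Longrightarrow> 0 < \<omega> \<Longrightarrow> t \<in> {0..T} \<Longrightarrow>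
          \<bar>f x \<mu> \<omega> t\<bar> \<le> C * g_star \<omega>" "0 \<le> C"
        using kinetic_solution_temperature_bounded[OF f] by metis
      show ?thesis
        unfolding J_def
      proof (rule integrable_flux_mult[OF J[unfolded J_def]])
        show "(\<lambda>z. \<Delta> (snd (fst z)) * incident_trace T f z) \<in> borel_measurable borel"
          by (rule borel_measurable_times[OF \<Delta>m measurable_incident_trace[OF f]])
        fix \<mu> \<omega> t :: real assume a: "\<mu> \<in> {-1..<0}" "0 < \<omega>" "t \<in> {0..T}"
        have "\<bar>\<Delta> \<omega>\<bar> * \<bar>incident_trace T f ((\<mu>, \<omega>), t)\<bar> \<le> 1 * C"
          using \<Delta>(2)[OF a(2)] incident_trace_bound[OF C(1) a] by (intro mult_mono) auto
        then show "\<bar>\<Delta> (snd (fst ((\<mu>, \<omega>), t))) * incident_trace T f ((\<mu>, \<omega>), t)\<bar> \<le> C"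
          by (simp add: abs_mult)
      qed
    qed
    have J0: "J z = 0" if "snd (fst z) \<le> 0" for z
      using that by (auto simp: J_def outgoing_flux_def split: prod.split)
    have "?Z * (?F \<eta>' - ?F \<eta>)
        = (LINT z|lborel. J z * ((\<eta>' (snd (fst z)) - \<eta> (snd (fst z))) * incident_trace T g' z))"
      using measurement_difference[OF T \<psi> fg fg' \<eta> h J[unfolded J_def]] by (simp add: J_def g_def g'_def)
    also have "\<dots> = (LINT z|lborel. J z * (\<Delta> (snd (fst z)) * incident_trace T g' z))"
    proof (rule Bochner_Integration.integral_cong[OF refl])
      show "J z * ((\<eta>' (snd (fst z)) - \<eta> (snd (fst z))) * incident_trace T g' z)
          = J z * (\<Delta> (snd (fst z)) * incident_trace T g' z)" for z
        using J0[of z] \<Delta>(1)[of "snd (fst z)"] by (cases "0 < snd (fst z)") auto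
    qed
    finally have F_eq: "?Z * (?F \<eta>' - ?F \<eta>) = (LINT z|lborel. J z * (\<Delta> (snd (fst z)) * incident_trace T g' z))" .
    have "?Z * (LBINT \<omega>:{0<..}. ?G \<omega> * (\<eta>' \<omega> - \<eta> \<omega>))
        = (LINT \<omega>|lborel. ?Z * ((indicator {0<..} \<omega> * ?G \<omega>) * \<Delta> \<omega>))"
      unfolding set_lebesgue_integral_def integral_mult_right_zero
      by (intro arg_cong[where f="(*) ?Z"] Bochner_Integration.integral_cong[OF refl])
        (simp add: \<Delta>_def indicator_def)
    also have "\<dots> = (LINT \<omega>|lborel. LINT t|lborel. LINT \<mu>|lborel. R ((\<mu>, \<omega>), t) * \<Delta> \<omega>)"
      unfolding GR integral_mult_left_zero using Zp by simp
    also have "\<dots> = (LINT z|lborel. R z * \<Delta> (snd (fst z)))"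
    proof -
      have "integrable lborel (\<lambda>z. R z * \<Delta> (snd (fst z)))"
        using int_\<Delta>[OF kg] by (simp add: R_def mult_ac)
      from integral_rotate(2)[OF this] show ?thesis by simp
    qed
    also have "\<dots> = (LINT z|lborel. J z * (\<Delta> (snd (fst z)) * incident_trace T g z))"
      by (simp add: R_def mult_ac)
    finally have G_eq: "?Z * (LBINT \<omega>:{0<..}. ?G \<omega> * (\<eta>' \<omega> - \<eta> \<omega>))
        = (LINT z|lborel. J z * (\<Delta> (snd (fst z)) * incident_trace T g z))" .
    have diff_eq: "?Z * (?F \<eta>' - ?F \<eta> - (LBINT \<omega>:{0<..}. ?G \<omega> * (\<eta>' \<omega> - \<eta> \<omega>)))
        = (LINT z|lborel. J z * (\<Delta> (snd (fst z)) * incident_trace T g' z)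
            - J z * (\<Delta> (snd (fst z)) * incident_trace T g z))"
      unfolding right_diff_distrib[of ?Z "?F \<eta>' - ?F \<eta>"] F_eq G_eq
      by (rule Bochner_Integration.integral_diff[symmetric, OF int_\<Delta>[OF kg'] int_\<Delta>[OF kg]])
    have "\<bar>LINT z|lborel. J z * (\<Delta> (snd (fst z)) * incident_trace T g' z)
            - J z * (\<Delta> (snd (fst z)) * incident_trace T g z)\<bar> \<le> (LINT z|lborel. \<delta>\<^sup>2 * K * \<bar>J z\<bar>)"
    proof -
      let ?E = "\<lambda>z. J z * (\<Delta> (snd (fst z)) * incident_trace T g' z)
            - J z * (\<Delta> (snd (fst z)) * incident_trace T g z)"
      have E: "integrable lborel ?E"
        by (rule Bochner_Integration.integrable_diff[OF int_\<Delta>[OF kg'] int_\<Delta>[OF kg]])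
      have "AE z in lborel. norm (?E z) \<le> \<delta>\<^sup>2 * K * \<bar>J z\<bar>"
      proof -
        have "AE \<mu> :: real in lborel. True" "AE t :: real in lborel. True" by simp_all
        from AE_lborel_prodI[OF AE_lborel_prodI[OF this(1) \<delta>(2)] this(2)] show ?thesis
        proof (rule eventually_mono)
          fix z :: "(real \<times> real) \<times> real"
          assume P: "(True \<and> (0 < snd (fst z) \<longrightarrow> \<bar>\<eta>' (snd (fst z)) - \<eta> (snd (fst z))\<bar> \<le> \<delta>)) \<and> True"
          obtain \<mu> \<omega> t where z: "z = ((\<mu>, \<omega>), t)" by (metis prod.exhaust)
          show "norm (?E z) \<le> \<delta>\<^sup>2 * K * \<bar>J z\<bar>"
          proof (cases "\<mu> \<in> {-1..<0} \<and> 0 < \<omega> \<and> t \<in> {0..T}")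
            case True
            then have \<omega>: "0 < \<omega>" by simp
            have "\<bar>\<Delta> \<omega>\<bar> \<le> \<delta>" using P \<omega> \<Delta>(1)[OF \<omega>] by (simp add: z)
            moreover have "\<bar>incident_trace T g' z - incident_trace T g z\<bar> \<le> \<delta> * K"
            proof -
              have "\<bar>d 1 (- \<mu>) \<omega> t\<bar> \<le> \<delta> * K * g_star \<omega>"
                using stab[of \<omega> "- \<mu>" 1 t] P True by (simp add: z K_def mult_ac)
              then show ?thesis
                using True g_star_pos[OF \<omega>]
                by (simp add: z incident_trace_def d_def divide_le_eq flip: diff_divide_distrib)
            qed
            ultimately have "\<bar>\<Delta> \<omega>\<bar> * \<bar>incident_trace T g' z - incident_trace T g z\<bar> \<le> \<delta> * (\<delta> * K)"
              using \<delta>(1) by (intro mult_mono) auto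
            from mult_left_mono[OF this abs_ge_zero, of "J z"]
            have "\<bar>J z\<bar> * (\<bar>\<Delta> \<omega>\<bar> * \<bar>incident_trace T g' z - incident_trace T g z\<bar>) \<le> \<delta>\<^sup>2 * K * \<bar>J z\<bar>"
              by (simp add: power2_eq_square mult_ac)
            moreover have "?E z = J z * (\<Delta> \<omega> * (incident_trace T g' z - incident_trace T g z))"
              by (simp add: z algebra_simps)
            ultimately show ?thesis
              by (simp only: real_norm_def abs_mult)
          next
            case False
            then have "J z = 0" by (auto simp: z J_def outgoing_flux_def)
            then show ?thesis by simp
          qed
        qed
      qed
      then have "(LINT z|lborel. norm (?E z)) \<le> (LINT z|lborel. \<delta>\<^sup>2 * K * \<bar>J z\<bar>)"
        using E J by (intro integral_mono_AE) auto
      then show ?thesis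
        using integral_norm_bound[of lborel ?E] by (simp only: real_norm_def)
    qed
    also have "\<dots> = ?Z * (Q * \<delta>\<^sup>2)"
      using Zp by (simp add: Q_def)
    finally have "\<bar>?Z * (?F \<eta>' - ?F \<eta> - (LBINT \<omega>:{0<..}. ?G \<omega> * (\<eta>' \<omega> - \<eta> \<omega>)))\<bar> \<le> ?Z * (Q * \<delta>\<^sup>2)"
      unfolding diff_eq .
    then have "?Z * \<bar>?F \<eta>' - ?F \<eta> - (LBINT \<omega>:{0<..}. ?G \<omega> * (\<eta>' \<omega> - \<eta> \<omega>))\<bar> \<le> ?Z * (Q * \<delta>\<^sup>2)"
      by (simp only: abs_mult abs_of_pos[OF Zp])
    then show ?thesis
      unfolding \<delta>_def by (rule mult_left_le_imp_le[OF _ Zp])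
  qed

  \<comment> \<open>From the quadratic bound to the derivative\<close>
  show ?thesis
    unfolding has_frechet_gradient_within_def
  proof (intro conjI allI impI G_int)
    fix \<epsilon> :: real assume \<epsilon>: "0 < \<epsilon>"
    show "\<exists>d>0. \<forall>\<eta>'\<in>reflection_coefficients. Linf_norm (\<lambda>\<omega>. \<eta>' \<omega> - \<eta> \<omega>) < d \<longrightarrow>
        \<bar>?F \<eta>' - ?F \<eta> - (LBINT \<omega>:{0<..}. ?G \<omega> * (\<eta>' \<omega> - \<eta> \<omega>))\<bar>
          \<le> \<epsilon> * Linf_norm (\<lambda>\<omega>. \<eta>' \<omega> - \<eta> \<omega>)"
    proof (intro exI[of _ "\<epsilon> / (Q + 1)"] conjI ballI impI)
      \<comment> \<open>The 1 in the denominator covers the case Q = 0; for \<delta> below this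
        threshold Q \<delta>^2 is at most \<epsilon> \<delta>.\<close>
      show "0 < \<epsilon> / (Q + 1)" using \<epsilon> Q by simp
      fix \<eta>' assume \<eta>': "\<eta>' \<in> reflection_coefficients"
      let ?\<delta> = "Linf_norm (\<lambda>\<omega>. \<eta>' \<omega> - \<eta> \<omega>)"
      assume "?\<delta> < \<epsilon> / (Q + 1)"
      then have "?\<delta> * (Q + 1) \<le> \<epsilon>" using Q by (simp add: less_divide_eq less_imp_le)
      moreover have \<delta>: "0 \<le> ?\<delta>" by (rule Linf_norm_reflection(1)[OF \<eta> \<eta>'])
      ultimately have "Q * ?\<delta> \<le> \<epsilon>" by (simp add: algebra_simps)
      from mult_right_mono[OF this \<delta>] have "Q * ?\<delta>\<^sup>2 \<le> \<epsilon> * ?\<delta>"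
        by (simp add: power2_eq_square mult.assoc)
      then show "\<bar>?F \<eta>' - ?F \<eta> - (LBINT \<omega>:{0<..}. ?G \<omega> * (\<eta>' \<omega> - \<eta> \<omega>))\<bar> \<le> \<epsilon> * ?\<delta>"
        using main[OF \<eta>'] by simp
    qed
  qed
qed

end
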